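(* For all positive integers $n$, $$\mathtt{SCG}(\beta(n,n,\infty))=\Omega\left(\frac{\beta(n,n,\infty)}{n\log n}\right).$$
   Context: Directed sparsest cut: given a directed graph $G=(V,E)$ and demand pairs $P\subseteq V\times V$, for an edge set $E'\subseteq E$ let $P_{E'}\subseteq P$ be the set of pairs $(s,t)$ with no $s\leadsto t$ path in $G\setminus E'$; $\textsc{SCut}(G,P)$ is the minimum of $|E'|/|P_{E'}|$ over $E'$ with $P_{E'}\neq\emptyset$. Maximum concurrent flow: with unit capacity on every edge, choose for each $(s_i,t_i)\in P$ a flow $f_i$ from $s_i$ to $t_i$ (conserved elsewhere) such that the total flow on each edge is at most $1$; $\textsc{MCFlow}(G,P)$ is the maximum over such choices of $\min_i|f_i|$, where $|f_i|$ is the value of $f_i$. $\mathtt{SCG}(N)$ is the least integer $k$ such that for every $N$-node directed graph $G$ and every set of demand pairs $P$ (of any size), $\textsc{SCut}(G,P)\le k\cdot\textsc{MCFlow}(G,P)$. A path system is $S=(V,\Pi)$ with $V$ a finite set of nodes and $\Pi$ a multiset of node sequences (paths), each containing each node at most once; size $\|S\|=\sum_\pi|\pi|$ ($|\pi|$ = number of nodes). Write $x<_\pi y$ if $x$ strictly precedes $y$ in $\pi$. A $b$-bridge: $b$ distinct nodes $v_1,\dots,v_b$ and $b$ distinct paths $\pi_1,\dots,\pi_b$ with $v_i<_{\pi_i}v_{i+1}$ ($1\le i\le b-1$) and $v_1<_{\pi_b}v_b$. Bridge girth = least $b$ admitting a $b$-bridge ($\infty$ if none). $\beta(n,p,k)$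 = maximum size of a path system with $n$ nodes, $p$ paths and bridge girth $>k$. *)

theory Defs
  imports Complex_Main "HOL-Library.Landau_Symbols" "HOL-Library.Extended_Nat"
begin

definition separated :: "('v \<times> 'v) set \<Rightarrow> ('v \<times> 'v) set \<Rightarrow> ('v \<times> 'v) set \<Rightarrow> ('v \<times> 'v) set" where
  "separated E P E' = {(s,t) \<in> P. (s,t) \<notin> (E - E')\<^sup>*}"

definition SCut :: "('v \<times> 'v) set \<Rightarrow> ('v \<times> 'v) set \<Rightarrow> real" where
  "SCut E P = Min {real (card E') / real (card (separated E P E')) | E'. E' \<subseteq> E \<and> separated E P E' \<noteq> {}}"

definition flow_value :: "('v \<times> 'v) set \<Rightarrow> (('v \<times> 'v) \<Rightarrow> real) \<Rightarrow> 'v \<Rightarrow> real" where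
  "flow_value E g v = (\<Sum>e\<in>{e\<in>E. fst e = v}. g e) - (\<Sum>e\<in>{e\<in>E. snd e = v}. g e)"

definition feasible_mcf :: "'v set \<Rightarrow> ('v \<times> 'v) set \<Rightarrow> ('v \<times> 'v) set \<Rightarrow> (('v \<times> 'v) \<Rightarrow> ('v \<times> 'v) \<Rightarrow> real) \<Rightarrow> bool" where
  "feasible_mcf V E P f \<longleftrightarrow>
     (\<forall>p\<in>P. \<forall>e\<in>E. f p e \<ge> 0) \<and>
     (\<forall>p\<in>P. \<forall>v\<in>V. v \<noteq> fst p \<and> v \<noteq> snd p \<longrightarrow> flow_value E (f p) v = 0) \<and>
     (\<forall>e\<in>E. (\<Sum>p\<in>P. f p e) \<le> 1)"

definition MCFlow :: "'v set \<Rightarrow> ('v \<times> 'v) set \<Rightarrow> ('v \<times> 'v) set \<Rightarrow> real" where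
  "MCFlow V E P = Sup {Min ((\<lambda>p. flow_value E (f p) (fst p)) ` P) | f. feasible_mcf V E P f}"

definition SCG :: "nat \<Rightarrow> nat" where
  "SCG N = (LEAST k::nat. \<forall>(V::nat set) E P.
      finite V \<and> card V = N \<and> E \<subseteq> V \<times> V \<and> P \<subseteq> V \<times> V \<and> P \<noteq> {} \<and>
      (\<forall>(s,t)\<in>P. s \<noteq> t)
      \<longrightarrow> SCut E P \<le> real k * MCFlow V E P)"

text \<open>The multiset of paths is represented by a list of paths (node lists);
  distinct paths means distinct list indices.\<close>

definition path_system :: "'a set \<Rightarrow> 'a list list \<Rightarrow> bool" where
  "path_system V Pi \<longleftrightarrow> finite V \<and> (\<forall>\<pi>\<in>set Pi. distinct \<pi> \<and> set \<pi> \<subseteq> V)"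

definition ps_size :: "'a list list \<Rightarrow> nat" where
  "ps_size Pi = (\<Sum>\<pi>\<leftarrow>Pi. length \<pi>)"

definition precedes :: "'a list \<Rightarrow> 'a \<Rightarrow> 'a \<Rightarrow> bool" where
  "precedes \<pi> x y \<longleftrightarrow> (\<exists>i j. i < j \<and> j < length \<pi> \<and> \<pi> ! i = x \<and> \<pi> ! j = y)"

definition has_bridge :: "'a set \<Rightarrow> 'a list list \<Rightarrow> nat \<Rightarrow> bool" where
  "has_bridge V Pi b \<longleftrightarrow> b \<ge> 1 \<and> (\<exists>(v::nat \<Rightarrow> 'a) (idx::nat \<Rightarrow> nat).
     inj_on v {1..b} \<and> v ` {1..b} \<subseteq> V \<and>
     inj_on idx {1..b} \<and> (\<forall>i\<in>{1..b}. idx i < length Pi) \<and>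
     (\<forall>i\<in>{1..<b}. precedes (Pi ! idx i) (v i) (v (Suc i))) \<and>
     precedes (Pi ! idx b) (v 1) (v b))"

definition girth_gt :: "'a set \<Rightarrow> 'a list list \<Rightarrow> enat \<Rightarrow> bool" where
  "girth_gt V Pi k \<longleftrightarrow> (\<forall>b::nat. enat b \<le> k \<longrightarrow> \<not> has_bridge V Pi b)"

text \<open>Path systems with n nodes: WLOG node set {..<n}.\<close>
definition beta :: "nat \<Rightarrow> nat \<Rightarrow> enat \<Rightarrow> nat" where
  "beta n p k = Max {ps_size Pi | Pi. path_system {..<n} Pi \<and> length Pi = p \<and> girth_gt {..<n} Pi k}"

end

theory Submission
  imports Defs "HOL-Library.Countable" "HOL-Library.FuncSet" "HOL-Real_Asymp.Real_Asymp"
begin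

text \<open>
  Let S be an extremal bridge-free system with n nodes, n paths and size B, and put d = B / n.

  A bridge uses distinct paths, so S may still contain directed cycles. These can be removed at the
  cost of half of the size: if x precedes y on a path, then walks with distinct labels from x and to y
  that use disjoint random sets of paths cannot meet, so one of the two balls they sweep out contains
  at most half of the nodes, and a random stopping time makes its boundary small. Recursive cutting
  along such balls leaves an acyclic subsystem, in which two nodes of a path are joined by no walk
  along the other paths.

  Cut the remaining paths into pieces of length l, proportional to d, and split the nodes into copies
  of degree O(l). Every copy becomes a cloud of h cells, h proportional to l; a cell is an edge of
  capacity one. Each piece orders the cells of each of its nodes by levels 0, ..., h - 1 with a random
  cyclic shift, and its demand must pass cells of levels 0, ..., h - 1 in turn, moving forward along
  the piece; no shortcuts exist by acyclicity, so the concurrent flow is O(1). A set K of cells blocks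
  a piece only if it contains half of the cells of half of its nodes, or with probability exp(-l/8);
  a union bound over all K shows that K blocks O(|K| log n / l) demands.

  Finally d is at least a power of n by an explicit system of lines in a box, which absorbs the
  polylogarithmic terms.
\<close>

subsection \<open>Flows, cuts and the gap\<close>

text \<open>A demand must pass h of the |X| h cells, so the flow is at most |X| / p, while every cut
  has ratio at least of order l / log n. With l of order B / n and with |X| and p of order n, the
  gap is B / (n log n). The cloud size h is forced from both sides: |X| h has to stay below the B
  nodes that are available, and disabling half of a cloud must cost about as many cells as there are
  pieces through it, so that no node is a cheap cut.

  Bridge girth alone does not exclude shortcuts that use one path repeatedly; in an acyclic system
  such repetitions can be skipped, hence the first stage.

  Balls grow along short random lists because the two walks must have disjoint labels. A path that
  is already used cannot be charged to the growth of the ball and is charged to its nodes instead.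
  With lists of length about n / (32 ln n) this takes a fraction of order 1 / log n of the degrees,
  and the growth costs O(log^2 n) per node. Over log n rounds a quarter of the size is lost to the
  former, and n times a power of log n to the latter, which is why d must exceed every power of log
  n.\<close>

lemma flow_value_add:
  "finite E \<Longrightarrow> flow_value E (\<lambda>e. f e + g e) v = flow_value E f v + flow_value E g v"
  by (simp add: flow_value_def sum.distrib)

lemma flow_value_scale:
  "flow_value E (\<lambda>e. c * f e) v = c * flow_value E f v"
  by (simp add: flow_value_def sum_distrib_left right_diff_distrib)

lemma flow_value_single_edge:
  assumes "finite E" "(y, z) \<in> E"
  shows "flow_value E (\<lambda>e. of_bool (e = (y, z))) v = of_bool (v = y) - of_bool (v = z)"
proof -
  have 1: "(\<Sum>e\<in>{e\<in>E. fst e = v}. of_bool (e = (y, z)) :: real) = of_bool (v = y)"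
    using assms by (auto simp: of_bool_def)
  have 2: "(\<Sum>e\<in>{e\<in>E. snd e = v}. of_bool (e = (y, z)) :: real) = of_bool (v = z)"
    using assms by (auto simp: of_bool_def)
  show ?thesis by (simp add: flow_value_def 1 2)
qed

lemma relpow_unit_flow:
  assumes "finite E" "(s, t) \<in> E ^^ k"
  shows "\<exists>g. (\<forall>e. 0 \<le> g e \<and> g e \<le> real k) \<and>
    (\<forall>v. flow_value E g v = of_bool (v = s) - of_bool (v = t))"
  using assms(2)
proof (induction k arbitrary: t)
  case 0
  then show ?case by (intro exI[of _ "\<lambda>_. 0"]) (simp add: flow_value_def)
next
  case (Suc k)
  then obtain y where y: "(s, y) \<in> E ^^ k" "(y, t) \<in> E" by auto
  from Suc.IH[OF y(1)] obtain g where g: "\<forall>e. 0 \<le> g e \<and> g e \<le> real k"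
    "\<forall>v. flow_value E g v = of_bool (v = s) - of_bool (v = y)" by blast
  have g': "0 \<le> g e" "g e \<le> real k" for e using g(1) by blast+
  define g1 where "g1 e = g e + of_bool (e = (y, t))" for e
  have "0 \<le> g1 e \<and> g1 e \<le> real (Suc k)" for e
    using g'[of e] by (cases "e = (y, t)") (auto simp: g1_def)
  moreover have "flow_value E g1 v = of_bool (v = s) - of_bool (v = t)" for v
    unfolding g1_def
    by (simp add: flow_value_add[OF assms(1)] flow_value_single_edge[OF assms(1) y(2)] g(2))
  ultimately show ?case by blast
qed

lemma rtrancl_unit_flow:
  assumes "finite E" "(s, t) \<in> E\<^sup>*"
  obtains g where "\<And>e. 0 \<le> g e" "\<And>e. g e \<le> real (card E)"
    "\<And>v. flow_value E g v = of_bool (v = s) - of_bool (v = t)"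
proof -
  from assms rtrancl_finite_eq_relpow[OF assms(1)] obtain k where k: "k \<le> card E" "(s, t) \<in> E ^^ k"
    by auto
  from relpow_unit_flow[OF assms(1) k(2)] obtain g where
    "\<forall>e. 0 \<le> g e \<and> g e \<le> real k" "\<forall>v. flow_value E g v = of_bool (v = s) - of_bool (v = t)" by blast
  moreover from this have "g e \<le> real (card E)" for e using k(1) by (meson of_nat_mono order_trans)
  ultimately show thesis using that[of g] by blast
qed

text \<open>Summation by parts. With a constant potential it says that net outflows cancel; with a
  potential adapted to one demand it is the core of weak duality.\<close>

lemma flow_potential_identity:
  fixes g :: "'v \<times> 'v \<Rightarrow> real" and \<theta> :: "'v \<Rightarrow> real"
  assumes "finite V" "E \<subseteq> V \<times> V"
  shows "(\<Sum>e\<in>E. g e * (\<theta> (snd e) - \<theta> (fst e))) = - (\<Sum>v\<in>V. \<theta> v * flow_value E g v)"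
proof -
  have fE: "finite E" using assms finite_subset by blast
  have 1: "(\<Sum>e\<in>E. g e * \<theta> (fst e)) = (\<Sum>v\<in>V. \<theta> v * (\<Sum>e\<in>{e\<in>E. fst e = v}. g e))"
  proof -
    have "(\<Sum>e\<in>E. g e * \<theta> (fst e)) = (\<Sum>v\<in>V. \<Sum>e\<in>{e\<in>E. fst e = v}. g e * \<theta> (fst e))"
      using fE assms by (intro sum.group[symmetric]) auto
    also have "\<dots> = (\<Sum>v\<in>V. \<theta> v * (\<Sum>e\<in>{e\<in>E. fst e = v}. g e))"
      by (intro sum.cong refl) (simp add: sum_distrib_left mult.commute)
    finally show ?thesis .
  qed
  have 2: "(\<Sum>e\<in>E. g e * \<theta> (snd e)) = (\<Sum>v\<in>V. \<theta> v * (\<Sum>e\<in>{e\<in>E. snd e = v}. g e))"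
  proof -
    have "(\<Sum>e\<in>E. g e * \<theta> (snd e)) = (\<Sum>v\<in>V. \<Sum>e\<in>{e\<in>E. snd e = v}. g e * \<theta> (snd e))"
      using fE assms by (intro sum.group[symmetric]) auto
    also have "\<dots> = (\<Sum>v\<in>V. \<theta> v * (\<Sum>e\<in>{e\<in>E. snd e = v}. g e))"
      by (intro sum.cong refl) (simp add: sum_distrib_left mult.commute)
    finally show ?thesis .
  qed
  show ?thesis
    by (simp add: right_diff_distrib sum_subtractf 1 2 flow_value_def)
qed

lemma flow_value_sum_zero:
  assumes "finite V" "E \<subseteq> V \<times> V"
  shows "(\<Sum>v\<in>V. flow_value E g v) = 0"
  using flow_potential_identity[OF assms, of g "\<lambda>_. 1"] by simp

lemma feasible_zero: "feasible_mcf V E P (\<lambda>_ _. 0)"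
  by (simp add: feasible_mcf_def flow_value_def)

lemma feasible_le_one:
  assumes "feasible_mcf V E P f" "finite P" "p \<in> P" "e \<in> E"
  shows "f p e \<le> 1"
proof -
  have "f p e \<le> (\<Sum>p\<in>P. f p e)"
    using assms by (intro member_le_sum) (auto simp: feasible_mcf_def)
  with assms show ?thesis by (force simp: feasible_mcf_def)
qed

text \<open>Weak LP duality with length 1 on the edges of \<open>Sp\<close> and 0 elsewhere. The
  potential certifies distance at least \<open>H\<close> for each demand, so each unit of flow takes
  \<open>H\<close> units of the capacity of \<open>Sp\<close>. Potentials may drop freely along an
  edge, which matters for walks that leave the intended route.\<close>

lemma MCFlow_le_potential:
  fixes \<theta> :: "'v \<times> 'v \<Rightarrow> 'v \<Rightarrow> real"
  assumes V: "finite V" "E \<subseteq> V \<times> V" and P: "P \<subseteq> V \<times> V" "P \<noteq> {}" "\<forall>(s,t)\<in>P. s \<noteq> t"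
    and Sp: "Sp \<subseteq> E" and H: "H > 0"
    and step: "\<And>p e. p \<in> P \<Longrightarrow> e \<in> E \<Longrightarrow> \<theta> p (snd e) - \<theta> p (fst e) \<le> of_bool (e \<in> Sp)"
    and ends: "\<And>p. p \<in> P \<Longrightarrow> \<theta> p (snd p) - \<theta> p (fst p) \<ge> H"
  shows "MCFlow V E P \<le> real (card Sp) / (H * real (card P))"
  unfolding MCFlow_def
proof (rule cSup_least)
  show "{Min ((\<lambda>p. flow_value E (f p) (fst p)) ` P) |f. feasible_mcf V E P f} \<noteq> {}"
    using feasible_zero by blast
next
  have fP: "finite P" and fE: "finite E" using V P finite_subset by blast+
  have cP: "card P > 0" using fP P by (simp add: card_gt_0_iff)
  fix x assume "x \<in> {Min ((\<lambda>p. flow_value E (f p) (fst p)) ` P) |f. feasible_mcf V E P f}"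
  then obtain f where f: "feasible_mcf V E P f" and x: "x = Min ((\<lambda>p. flow_value E (f p) (fst p)) ` P)"
    by blast
  have xle: "x \<le> flow_value E (f p) (fst p)" if "p \<in> P" for p
    unfolding x using fP that by (intro Min_le) auto
  have nn: "f p e \<ge> 0" if "p \<in> P" "e \<in> E" for p e using f that by (auto simp: feasible_mcf_def)
  show "x \<le> real (card Sp) / (H * real (card P))"
  \<comment> \<open>A \<open>flow_value\<close> is a net outflow and may be negative; the product
    estimate in \<open>key\<close> uses x > 0.\<close>
  proof (cases "x \<le> 0")
    case True
    then show ?thesis using H by (smt (verit) divide_nonneg_nonneg mult_nonneg_nonneg of_nat_0_le_iff)
  next
    case False
    have key: "H * x \<le> (\<Sum>e\<in>Sp. f p e)" if p: "p \<in> P" for p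
    proof -
      let ?s = "fst p" and ?t = "snd p"
      have st: "?s \<in> V" "?t \<in> V" "?s \<noteq> ?t" using P p by auto
      have zero: "flow_value E (f p) v = 0" if "v \<in> V - {?s, ?t}" for v
        using f p that by (auto simp: feasible_mcf_def)
      have "0 = (\<Sum>v\<in>V. flow_value E (f p) v)" by (simp add: flow_value_sum_zero[OF V])
      also have "\<dots> = (\<Sum>v\<in>{?s, ?t}. flow_value E (f p) v)"
        using V st zero by (intro sum.mono_neutral_right) auto
      finally have t: "flow_value E (f p) ?t = - flow_value E (f p) ?s" using st by simp
      have "(\<Sum>v\<in>V. \<theta> p v * flow_value E (f p) v) = (\<Sum>v\<in>{?s, ?t}. \<theta> p v * flow_value E (f p) v)"
        using V st zero by (intro sum.mono_neutral_right) auto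
      also have "\<dots> = - (\<theta> p ?t - \<theta> p ?s) * flow_value E (f p) ?s"
        using st t by (simp add: algebra_simps)
      finally have id: "(\<Sum>e\<in>E. f p e * (\<theta> p (snd e) - \<theta> p (fst e))) = (\<theta> p ?t - \<theta> p ?s) * flow_value E (f p) ?s"
        using flow_potential_identity[OF V, of "f p" "\<theta> p"] by (simp add: algebra_simps)
      have "H * x \<le> (\<theta> p ?t - \<theta> p ?s) * flow_value E (f p) ?s"
        using ends[OF p] xle[OF p] False H by (intro mult_mono) auto
      also have "\<dots> = (\<Sum>e\<in>E. f p e * (\<theta> p (snd e) - \<theta> p (fst e)))" using id by simp
      also have "\<dots> \<le> (\<Sum>e\<in>E. f p e * of_bool (e \<in> Sp))"
        using step[OF p] nn[OF p] by (intro sum_mono mult_left_mono) auto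
      also have "\<dots> = (\<Sum>e\<in>Sp. f p e)"
        using fE Sp by (simp add: of_bool_def if_distrib sum.If_cases Int_absorb1 cong: if_cong)
      finally show ?thesis .
    qed
    have "real (card P) * (H * x) \<le> (\<Sum>p\<in>P. \<Sum>e\<in>Sp. f p e)"
      using sum_mono[of P "\<lambda>_. H * x" "\<lambda>p. \<Sum>e\<in>Sp. f p e"] key by simp
    also have "\<dots> = (\<Sum>e\<in>Sp. \<Sum>p\<in>P. f p e)" by (rule sum.swap)
    also have "\<dots> \<le> (\<Sum>e\<in>Sp. 1)"
      using f Sp by (intro sum_mono) (auto simp: feasible_mcf_def)
    finally have "real (card P) * (H * x) \<le> real (card Sp)" by simp
    then show ?thesis using H cP by (simp add: field_simps)
  qed
qed

text \<open>A real \<open>Sup\<close> is an upper bound only for a set bounded above, so most of the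
  work is to bound every concurrent value by the total capacity.\<close>

lemma MCFlow_ge:
  assumes V: "finite V" "E \<subseteq> V \<times> V" and P: "P \<subseteq> V \<times> V" "P \<noteq> {}"
    and f: "feasible_mcf V E P f" and c: "\<And>p. p \<in> P \<Longrightarrow> flow_value E (f p) (fst p) \<ge> c"
  shows "MCFlow V E P \<ge> c"
proof -
  have fP: "finite P" and fE: "finite E" using V P finite_subset by blast+
  have "bdd_above {Min ((\<lambda>p. flow_value E (f p) (fst p)) ` P) |f. feasible_mcf V E P f}"
  proof (rule bdd_aboveI[of _ "real (card E)"])
    fix x assume "x \<in> {Min ((\<lambda>p. flow_value E (f p) (fst p)) ` P) |f. feasible_mcf V E P f}"
    then obtain f where f: "feasible_mcf V E P f" and x: "x = Min ((\<lambda>p. flow_value E (f p) (fst p)) ` P)"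
      by blast
    obtain p where p: "p \<in> P" using P by blast
    have nn: "f p e \<ge> 0" if "e \<in> E" for e using f p that by (auto simp: feasible_mcf_def)
    have "x \<le> flow_value E (f p) (fst p)" unfolding x using fP p by (intro Min_le) auto
    also have "\<dots> \<le> (\<Sum>e\<in>{e\<in>E. fst e = fst p}. f p e)"
      unfolding flow_value_def using nn sum_nonneg[of "{e\<in>E. snd e = fst p}" "f p"] by auto
    also have "\<dots> \<le> (\<Sum>e\<in>E. f p e)" using fE nn by (intro sum_mono2) auto
    also have "\<dots> \<le> (\<Sum>e\<in>E. 1)" using feasible_le_one[OF f fP p] by (intro sum_mono) auto
    finally show "x \<le> real (card E)" by simp
  qed
  moreover have "Min ((\<lambda>p. flow_value E (f p) (fst p)) ` P) \<in>
      {Min ((\<lambda>p. flow_value E (f p) (fst p)) ` P) |f. feasible_mcf V E P f}" using f by blast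
  ultimately have "Min ((\<lambda>p. flow_value E (f p) (fst p)) ` P) \<le> MCFlow V E P"
    unfolding MCFlow_def by (rule cSup_upper[rotated])
  moreover have "c \<le> Min ((\<lambda>p. flow_value E (f p) (fst p)) ` P)"
    using fP P c by (subst Min_ge_iff) auto
  ultimately show ?thesis by linarith
qed

section \<open>Bounds for the sparsest cut and their transfer to \<open>SCG\<close>\<close>

lemma SCut_candidates:
  assumes "finite E"
  shows "finite {real (card E') / real (card (separated E P E')) | E'. E' \<subseteq> E \<and> separated E P E' \<noteq> {}}"
proof -
  have "{real (card E') / real (card (separated E P E')) | E'. E' \<subseteq> E \<and> separated E P E' \<noteq> {}}
    \<subseteq> (\<lambda>E'. real (card E') / real (card (separated E P E'))) ` Pow E" by auto
  then show ?thesis using assms finite_subset by blast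
qed

lemma SCut_le:
  assumes "finite E" "E' \<subseteq> E" "separated E P E' \<noteq> {}"
  shows "SCut E P \<le> real (card E') / real (card (separated E P E'))"
  unfolding SCut_def using assms by (intro Min_le SCut_candidates) auto

lemma separated_all:
  assumes "\<forall>(s,t)\<in>P. s \<noteq> t" shows "separated E P E = P"
  using assms by (auto simp: separated_def)

lemma SCut_ge:
  assumes "finite E" "finite P" "P \<noteq> {}" "\<forall>(s,t)\<in>P. s \<noteq> t" "\<kappa> > 0"
    and cut: "\<And>E'. E' \<subseteq> E \<Longrightarrow> real (card (separated E P E')) \<le> \<kappa> * real (card E')"
  shows "SCut E P \<ge> 1 / \<kappa>"
proof -
  let ?S = "{real (card E') / real (card (separated E P E')) | E'. E' \<subseteq> E \<and> separated E P E' \<noteq> {}}"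
  have "?S \<noteq> {}" using assms separated_all[OF assms(4), of E] by blast
  moreover have "1 / \<kappa> \<le> x" if "x \<in> ?S" for x
  proof -
    from that obtain E' where E': "E' \<subseteq> E" "separated E P E' \<noteq> {}"
      "x = real (card E') / real (card (separated E P E'))" by blast
    have "separated E P E' \<subseteq> P" by (auto simp: separated_def)
    then have "card (separated E P E') > 0" using E'(2) assms(2)
      by (simp add: card_gt_0_iff finite_subset)
    then show ?thesis unfolding E'(3) using cut[OF E'(1)] assms(5) by (simp add: field_simps)
  qed
  ultimately show ?thesis unfolding SCut_def using SCut_candidates[OF assms(1)] by simp
qed

text \<open>\<open>LEAST\<close> in \<open>SCG\<close> has its meaning only once some factor is
  known to work. A crude one suffices: sending 1 / (|E| |P|) along one walk per demand is feasible,
  the cut ratio is at most |E|, and |E| |E| |P| is at most |V|^6.\<close>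

lemma SCut_le_MCFlow:
  assumes V: "finite V" "E \<subseteq> V \<times> V" and P: "P \<subseteq> V \<times> V" "P \<noteq> {}" "\<forall>(s,t)\<in>P. s \<noteq> t"
  shows "SCut E P \<le> real (card V ^ 6) * MCFlow V E P"
proof -
  have fP: "finite P" and fE: "finite E" using V P finite_subset by blast+
  have cP: "card P > 0" using fP P by (simp add: card_gt_0_iff)
  have cPN: "card P \<le> card V ^ 2" and cEN: "card E \<le> card V ^ 2"
    using card_mono[of "V \<times> V"] V P by (auto simp: card_cartesian_product power2_eq_square)
  have M0: "MCFlow V E P \<ge> 0"
    using feasible_zero by (rule MCFlow_ge[OF V P(1,2)]) (simp add: flow_value_def)
  show ?thesis
  proof (cases "separated E P {} = {}")
    \<comment> \<open>Some demand is disconnected from the start, so the empty cut has ratio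
      0.\<close>
    case False
    then have "SCut E P \<le> 0" using SCut_le[OF fE, of "{}" P] by simp
    also have "0 \<le> real (card V ^ 6) * MCFlow V E P" using M0 by simp
    finally show ?thesis .
  next
    case True
    then have conn: "(fst p, snd p) \<in> E\<^sup>*" if "p \<in> P" for p
      using that by (cases p) (auto simp: separated_def)
    have "\<exists>g. \<forall>p\<in>P. (\<forall>e. 0 \<le> g p e \<and> g p e \<le> real (card E)) \<and>
       (\<forall>v. flow_value E (g p) v = of_bool (v = fst p) - of_bool (v = snd p))"
      by (intro bchoice ballI) (metis rtrancl_unit_flow[OF fE conn])
    then obtain g where g0: "\<And>p e. p \<in> P \<Longrightarrow> 0 \<le> g p e" and g1: "\<And>p e. p \<in> P \<Longrightarrow> g p e \<le> real (card E)"
      and g2: "\<And>p v. p \<in> P \<Longrightarrow> flow_value E (g p) v = of_bool (v = fst p) - of_bool (v = snd p)"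
      by blast
    have Epos: "card E > 0"
    proof -
      obtain s t where "(s, t) \<in> P" using P by auto
      then have "(s, t) \<in> E\<^sup>*" "s \<noteq> t" using conn[of "(s,t)"] P by auto
      then have "E \<noteq> {}" by auto
      then show ?thesis using fE by (simp add: card_gt_0_iff)
    qed
    define c where "c = 1 / (real (card E) * real (card P))"
    have c0: "c > 0" using Epos cP by (simp add: c_def)
    define f where "f p e = c * g p e" for p e
    have "feasible_mcf V E P f" unfolding feasible_mcf_def
    proof (intro conjI ballI impI)
      fix p e assume "p \<in> P" "e \<in> E" then show "0 \<le> f p e" using g0 c0 by (simp add: f_def)
    next
      fix p v assume "p \<in> P" "v \<in> V" "v \<noteq> fst p \<and> v \<noteq> snd p"
      then show "flow_value E (f p) v = 0" unfolding f_def by (simp add: flow_value_scale g2)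
    next
      fix e assume "e \<in> E"
      have "(\<Sum>p\<in>P. f p e) \<le> (\<Sum>p\<in>P. c * real (card E))"
        unfolding f_def using g1 c0 by (intro sum_mono mult_left_mono) auto
      also have "\<dots> = 1" using Epos cP by (simp add: c_def)
      finally show "(\<Sum>p\<in>P. f p e) \<le> 1" .
    qed
    moreover have "flow_value E (f p) (fst p) \<ge> c" if "p \<in> P" for p
    proof -
      have "fst p \<noteq> snd p" using that P(3) by (cases p) auto
      then show ?thesis unfolding f_def using that by (simp add: flow_value_scale g2)
    qed
    ultimately have Mc: "MCFlow V E P \<ge> c" by (rule MCFlow_ge[OF V P(1,2)])
    have "SCut E P \<le> real (card E) / real (card P)"
      using SCut_le[OF fE subset_refl, of P] separated_all[OF P(3)] P by auto
    also have "\<dots> \<le> real (card E)" using cP by (simp add: field_simps) (metis Suc_leI cP mult_le_mono2 mult.right_neutral One_nat_def of_nat_mult of_nat_le_iff)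
    also have "\<dots> = (real (card E) * real (card E) * real (card P)) * c" using Epos cP by (simp add: c_def)
    also have "\<dots> \<le> real (card V ^ 6) * c"
    proof -
      have "card E * card E * card P \<le> card V ^ 2 * card V ^ 2 * card V ^ 2"
        using cPN cEN by (intro mult_le_mono) auto
      also have "\<dots> = card V ^ 6" by (simp add: power_add[symmetric])
      finally show ?thesis using c0 by (metis mult_right_mono less_imp_le of_nat_mult of_nat_le_iff)
    qed
    also have "\<dots> \<le> real (card V ^ 6) * MCFlow V E P" using Mc by (intro mult_left_mono) auto
    finally show ?thesis .
  qed
qed

lemma SCut_le_SCG:
  fixes V :: "nat set"
  assumes "finite V" "E \<subseteq> V \<times> V" "P \<subseteq> V \<times> V" "P \<noteq> {}" "\<forall>(s,t)\<in>P. s \<noteq> t"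
  shows "SCut E P \<le> real (SCG (card V)) * MCFlow V E P"
proof -
  let ?Q = "\<lambda>k. \<forall>(V'::nat set) E P.
      finite V' \<and> card V' = card V \<and> E \<subseteq> V' \<times> V' \<and> P \<subseteq> V' \<times> V' \<and> P \<noteq> {} \<and>
      (\<forall>(s,t)\<in>P. s \<noteq> t) \<longrightarrow> SCut E P \<le> real k * MCFlow V' E P"
  have "?Q (card V ^ 6)" using SCut_le_MCFlow by metis
  then have "?Q (SCG (card V))" unfolding SCG_def by (rule LeastI)
  then show ?thesis using assms by blast
qed

text \<open>\<open>SCG N\<close> speaks of graphs with exactly \<open>N\<close> natural numbers as
  nodes; the instance is renamed by \<open>enc\<close> and padded with isolated nodes. What remains
  is a dual certificate for the flow against a lower bound 1 / \<open>\<kappa>\<close> for the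
  cut.\<close>

lemma SCG_lower_bound:
  fixes V :: "'v set" and enc :: "'v \<Rightarrow> nat" and \<theta> :: "'v \<times> 'v \<Rightarrow> 'v \<Rightarrow> real"
  assumes V: "finite V" "E \<subseteq> V \<times> V" and P: "P \<subseteq> V \<times> V" "P \<noteq> {}" "\<forall>(s,t)\<in>P. s \<noteq> t"
    and N: "card V \<le> N" and enc: "inj enc" and Sp: "Sp \<subseteq> E" and H: "H > 0" and k: "\<kappa> > 0"
    and step: "\<And>p e. p \<in> P \<Longrightarrow> e \<in> E \<Longrightarrow> \<theta> p (snd e) - \<theta> p (fst e) \<le> of_bool (e \<in> Sp)"
    and ends: "\<And>p. p \<in> P \<Longrightarrow> \<theta> p (snd p) - \<theta> p (fst p) \<ge> H"
    and cut: "\<And>E'. E' \<subseteq> E \<Longrightarrow> real (card (separated E P E')) \<le> \<kappa> * real (card E')"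
  shows "H * real (card P) \<le> real (SCG N) * \<kappa> * real (card Sp)"
proof -
  let ?m = "map_prod enc enc"
  have injm: "inj ?m" using enc by (simp add: prod.inj_map)
  have fE: "finite E" and fP: "finite P" using V P finite_subset by blast+
  have cP: "card P > 0" using fP P by (simp add: card_gt_0_iff)
  obtain V' where V': "enc ` V \<subseteq> V'" "finite V'" "card V' = N"
  proof -
    have "card (enc ` V) \<le> N" using N card_image_le[OF V(1), of enc] by linarith
    moreover have "infinite (UNIV - enc ` V)" using V(1) by (simp add: Diff_infinite_finite)
    ultimately obtain D where "D \<subseteq> UNIV - enc ` V" "finite D" "card D = N - card (enc ` V)"
      using infinite_arbitrarily_large by metis
    with \<open>card (enc ` V) \<le> N\<close> V(1) that[of "enc ` V \<union> D"] show thesis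
      by (auto simp: card_Un_disjoint Int_commute disjoint_iff subset_iff)
  qed
  let ?E = "?m ` E" and ?P = "?m ` P"
  have VE: "?E \<subseteq> V' \<times> V'" "?P \<subseteq> V' \<times> V'" using V(2) P(1) V'(1) by (fastforce simp: subset_iff)+
  have P': "?P \<noteq> {}" "\<forall>(s,t)\<in>?P. s \<noteq> t" using P enc by (auto simp: inj_eq)
  have enc_inv: "inv enc (enc x) = x" for x using enc by simp
  define \<theta>' where "\<theta>' p v = \<theta> (inv enc (fst p), inv enc (snd p)) (inv enc v)" for p v
  have "MCFlow V' ?E ?P \<le> real (card (?m ` Sp)) / (H * real (card ?P))"
  proof (rule MCFlow_le_potential[OF V'(2) VE(1) VE(2) P', where \<theta> = \<theta>'])
    show "?m ` Sp \<subseteq> ?E" using Sp by auto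
    show "0 < H" by fact
    fix p e assume "p \<in> ?P" "e \<in> ?E"
    then obtain p0 e0 where pe: "p = ?m p0" "e = ?m e0" "p0 \<in> P" "e0 \<in> E" by auto
    have "(e \<in> ?m ` Sp) = (e0 \<in> Sp)" using injm pe(2) by (simp add: inj_image_mem_iff)
    then show "\<theta>' p (snd e) - \<theta>' p (fst e) \<le> of_bool (e \<in> ?m ` Sp)"
      using step[OF pe(3,4)] pe by (simp add: \<theta>'_def enc_inv)
  next
    fix p assume "p \<in> ?P"
    then obtain p0 where pe: "p = ?m p0" "p0 \<in> P" by auto
    show "\<theta>' p (snd p) - \<theta>' p (fst p) \<ge> H"
      using ends[OF pe(2)] pe by (simp add: \<theta>'_def enc_inv)
  qed
  then have M: "MCFlow V' ?E ?P \<le> real (card Sp) / (H * real (card P))"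
    using injm by (simp add: card_image inj_on_subset)
  have C: "SCut ?E ?P \<ge> 1 / \<kappa>"
  proof (rule SCut_ge)
    show "finite ?E" "finite ?P" using fE fP by auto
    fix E' assume E': "E' \<subseteq> ?E"
    define E0 where "E0 = {e \<in> E. ?m e \<in> E'}"
    have E0: "E' = ?m ` E0"
    proof
      show "E' \<subseteq> ?m ` E0"
      proof
        fix e assume e: "e \<in> E'"
        then have "e \<in> ?E" using E' by (rule rev_subsetD)
        then obtain e0 where "e0 \<in> E" "e = ?m e0" by (rule imageE)
        then show "e \<in> ?m ` E0" using e unfolding E0_def by (intro image_eqI[of _ _ e0]) simp_all
      qed
    qed (auto simp: E0_def)
    have fsep: "finite (separated E P E0)" by (rule finite_subset[OF _ fP]) (auto simp: separated_def)
    have "separated ?E ?P E' \<subseteq> ?m ` separated E P E0"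
    proof
      fix q assume q: "q \<in> separated ?E ?P E'"
      then obtain s t where st: "q = (enc s, enc t)" "(s, t) \<in> P" by (auto simp: separated_def)
      have "(s, t) \<notin> (E - E0)\<^sup>*"
      proof
        assume "(s, t) \<in> (E - E0)\<^sup>*"
        then have "(enc s, enc t) \<in> (?E - E')\<^sup>*"
        proof (induction rule: rtrancl_induct)
          case (step b c)
          then have "(enc b, enc c) \<in> ?E" "(enc b, enc c) \<notin> E'"
            by (auto simp: E0_def intro!: image_eqI[of _ _ "(b, c)"])
          then have "(enc b, enc c) \<in> ?E - E'" by blast
          with step.IH show ?case by (rule rtrancl_into_rtrancl)
        qed simp
        with q st show False by (auto simp: separated_def)
      qed
      with st have "(s, t) \<in> separated E P E0" by (simp add: separated_def)
      with st show "q \<in> ?m ` separated E P E0" by (intro image_eqI[of _ _ "(s, t)"]) auto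
    qed
    then have "card (separated ?E ?P E') \<le> card (?m ` separated E P E0)"
      using fsep by (intro card_mono finite_imageI)
    also have "\<dots> \<le> card (separated E P E0)"
      using fsep by (rule card_image_le)
    finally have "card (separated ?E ?P E') \<le> card (separated E P E0)" .
    moreover have "E0 \<subseteq> E" by (auto simp: E0_def)
    ultimately have "real (card (separated ?E ?P E')) \<le> \<kappa> * real (card E0)"
      using cut[of E0] by linarith
    also have "card E0 = card E'" using injm E0 by (simp add: card_image inj_on_subset)
    finally show "real (card (separated ?E ?P E')) \<le> \<kappa> * real (card E')" .
  qed (use P' k in auto)
  have "1 / \<kappa> \<le> real (SCG N) * MCFlow V' ?E ?P"
    using SCut_le_SCG[OF V'(2) VE P'] V'(3) C by simp
  also have "\<dots> \<le> real (SCG N) * (real (card Sp) / (H * real (card P)))"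
    using M by (intro mult_left_mono) auto
  finally show ?thesis using H cP k by (simp add: field_simps)
qed

subsection \<open>Acyclic subsystems\<close>

text \<open>The set argument collects the labels used. Nodes may repeat, which makes walks easy to
  concatenate; a bridge is such a walk with distinct nodes, closed by a chord on one more
  path.\<close>

inductive rainbow :: "('i \<Rightarrow> ('a \<times> 'a) set) \<Rightarrow> 'a \<Rightarrow> 'i set \<Rightarrow> 'a \<Rightarrow> bool" for R where
  rainbow_refl: "rainbow R x {} x"
| rainbow_step: "rainbow R x Q y \<Longrightarrow> q \<notin> Q \<Longrightarrow> (y, z) \<in> R q \<Longrightarrow> rainbow R x (insert q Q) z"

lemma rainbow_append:
  assumes "rainbow R y Q' z" "rainbow R x Q y" "Q \<inter> Q' = {}"
  shows "rainbow R x (Q \<union> Q') z"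
  using assms
proof (induction rule: rainbow.induct)
  case (rainbow_step y Q' w q z)
  then have "rainbow R x (Q \<union> Q') w" "q \<notin> Q \<union> Q'" by auto
  then show ?case using rainbow.rainbow_step[of R x "Q \<union> Q'" w q z] rainbow_step.hyps by simp
qed simp

lemma rainbow_converse:
  assumes "rainbow (\<lambda>i. (R i)\<inverse>) x Q y" shows "rainbow R y Q x"
  using assms
proof (induction rule: rainbow.induct)
  case (rainbow_step x Q y q z)
  have "rainbow R z {q} y"
    using rainbow.rainbow_step[OF rainbow_refl, of q z y R] rainbow_step.hyps by simp
  from rainbow_append[OF rainbow_step.IH this] show ?case using rainbow_step.hyps by simp
qed (rule rainbow_refl)

lemma rainbow_distinct_nodes:
  assumes "rainbow R x Q y"
  shows "\<exists>us qs. length us = Suc (length qs) \<and> us ! 0 = x \<and> us ! length qs = y \<and> distinct us \<and>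
    distinct qs \<and> set qs \<subseteq> Q \<and> (\<forall>k<length qs. (us ! k, us ! Suc k) \<in> R (qs ! k))"
  using assms
proof (induction rule: rainbow.induct)
  case (rainbow_refl x)
  show ?case by (intro exI[of _ "[x]"] exI[of _ "[]"]) simp
next
  case (rainbow_step x Q y q z)
  then obtain us qs where h: "length us = Suc (length qs)" "us ! 0 = x" "us ! length qs = y" "distinct us"
    "distinct qs" "set qs \<subseteq> Q" "\<forall>k<length qs. (us ! k, us ! Suc k) \<in> R (qs ! k)" by blast
  show ?case
  proof (cases "z \<in> set us")
    case False
    have "(us @ [z]) ! k = us ! k" if "k < Suc (length qs)" for k using that h(1) by (simp add: nth_append)
    moreover have "(us @ [z]) ! Suc (length qs) = z" using h(1) by (metis nth_append_length)
    ultimately show ?thesis using h False rainbow_step.hyps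
      by (intro exI[of _ "us @ [z]"] exI[of _ "qs @ [q]"]) (auto simp: nth_append less_Suc_eq)
  next
    \<comment> \<open>The new endpoint was visited before: cutting the walk off at that visit
      removes the loop and only discards labels.\<close>
    case True
    then obtain j where j: "j < length us" "us ! j = z" by (auto simp: in_set_conv_nth)
    then show ?thesis using h set_take_subset[of j qs]
      by (intro exI[of _ "take (Suc j) us"] exI[of _ "take j qs"]) auto
  qed
qed

definition path_rel :: "'a list list \<Rightarrow> nat \<Rightarrow> ('a \<times> 'a) set" where
  "path_rel Ps i = {(x, y). precedes (Ps ! i) x y}"

lemma precedes_set: "precedes \<pi> x y \<Longrightarrow> x \<in> set \<pi> \<and> y \<in> set \<pi>"
  by (auto simp: precedes_def)

lemma no_rainbow_of_girth:
  assumes ps: "path_system V Ps" and g: "girth_gt V Ps \<infinity>"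
    and i: "i < length Ps" and xy: "(x, y) \<in> path_rel Ps i" and Q: "Q \<subseteq> {..<length Ps} - {i}"
  shows "\<not> rainbow (path_rel Ps) x Q y"
proof
  assume "rainbow (path_rel Ps) x Q y"
  from rainbow_distinct_nodes[OF this] obtain us qs where h: "length us = Suc (length qs)" "us ! 0 = x"
    "us ! length qs = y" "distinct us" "distinct qs" "set qs \<subseteq> Q"
    "\<forall>k<length qs. (us ! k, us ! Suc k) \<in> path_rel Ps (qs ! k)" by blast
  \<comment> \<open>Bridges count from 1 and lists from 0, hence the shift by one below. Index
    \<open>b\<close> is reserved for the chord, which lies on path \<open>i\<close>.\<close>
  define b where "b = Suc (length qs)"
  define v where "v k = us ! (k - 1)" for k
  define idx where "idx k = (if k = b then i else qs ! (k - 1))" for k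
  have qlt: "qs ! k < length Ps \<and> qs ! k \<noteq> i" if "k < length qs" for k
    using that h(6) Q by (metis Diff_iff lessThan_iff nth_mem singletonI subsetD)
  have VV: "u \<in> V \<and> w \<in> V" if "(u, w) \<in> path_rel Ps j" "j < length Ps" for u w j
    using that ps precedes_set[of "Ps ! j" u w] by (auto simp: path_rel_def path_system_def)
  have "has_bridge V Ps b" unfolding has_bridge_def
  proof (intro conjI exI[of _ v] exI[of _ idx] ballI)
    show "1 \<le> b" by (simp add: b_def)
    show "inj_on v {1..b}"
    proof (rule inj_onI)
      fix k l assume "k \<in> {1..b}" "l \<in> {1..b}" "v k = v l"
      then have "k - 1 < length us" "l - 1 < length us" "us ! (k - 1) = us ! (l - 1)"
        using h(1) by (auto simp: v_def b_def)
      then have "k - 1 = l - 1" using nth_eq_iff_index_eq[OF h(4)] by blast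
      then show "k = l" using \<open>k \<in> {1..b}\<close> \<open>l \<in> {1..b}\<close> by auto
    qed
    show "v ` {1..b} \<subseteq> V"
    proof
      fix w assume "w \<in> v ` {1..b}"
      then obtain k where k: "k \<in> {1..b}" "w = us ! (k - 1)" by (auto simp: v_def)
      show "w \<in> V"
      proof (cases "k = b")
        case True
        then have "w = y" using k h(3) by (simp add: b_def)
        then show ?thesis using VV[OF xy i] by simp
      next
        case False
        then have "k - 1 < length qs" using k by (auto simp: b_def)
        then show ?thesis using VV h(7) qlt k by blast
      qed
    qed
    show "inj_on idx {1..b}"
    proof (rule inj_onI)
      fix k l assume kl: "k \<in> {1..b}" "l \<in> {1..b}" "idx k = idx l"
      have *: "k' - 1 < length qs" if "k' \<in> {1..b}" "k' \<noteq> b" for k' using that by (auto simp: b_def)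
      show "k = l"
      proof (cases "k = b \<or> l = b")
        case True
        then show ?thesis using kl qlt * by (metis idx_def)
      next
        case False
        then have "k - 1 = l - 1" using kl * h(5) by (simp add: idx_def nth_eq_iff_index_eq)
        then show ?thesis using kl by auto
      qed
    qed
    fix k assume k: "k \<in> {1..b}"
    show "idx k < length Ps" using k i qlt[of "k - 1"] by (auto simp: idx_def b_def)
  next
    fix k assume k: "k \<in> {1..<b}"
    then have "k - 1 < length qs" "Suc (k - 1) = k" by (auto simp: b_def)
    then have "(us ! (k - 1), us ! k) \<in> path_rel Ps (qs ! (k - 1))" using h(7) by fastforce
    then show "precedes (Ps ! idx k) (v k) (v (Suc k))"
      using k by (simp add: idx_def v_def path_rel_def)
  next
    show "precedes (Ps ! idx b) (v 1) (v b)"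
      using xy h by (simp add: idx_def v_def path_rel_def b_def)
  qed
  then show False using g by (simp add: girth_gt_def)
qed

section \<open>Uniform random lists of labels\<close>

definition lists_of :: "'i set \<Rightarrow> nat \<Rightarrow> 'i list set" where
  "lists_of I k = {s. set s \<subseteq> I \<and> length s = k}"

lemma finite_lists_of: "finite I \<Longrightarrow> finite (lists_of I k)"
  unfolding lists_of_def by (rule finite_lists_length_eq)

lemma card_lists_of: "finite I \<Longrightarrow> card (lists_of I k) = card I ^ k"
  unfolding lists_of_def by (rule card_lists_length_eq)

lemma lists_of_0 [simp]: "lists_of I 0 = {[]}"
  by (auto simp: lists_of_def)

lemma sum_lists_of_Suc:
  assumes "finite I"
  shows "(\<Sum>s\<in>lists_of I (Suc k). f s) = (\<Sum>s\<in>lists_of I k. \<Sum>i\<in>I. f (i # s))"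
proof -
  have "(\<Sum>s\<in>lists_of I (Suc k). f s) = (\<Sum>(s, i)\<in>lists_of I k \<times> I. f (i # s))"
    unfolding lists_of_def lists_length_Suc_eq
    by (subst sum.reindex) (auto simp: inj_on_def case_prod_unfold)
  then show ?thesis using assms by (simp add: sum.cartesian_product)
qed

text \<open>The averages of ln b over the lists of length k telescope.\<close>

lemma exists_slow_step:
  fixes b :: "'w \<Rightarrow> 'i list \<Rightarrow> nat"
  assumes I: "finite I" "I \<noteq> {}" and O: "finite \<Omega>" and m: "m > 0"
    and b: "\<And>\<omega> s. 1 \<le> b \<omega> s" "\<And>\<omega> s. b \<omega> s \<le> n"
  shows "\<exists>k<m. (\<Sum>\<omega>\<in>\<Omega>. \<Sum>s\<in>lists_of I k. \<Sum>i\<in>I. ln (real (b \<omega> (i # s))) - ln (real (b \<omega> s)))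
    \<le> real (card \<Omega>) * real (card I) ^ k * (real (card I) / real m * ln (real n))"
proof (rule ccontr)
  define p where "p = real (card I)"
  have p: "p > 0" using I by (simp add: p_def card_gt_0_iff)
  define S where "S k = (\<Sum>\<omega>\<in>\<Omega>. \<Sum>s\<in>lists_of I k. ln (real (b \<omega> s)))" for k
  define E where "E k = S k / p ^ k" for k
  define c where "c = real (card \<Omega>) * ln (real n) / real m"
  have inc: "(\<Sum>\<omega>\<in>\<Omega>. \<Sum>s\<in>lists_of I k. \<Sum>i\<in>I. ln (real (b \<omega> (i # s))) - ln (real (b \<omega> s)))
      = S (Suc k) - p * S k" for k
    by (simp add: S_def sum_lists_of_Suc[OF I(1)] sum_subtractf p_def sum_distrib_left)
  assume "\<not> ?thesis"
  then have neg: "S (Suc k) - p * S k > real (card \<Omega>) * p ^ k * (p / real m * ln (real n))" if "k < m" for k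
    using that unfolding inc p_def by (meson not_le)
  have "E (Suc k) - E k > c" if "k < m" for k
  proof -
    have "E (Suc k) - E k = (S (Suc k) - p * S k) / p ^ Suc k" using p by (simp add: E_def field_simps)
    also have "\<dots> > (real (card \<Omega>) * p ^ k * (p / real m * ln (real n))) / p ^ Suc k"
      using neg[OF that] p by (intro divide_strict_right_mono) auto
    also have "(real (card \<Omega>) * p ^ k * (p / real m * ln (real n))) / p ^ Suc k = c"
      using p by (simp add: c_def field_simps)
    finally show ?thesis .
  qed
  then have "(\<Sum>k<m. E (Suc k) - E k) > (\<Sum>k<m. c)"
    using m by (intro sum_strict_mono) auto
  then have "E m - E 0 > real m * c" by (simp add: sum_lessThan_telescope)
  then have 1: "E m - E 0 > real (card \<Omega>) * ln (real n)" using m by (simp add: c_def)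
  have "E 0 \<ge> 0" using b by (auto simp: E_def S_def intro!: sum_nonneg)
  moreover have "E m \<le> real (card \<Omega>) * ln (real n)"
  proof -
    have "S m \<le> (\<Sum>\<omega>\<in>\<Omega>. \<Sum>s\<in>lists_of I m. ln (real n))"
      unfolding S_def
    proof (intro sum_mono)
      fix \<omega> s show "ln (real (b \<omega> s)) \<le> ln (real n)"
        using b(1)[of \<omega> s] b(2)[of \<omega> s] by (subst ln_le_cancel_iff) auto
    qed
    also have "\<dots> = real (card \<Omega>) * ln (real n) * p ^ m"
      by (simp add: card_lists_of[OF I(1)] p_def)
    finally show ?thesis using p by (simp add: E_def field_simps)
  qed
  ultimately show False using 1 by linarith
qed

definition load :: "('i \<Rightarrow> 'a set) \<Rightarrow> 'a \<Rightarrow> 'i list \<Rightarrow> nat" where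
  "load A v s = length (filter (\<lambda>i. v \<in> A i) s)"

text \<open>Entries are drawn independently and with repetition, so the exponential moment of the
  load factorizes. It drives a Chernoff bound on how often a node is met by the paths drawn.\<close>

lemma load_moment:
  assumes I: "finite I" "I \<noteq> {}"
  shows "(\<Sum>s\<in>lists_of I k. 2 ^ load A v s :: real) =
    (real (card I) + real (card {i \<in> I. v \<in> A i})) ^ k"
proof (induction k)
  case (Suc k)
  have "(\<Sum>i\<in>I. (if v \<in> A i then 2 else 1) :: real) = (\<Sum>i\<in>I. 1 + (if v \<in> A i then 1 else 0))"
    by (intro sum.cong) auto
  also have "\<dots> = real (card I) + real (card {i \<in> I. v \<in> A i})"
    using I by (simp add: sum.distrib sum.If_cases Int_def)
  finally have 1: "(\<Sum>i\<in>I. (if v \<in> A i then 2 else 1) :: real) = real (card I) + real (card {i \<in> I. v \<in> A i})" .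
  have "(\<Sum>s\<in>lists_of I (Suc k). 2 ^ load A v s :: real)
      = (\<Sum>s\<in>lists_of I k. 2 ^ load A v s * (\<Sum>i\<in>I. if v \<in> A i then 2 else 1))"
    unfolding sum_lists_of_Suc[OF I(1)] sum_distrib_left by (intro sum.cong refl) (auto simp: load_def)
  then show ?case using Suc 1 by (simp add: sum_distrib_right[symmetric])
qed (simp add: load_def)

lemma load_moment_le:
  assumes I: "finite I" "I \<noteq> {}" and k: "k \<le> m"
  shows "(\<Sum>s\<in>lists_of I k. 2 ^ load A v s :: real) \<le>
    real (card I) ^ k * exp (real m * real (card {i \<in> I. v \<in> A i}) / real (card I))"
proof -
  define p d where "p = real (card I)" and "d = real (card {i \<in> I. v \<in> A i})"
  have p: "p > 0" using I by (simp add: p_def card_gt_0_iff)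
  have d: "d \<ge> 0" by (simp add: d_def)
  have "(p + d) ^ k = p ^ k * (1 + d / p) ^ k" using p by (simp add: power_mult_distrib[symmetric] field_simps)
  also have "\<dots> \<le> p ^ k * exp (d / p) ^ k"
    using p d by (intro mult_left_mono power_mono exp_ge_add_one_self) (auto simp: add_nonneg_nonneg)
  also have "exp (d / p) ^ k = exp (real k * (d / p))" by (simp only: exp_of_nat_mult)
  also have "p ^ k * exp (real k * (d / p)) \<le> p ^ k * exp (real m * (d / p))"
    using p d k by (intro mult_left_mono) (auto intro!: divide_right_mono mult_right_mono)
  finally show ?thesis unfolding load_moment[OF I] by (simp add: p_def d_def)
qed

section \<open>Ball growing\<close>

definition outs :: "('i \<Rightarrow> ('a \<times> 'a) set) \<Rightarrow> 'a set \<Rightarrow> 'i \<Rightarrow> 'a set \<Rightarrow> 'a set" where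
  "outs R W i Y = {w \<in> W - Y. \<exists>y\<in>Y. (y, w) \<in> R i}"

text \<open>The price of destroying all steps out of \<open>Y\<close>: each path gives up either the
  nodes outside that it reaches from \<open>Y\<close> or its own nodes in \<open>Y\<close>,
  whichever are fewer.\<close>

definition loss :: "('i \<Rightarrow> ('a \<times> 'a) set) \<Rightarrow> ('i \<Rightarrow> 'a set) \<Rightarrow> 'i set \<Rightarrow> 'a set \<Rightarrow> 'a set \<Rightarrow> nat" where
  "loss R A I W Y = (\<Sum>i\<in>I. min (card (outs R W i Y)) (card (A i \<inter> Y)))"

text \<open>The ball is grown from x along the paths of the list, last entry first; a path is used at most
  once, so that every node is reached by a walk with distinct labels.\<close>

fun ball :: "('i \<Rightarrow> ('a \<times> 'a) set) \<Rightarrow> 'a set \<Rightarrow> 'i set \<Rightarrow> 'a \<Rightarrow> 'i list \<Rightarrow> 'a set" where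
  "ball R W X x [] = {x}"
| "ball R W X x (i # s) = ball R W X x s \<union>
     (if i \<in> X \<or> i \<in> set s then {} else outs R W i (ball R W X x s))"

lemma ball_subset: "x \<in> W \<Longrightarrow> ball R W X x s \<subseteq> W"
  by (induction s) (auto simp: outs_def)

lemma ball_center: "x \<in> ball R W X x s"
  by (induction s) auto

lemma ball_rainbow:
  "z \<in> ball R W X x s \<Longrightarrow> \<exists>Q. Q \<subseteq> set s - X \<and> rainbow R x Q z"
proof (induction s arbitrary: z)
  case Nil
  then show ?case using rainbow_refl by fastforce
next
  case (Cons i s)
  show ?case
  proof (cases "z \<in> ball R W X x s")
    case True
    then show ?thesis using Cons.IH[OF True] by (metis Diff_mono order_refl order_trans set_subset_Cons)
  next
    case False
    then have z: "i \<notin> X" "i \<notin> set s" "z \<in> outs R W i (ball R W X x s)"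
      using Cons.prems by (auto split: if_splits)
    then obtain y where y: "y \<in> ball R W X x s" "(y, z) \<in> R i" by (auto simp: outs_def)
    from Cons.IH[OF y(1)] obtain Q where Q: "Q \<subseteq> set s - X" "rainbow R x Q y" by blast
    have "rainbow R x (insert i Q) z" using Q z y by (intro rainbow_step) auto
    moreover have "insert i Q \<subseteq> set (i # s) - X" using Q z by auto
    ultimately show ?thesis by blast
  qed
qed

lemma ln_one_plus_ge: "0 \<le> z \<Longrightarrow> z / (1 + z) \<le> ln (1 + z)" for z :: real
proof -
  assume z: "0 \<le> z"
  have "ln (1 / (1 + z)) \<le> 1 / (1 + z) - 1" using z by (intro ln_le_minus_one) auto
  then show ?thesis using z by (simp add: ln_div field_simps)
qed

lemma ln2_ge_half: "1 / 2 \<le> ln (2 :: real)"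
  using ln_one_plus_ge[of 1] by simp

text \<open>Converts a boundary of size u around a ball of size y into growth of the logarithm. The
  cap at y is essential: for u > y the logarithm grows only slowly in u, but by at least ln
  2.\<close>

lemma min_le_log_growth:
  fixes y u :: real
  assumes "y \<ge> 1" "u \<ge> 0"
  shows "min u y \<le> 2 * y * (ln (y + u) - ln y)"
proof (cases "u \<le> y")
  case True
  define z where "z = u / y"
  have z: "0 \<le> z" "z \<le> 1" using True assms by (auto simp: z_def)
  have "z / 2 \<le> z / (1 + z)" using z by (intro divide_left_mono) auto
  then have "z / 2 \<le> ln (1 + z)" using ln_one_plus_ge[OF z(1)] by linarith
  moreover have "ln (y + u) - ln y = ln (1 + z)"
  proof -
    have "y + u = y * (1 + z)" using assms by (simp add: z_def field_simps)
    then show ?thesis using assms z by (simp add: ln_mult)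
  qed
  ultimately have "u \<le> 2 * y * (ln (y + u) - ln y)"
    using assms by (simp add: z_def field_simps)
  then show ?thesis by simp
next
  case False
  have "ln (2 * y) \<le> ln (y + u)" using False assms by (subst ln_le_cancel_iff) auto
  then have "1 / 2 \<le> ln (y + u) - ln y" using assms ln2_ge_half by (simp add: ln_mult)
  then have "2 * y * (1 / 2) \<le> 2 * y * (ln (y + u) - ln y)" using assms by (intro mult_left_mono) auto
  then show ?thesis by simp
qed

text \<open>A fresh path would extend the ball by exactly its boundary, so its loss is paid by
  logarithmic growth. A forbidden or used path cannot extend the ball; its loss is at most its
  number of nodes in \<open>Y\<close>, and summed over these paths that is the load of each node of
  \<open>Y\<close>, plus 1 for \<open>i0\<close>.\<close>

lemma ball_loss:
  assumes I: "finite I" and W: "finite W" "x \<in> W" and Y: "Y = ball R W X x s"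
    and X: "X \<union> set s \<subseteq> insert i0 (set zs)"
  shows "real (loss R A I W Y) \<le>
      2 * real (card Y) * (\<Sum>i\<in>I. ln (real (card (ball R W X x (i # s)))) - ln (real (card Y)))
      + (\<Sum>v\<in>Y. 1 + real (load A v zs))"
proof -
  have fY: "finite Y" unfolding Y using ball_subset[OF W(2)] W(1) by (rule finite_subset)
  have Y1: "card Y \<ge> 1" using fY ball_center[of x R W X s] unfolding Y by (metis One_nat_def Suc_leI card_gt_0_iff empty_iff)
  let ?U = "I \<inter> (X \<union> set s)"
  let ?g = "\<lambda>i. ln (real (card (ball R W X x (i # s)))) - ln (real (card Y))"
  have g0: "?g i \<ge> 0" for i
  proof -
    have "finite (ball R W X x (i # s))" using ball_subset[OF W(2)] W(1) by (rule finite_subset)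
    then have "card Y \<le> card (ball R W X x (i # s))" unfolding Y by (rule card_mono) auto
    then show ?thesis using Y1 by simp
  qed
  have 1: "real (min (card (outs R W i Y)) (card (A i \<inter> Y))) \<le> 2 * real (card Y) * ?g i"
    if "i \<in> I - ?U" for i
  proof -
    have "ball R W X x (i # s) = Y \<union> outs R W i Y" using that unfolding Y by auto
    moreover have "finite (outs R W i Y)" "Y \<inter> outs R W i Y = {}" using W by (auto simp: outs_def)
    ultimately have c: "card (ball R W X x (i # s)) = card Y + card (outs R W i Y)"
      using fY by (simp add: card_Un_disjoint)
    have "card (A i \<inter> Y) \<le> card Y" using fY by (intro card_mono) auto
    then have "real (min (card (outs R W i Y)) (card (A i \<inter> Y))) \<le> min (real (card (outs R W i Y))) (real (card Y))"
      by auto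
    also have "\<dots> \<le> 2 * real (card Y) * ?g i"
      unfolding c using min_le_log_growth[of "real (card Y)" "real (card (outs R W i Y))"] Y1 by simp
    finally show ?thesis .
  qed
  have 2: "(\<Sum>i\<in>?U. card (A i \<inter> Y)) \<le> (\<Sum>v\<in>Y. 1 + load A v zs)"
  proof -
    have "(\<Sum>i\<in>?U. card (A i \<inter> Y)) = (\<Sum>i\<in>?U. \<Sum>v\<in>Y. if v \<in> A i then 1 else 0)"
      using fY by (intro sum.cong refl) (simp add: sum.If_cases Int_commute)
    also have "\<dots> = (\<Sum>v\<in>Y. \<Sum>i\<in>?U. if v \<in> A i then 1 else 0)" by (rule sum.swap)
    also have "\<dots> \<le> (\<Sum>v\<in>Y. 1 + load A v zs)"
    proof (rule sum_mono)
      fix v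
      have "(\<Sum>i\<in>?U. if v \<in> A i then 1 else 0) = card {i \<in> ?U. v \<in> A i}"
        using I by (simp add: sum.If_cases Int_def)
      also have "\<dots> \<le> card (insert i0 (set (filter (\<lambda>i. v \<in> A i) zs)))"
        using X by (intro card_mono) auto
      also have "\<dots> \<le> 1 + card (set (filter (\<lambda>i. v \<in> A i) zs))"
        by (simp add: card_insert_if)
      also have "\<dots> \<le> 1 + load A v zs" unfolding load_def using card_length by (intro add_left_mono)
      finally show "(\<Sum>i\<in>?U. if v \<in> A i then 1 else 0) \<le> 1 + load A v zs" .
    qed
    finally show ?thesis .
  qed
  have "real (loss R A I W Y) = (\<Sum>i\<in>I - ?U. real (min (card (outs R W i Y)) (card (A i \<inter> Y))))
      + (\<Sum>i\<in>?U. real (min (card (outs R W i Y)) (card (A i \<inter> Y))))"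
    unfolding loss_def of_nat_sum using I by (intro sum.subset_diff) auto
  also have "\<dots> \<le> (\<Sum>i\<in>I - ?U. 2 * real (card Y) * ?g i) + (\<Sum>i\<in>?U. real (card (A i \<inter> Y)))"
    using 1 by (intro add_mono sum_mono) auto
  also have "(\<Sum>i\<in>I - ?U. 2 * real (card Y) * ?g i) \<le> (\<Sum>i\<in>I. 2 * real (card Y) * ?g i)"
    using I g0 by (intro sum_mono2) (auto simp del: ball.simps)
  also have "\<dots> = 2 * real (card Y) * (\<Sum>i\<in>I. ?g i)" by (simp add: sum_distrib_left)
  also have "(\<Sum>i\<in>?U. real (card (A i \<inter> Y))) \<le> (\<Sum>v\<in>Y. 1 + real (load A v zs))"
    using 2 by (metis (mono_tags, lifting) of_nat_1 of_nat_add of_nat_le_iff of_nat_sum sum.cong)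
  finally show ?thesis by simp
qed

text \<open>The 1 pays for the path \<open>i0\<close>, the second term for ball growth at four times
  its average rate, and the third bounds the load of the node in both lists together.\<close>

definition cut_price :: "('i \<Rightarrow> 'a set) \<Rightarrow> 'i set \<Rightarrow> nat \<Rightarrow> nat \<Rightarrow> 'a \<Rightarrow> real" where
  "cut_price A I n m v = 1 + 8 * (real (card I) / real m * ln (real n))
     + 2 * (ln (4 * real n) + 2 * real m * real (card {i \<in> I. v \<in> A i}) / real (card I))"

lemma exists_le_average:
  fixes f :: "'b \<Rightarrow> real"
  assumes "finite S" "S \<noteq> {}" "(\<Sum>x\<in>S. f x) \<le> c * real (card S)"
  shows "\<exists>x\<in>S. f x \<le> c"
proof (rule ccontr)
  assume "\<not> ?thesis"
  then have "(\<Sum>x\<in>S. c) < (\<Sum>x\<in>S. f x)" using assms by (intro sum_strict_mono) auto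
  then show False using assms by (simp add: mult.commute)
qed

text \<open>Out-ball of x and in-ball of y use disjoint sets of paths other than i0; if they met, there
  would be a rainbow walk from x to y. So one of them contains at most half of the nodes.\<close>

lemma sparse_cut:
  fixes R :: "'i \<Rightarrow> ('a \<times> 'a) set" and A :: "'i \<Rightarrow> 'a set"
  assumes I: "finite I" and i0: "i0 \<in> I" and W: "finite W" "x \<in> W" "y \<in> W" "card W \<le> n" and m: "m > 0"
    and nb: "\<And>Q. Q \<subseteq> I - {i0} \<Longrightarrow> \<not> rainbow R x Q y"
  shows "\<exists>Y. Y \<subseteq> W \<and> Y \<noteq> {} \<and> 2 * card Y \<le> card W \<and>
    (real (loss R A I W Y) \<le> (\<Sum>v\<in>Y. cut_price A I n m v) \<or>
     real (loss (\<lambda>i. (R i)\<inverse>) A I W Y) \<le> (\<Sum>v\<in>Y. cut_price A I n m v))"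
proof -
  define p where "p = real (card I)"
  have In: "I \<noteq> {}" using i0 by blast
  have p: "p > 0" using I In by (simp add: p_def card_gt_0_iff)
  have xy: "x \<noteq> y" using nb[of "{}"] rainbow_refl[of R x] by auto
  have W2: "card W \<ge> 2" using card_mono[of W "{x, y}"] W xy by auto
  define g where "g = p / real m * ln (real n)"
  have g: "g > 0" using p m W2 W(4) by (simp add: g_def)
  let ?R' = "\<lambda>i. (R i)\<inverse>"
  let ?B = "\<lambda>s. ball R W {i0} x s"
  let ?C = "\<lambda>u s. ball ?R' W (insert i0 (set u)) y s"
  have cb: "1 \<le> card (ball S W X z s)" "card (ball S W X z s) \<le> n" if "z \<in> W" for S :: "'i \<Rightarrow> ('a \<times> 'a) set" and X z s
  proof -
    have f: "finite (ball S W X z s)" using ball_subset[OF that] W(1) by (rule finite_subset)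
    then show "1 \<le> card (ball S W X z s)" using ball_center[of z S W X s]
      by (metis One_nat_def Suc_leI card_gt_0_iff empty_iff)
    show "card (ball S W X z s) \<le> n" using card_mono[OF W(1) ball_subset[OF that, of S X s]] W(4) by linarith
  qed
  define GO where "GO s = (\<Sum>i\<in>I. ln (real (card (?B (i # s)))) - ln (real (card (?B s))))" for s
  define GI where "GI u s = (\<Sum>i\<in>I. ln (real (card (?C u (i # s)))) - ln (real (card (?C u s))))" for u s
  obtain k where k: "k < m" "(\<Sum>s\<in>lists_of I k. GO s) \<le> p ^ k * g"
    using exists_slow_step[OF I In, of "{()}" m "\<lambda>_ s. card (?B s)" n] m cb[OF W(2)]
    unfolding GO_def g_def p_def by auto
  \<comment> \<open>The labels forbidden to the in-ball depend on the list \<open>u\<close> of the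
    out-ball, so the stopping time \<open>l\<close> is chosen for the average over all
    \<open>u\<close> of the length \<open>k\<close> already fixed.\<close>
  obtain l where l: "l < m" "(\<Sum>u\<in>lists_of I k. \<Sum>s\<in>lists_of I l. GI u s) \<le> p ^ k * p ^ l * g"
    using exists_slow_step[OF I In finite_lists_of[OF I, of k] m, of "\<lambda>u s. card (?C u s)" n] cb[OF W(3)]
    unfolding GI_def g_def p_def by (auto simp: card_lists_of[OF I])
  define d where "d v = real (card {i \<in> I. v \<in> A i})" for v
  define q where "q v = 4 * real n * exp (2 * real m * d v / p)" for v
  have n0: "n > 0" using W2 W(4) by linarith
  have q0: "q v > 0" for v using n0 by (simp add: q_def)
  \<comment> \<open>The three summands are nonnegative and each has average at most 1/4; the factor
    4 n in \<open>q\<close> does this for the sum over the nodes. A pair with \<open>T\<close> at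
    most 3/4 is therefore good for both balls and for all loads at once.\<close>
  define T where "T u s = GO u / (4 * g) + GI u s / (4 * g)
     + (\<Sum>v\<in>W. 2 ^ load A v u * 2 ^ load A v s / q v)" for u s
  have "(\<Sum>u\<in>lists_of I k. \<Sum>s\<in>lists_of I l. T u s) \<le> 3 / 4 * (p ^ k * p ^ l)"
  proof -
    have "(\<Sum>u\<in>lists_of I k. \<Sum>s\<in>lists_of I l. GO u / (4 * g)) = p ^ l * (\<Sum>u\<in>lists_of I k. GO u) / (4 * g)"
      by (simp add: card_lists_of[OF I] p_def sum_distrib_left sum_divide_distrib)
    also have "\<dots> \<le> p ^ l * (p ^ k * g) / (4 * g)"
      using k p g by (intro divide_right_mono mult_left_mono) auto
    finally have 1: "(\<Sum>u\<in>lists_of I k. \<Sum>s\<in>lists_of I l. GO u / (4 * g)) \<le> 1 / 4 * (p ^ k * p ^ l)"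
      using g by (simp add: field_simps)
    have "(\<Sum>u\<in>lists_of I k. \<Sum>s\<in>lists_of I l. GI u s / (4 * g)) \<le> (p ^ k * p ^ l * g) / (4 * g)"
      unfolding sum_divide_distrib[symmetric] using l g by (intro divide_right_mono) auto
    then have 2: "(\<Sum>u\<in>lists_of I k. \<Sum>s\<in>lists_of I l. GI u s / (4 * g)) \<le> 1 / 4 * (p ^ k * p ^ l)"
      using g by (simp add: field_simps)
    have "(\<Sum>u\<in>lists_of I k. \<Sum>s\<in>lists_of I l. \<Sum>v\<in>W. 2 ^ load A v u * 2 ^ load A v s / q v)
       = (\<Sum>u\<in>lists_of I k. \<Sum>v\<in>W. \<Sum>s\<in>lists_of I l. 2 ^ load A v u * 2 ^ load A v s / q v)"
      by (intro sum.cong refl sum.swap)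
    also have "\<dots> = (\<Sum>v\<in>W. \<Sum>u\<in>lists_of I k. \<Sum>s\<in>lists_of I l. 2 ^ load A v u * 2 ^ load A v s / q v)"
      by (rule sum.swap)
    also have "\<dots> = (\<Sum>v\<in>W. (\<Sum>u\<in>lists_of I k. 2 ^ load A v u) * (\<Sum>s\<in>lists_of I l. 2 ^ load A v s) / q v)"
      by (simp add: sum_product sum_divide_distrib)
    also have "\<dots> \<le> (\<Sum>v\<in>W. (p ^ k * exp (real m * d v / p)) * (p ^ l * exp (real m * d v / p)) / q v)"
      using k(1) l(1) q0 p load_moment_le[OF I In, of _ m A] unfolding p_def d_def
      by (intro sum_mono divide_right_mono mult_mono) (auto intro!: sum_nonneg less_imp_le[OF q0[unfolded d_def p_def]])
    also have "\<dots> = (\<Sum>v\<in>W. p ^ k * p ^ l / (4 * real n))"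
    proof (rule sum.cong)
      fix v
      have "exp (real m * d v / p) * exp (real m * d v / p) = exp (2 * real m * d v / p)"
        by (simp add: exp_add[symmetric])
      then show "(p ^ k * exp (real m * d v / p)) * (p ^ l * exp (real m * d v / p)) / q v = p ^ k * p ^ l / (4 * real n)"
        unfolding q_def by (simp add: field_simps)
    qed simp
    also have "\<dots> = real (card W) / real n * (p ^ k * p ^ l) / 4" by simp
    also have "\<dots> \<le> 1 * (p ^ k * p ^ l) / 4"
      using W(4) n0 p by (intro divide_right_mono mult_right_mono) auto
    finally have 3: "(\<Sum>u\<in>lists_of I k. \<Sum>s\<in>lists_of I l. \<Sum>v\<in>W. 2 ^ load A v u * 2 ^ load A v s / q v) \<le> 1 / 4 * (p ^ k * p ^ l)"
      by simp
    show ?thesis using 1 2 3 unfolding T_def by (simp add: sum.distrib)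
  qed
  then have "(\<Sum>(u, s)\<in>lists_of I k \<times> lists_of I l. T u s) \<le> 3 / 4 * real (card (lists_of I k \<times> lists_of I l))"
    using I by (simp add: sum.cartesian_product[symmetric] card_cartesian_product card_lists_of p_def)
  moreover have "finite (lists_of I k \<times> lists_of I l)" "lists_of I k \<times> lists_of I l \<noteq> {}"
  proof -
    show f: "finite (lists_of I k \<times> lists_of I l)" using finite_lists_of[OF I] by blast
    have "card (lists_of I k \<times> lists_of I l) \<noteq> 0"
      using I In by (simp add: card_cartesian_product card_lists_of)
    then show "lists_of I k \<times> lists_of I l \<noteq> {}" by force
  qed
  ultimately obtain u s where us: "u \<in> lists_of I k" "s \<in> lists_of I l" "T u s \<le> 3 / 4"
    using exists_le_average[of "lists_of I k \<times> lists_of I l" "\<lambda>(u, s). T u s" "3 / 4"] by auto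
  have mono: "ln (real (card (ball S W X z s))) \<le> ln (real (card (ball S W X z (i # s))))" if "z \<in> W" for S :: "'i \<Rightarrow> ('a \<times> 'a) set" and X z s i
  proof -
    have "finite (ball S W X z (i # s))" using ball_subset[OF that] W(1) by (rule finite_subset)
    then have "card (ball S W X z s) \<le> card (ball S W X z (i # s))" by (rule card_mono) auto
    then show ?thesis using cb(1)[OF that, of S X s] by simp
  qed
  have GO0: "GO u \<ge> 0" unfolding GO_def by (intro sum_nonneg) (use mono[OF W(2)] in \<open>simp del: ball.simps\<close>)
  have GI0: "GI u s \<ge> 0" unfolding GI_def by (intro sum_nonneg) (use mono[OF W(3)] in \<open>simp del: ball.simps\<close>)
  have L0: "(\<Sum>v\<in>W. 2 ^ load A v u * 2 ^ load A v s / q v) \<ge> 0" using q0 by (intro sum_nonneg) (simp add: less_imp_le)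
  have GOg: "GO u \<le> 4 * g" and GIg: "GI u s \<le> 4 * g"
  proof -
    have "GO u / (4 * g) \<ge> 0" "GI u s / (4 * g) \<ge> 0" using GO0 GI0 g by auto
    then have "GO u / (4 * g) \<le> 1" "GI u s / (4 * g) \<le> 1" using us(3) L0 unfolding T_def by linarith+
    then show "GO u \<le> 4 * g" "GI u s \<le> 4 * g" using g by (auto simp: field_simps)
  qed
  have ld: "real (load A v (u @ s)) \<le> 2 * (ln (4 * real n) + 2 * real m * d v / p)" if v: "v \<in> W" for v
  proof -
    have "2 ^ load A v u * 2 ^ load A v s / q v \<le> (\<Sum>v\<in>W. 2 ^ load A v u * 2 ^ load A v s / q v)"
      using W(1) v q0 by (intro member_le_sum) (auto simp: less_imp_le)
    moreover have "GO u / (4 * g) \<ge> 0" "GI u s / (4 * g) \<ge> 0" using GO0 GI0 g by auto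
    ultimately have "2 ^ load A v u * 2 ^ load A v s / q v \<le> 1" using us(3) unfolding T_def by linarith
    then have "2 ^ load A v (u @ s) \<le> q v" using q0[of v] by (simp add: load_def power_add field_simps)
    then have "ln (2 ^ load A v (u @ s)) \<le> ln (q v)" using q0[of v] by (subst ln_le_cancel_iff) auto
    then have "real (load A v (u @ s)) * ln 2 \<le> ln (4 * real n) + 2 * real m * d v / p"
      using n0 unfolding q_def by (simp add: ln_mult ln_realpow)
    moreover have "real (load A v (u @ s)) * (1 / 2) \<le> real (load A v (u @ s)) * ln 2"
      using ln2_ge_half by (intro mult_left_mono) auto
    ultimately have "real (load A v (u @ s)) * (1 / 2) \<le> ln (4 * real n) + 2 * real m * d v / p"
      by (rule order_trans[rotated])
    then show ?thesis by (simp add: field_simps)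
  qed
  have price: "2 * real (card Y) * G + (\<Sum>v\<in>Y. 1 + real (load A v (u @ s))) \<le> (\<Sum>v\<in>Y. cut_price A I n m v)"
    if "Y \<subseteq> W" "G \<le> 4 * g" for Y G
  proof -
    have "2 * real (card Y) * G \<le> 2 * real (card Y) * (4 * g)" using that by (intro mult_left_mono) auto
    also have "\<dots> = (\<Sum>v\<in>Y. 8 * g)" by simp
    finally have "2 * real (card Y) * G + (\<Sum>v\<in>Y. 1 + real (load A v (u @ s))) \<le> (\<Sum>v\<in>Y. 8 * g + (1 + real (load A v (u @ s))))"
      by (simp add: sum.distrib)
    also have "\<dots> \<le> (\<Sum>v\<in>Y. cut_price A I n m v)"
    proof (rule sum_mono)
      fix v assume "v \<in> Y"
      then have "v \<in> W" using that by blast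
      from ld[OF this] show "8 * g + (1 + real (load A v (u @ s))) \<le> cut_price A I n m v"
        unfolding cut_price_def g_def p_def d_def by simp
    qed
    finally show ?thesis .
  qed
  define Y1 Y2 where "Y1 = ?B u" and "Y2 = ?C u s"
  have YW: "Y1 \<subseteq> W" "Y2 \<subseteq> W" unfolding Y1_def Y2_def using ball_subset W by metis+
  have l1: "real (loss R A I W Y1) \<le> (\<Sum>v\<in>Y1. cut_price A I n m v)"
  proof -
    have "real (loss R A I W Y1) \<le> 2 * real (card Y1) * GO u + (\<Sum>v\<in>Y1. 1 + real (load A v (u @ s)))"
      using ball_loss[OF I W(1,2) Y1_def, of i0 "u @ s" A] unfolding GO_def Y1_def by auto
    also have "\<dots> \<le> (\<Sum>v\<in>Y1. cut_price A I n m v)" using price[OF YW(1) GOg] .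
    finally show ?thesis .
  qed
  have l2: "real (loss ?R' A I W Y2) \<le> (\<Sum>v\<in>Y2. cut_price A I n m v)"
  proof -
    have "real (loss ?R' A I W Y2) \<le> 2 * real (card Y2) * GI u s + (\<Sum>v\<in>Y2. 1 + real (load A v (u @ s)))"
      using ball_loss[OF I W(1,3) Y2_def, of i0 "u @ s" A] unfolding GI_def Y2_def by auto
    also have "\<dots> \<le> (\<Sum>v\<in>Y2. cut_price A I n m v)" using price[OF YW(2) GIg] .
    finally show ?thesis .
  qed
  have disj: "Y1 \<inter> Y2 = {}"
  proof (rule ccontr)
    assume "Y1 \<inter> Y2 \<noteq> {}"
    then obtain z where "z \<in> Y1" "z \<in> Y2" by blast
    then obtain Q Q' where Q: "Q \<subseteq> set u - {i0}" "rainbow R x Q z"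
      "Q' \<subseteq> set s - insert i0 (set u)" "rainbow ?R' y Q' z"
      using ball_rainbow[of z R W "{i0}" x u] ball_rainbow[of z ?R' W "insert i0 (set u)" y s]
      unfolding Y1_def Y2_def by blast
    have "rainbow R x (Q \<union> Q') y"
      using rainbow_append[OF rainbow_converse[OF Q(4)] Q(2)] Q(1,3) by blast
    moreover have "Q \<union> Q' \<subseteq> I - {i0}" using Q(1,3) us(1,2) by (auto simp: lists_of_def)
    ultimately show False using nb by blast
  qed
  have fin: "finite Y1" "finite Y2" using YW W(1) finite_subset by blast+
  have "card Y1 + card Y2 \<le> card W"
    using card_mono[OF W(1), of "Y1 \<union> Y2"] card_Un_disjoint[OF fin disj] YW by simp
  then have "2 * card Y1 \<le> card W \<or> 2 * card Y2 \<le> card W" by linarith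
  moreover have "Y1 \<noteq> {}" "Y2 \<noteq> {}" using ball_center[of x R W "{i0}" u] ball_center[of y ?R' W "insert i0 (set u)" s]
    unfolding Y1_def Y2_def by blast+
  ultimately show ?thesis using YW l1 l2 by blast
qed

section \<open>Recursive cutting into an acyclic subsystem\<close>

lemma acyclic_two_parts:
  assumes a1: "acyclic (E \<inter> S \<times> S)" and a2: "acyclic (E \<inter> T \<times> T)" and ST: "S \<inter> T = {}"
    and E: "E \<subseteq> (S \<union> T) \<times> (S \<union> T)" and no: "E \<inter> T \<times> S = {}"
  shows "acyclic E"
proof (rule acyclicI, rule allI, rule notI)
  fix x assume x: "(x, x) \<in> E\<^sup>+"
  have T: "(u, w) \<in> (E \<inter> T \<times> T)\<^sup>+ \<and> w \<in> T" if "(u, w) \<in> E\<^sup>+" "u \<in> T" for u w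
    using that
  proof (induction rule: trancl_induct)
    case (base y)
    then show ?case using E no by blast
  next
    case (step y z)
    then have "(y, z) \<in> E \<inter> T \<times> T" using E no by blast
    then show ?case using step by (auto intro: trancl_into_trancl)
  qed
  have S: "(u, w) \<in> (E \<inter> S \<times> S)\<^sup>+" if "(u, w) \<in> E\<^sup>+" "w \<in> S" for u w
    using that
  proof (induction rule: converse_trancl_induct)
    case (base y)
    then show ?case using E no by blast
  next
    case (step y z)
    have "z \<in> S"
    proof (rule ccontr)
      assume "z \<notin> S"
      then have "z \<in> T" using step.hyps(1) E by blast
      then have "w \<in> T" using T[OF step.hyps(2)] by blast
      then show False using step.prems ST by blast
    qed
    then have "(y, z) \<in> E \<inter> S \<times> S" using step.hyps(1) E no by blast
    then show ?case using step by (meson trancl_into_trancl2)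
  qed
  have "x \<in> S \<union> T" using x E by (meson tranclD SigmaE subsetD mem_Sigma_iff)
  then show False using S[OF x] T[OF x] a1 a2 unfolding acyclic_def by blast
qed

definition restr :: "('i \<Rightarrow> ('a \<times> 'a) set) \<Rightarrow> 'i set \<Rightarrow> ('i \<Rightarrow> 'a set) \<Rightarrow> ('a \<times> 'a) set" where
  "restr R I A = (\<Union>i\<in>I. R i \<inter> A i \<times> A i)"

lemma restr_converse: "restr (\<lambda>i. (R i)\<inverse>) I A = (restr R I A)\<inverse>"
  by (auto simp: restr_def)

text \<open>After each path has paid the cheaper side of \<open>loss\<close>, no step leads from
  \<open>Y\<close> to the rest, so a cycle would lie within one of the two parts.\<close>

lemma merge_cut:
  assumes I: "finite I" and W: "finite W" "Y \<subseteq> W"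
    and AY: "\<And>i. i \<in> I \<Longrightarrow> AY i \<subseteq> A i \<inter> Y" "acyclic (restr R I AY)"
    and AZ: "\<And>i. i \<in> I \<Longrightarrow> AZ i \<subseteq> A i \<inter> (W - Y)" "acyclic (restr R I AZ)"
  shows "\<exists>A'. (\<forall>i\<in>I. A' i \<subseteq> A i \<inter> W) \<and> acyclic (restr R I A') \<and>
    (\<Sum>i\<in>I. card (AY i)) + (\<Sum>i\<in>I. card (AZ i)) \<le> (\<Sum>i\<in>I. card (A' i)) + loss R A I W Y"
proof -
  define A' where "A' i = (if card (outs R W i Y) \<le> card (A i \<inter> Y) then AY i \<union> (AZ i - outs R W i Y) else AZ i)" for i
  have fin: "finite (AY i)" "finite (AZ i)" "AY i \<inter> AZ i = {}" if "i \<in> I" for i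
    using AY(1)[OF that] AZ(1)[OF that] W by (auto intro: finite_subset)
  have sub: "A' i \<subseteq> A i \<inter> W" if "i \<in> I" for i
    using AY(1)[OF that] AZ(1)[OF that] W by (auto simp: A'_def)
  have cardA': "card (AY i) + card (AZ i) \<le> card (A' i) + min (card (outs R W i Y)) (card (A i \<inter> Y))" if "i \<in> I" for i
  proof (cases "card (outs R W i Y) \<le> card (A i \<inter> Y)")
    case True
    have "card (AZ i) \<le> card (AZ i - outs R W i Y) + card (outs R W i Y)"
    proof -
      have "finite (outs R W i Y)" using W by (auto simp: outs_def)
      then show ?thesis by (metis add.commute diff_card_le_card_Diff le_diff_conv)
    qed
    moreover have "card (A' i) = card (AY i) + card (AZ i - outs R W i Y)"
      unfolding A'_def using True fin[OF that] by (simp, subst card_Un_disjoint) auto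
    ultimately show ?thesis using True by simp
  next
    case False
    have "card (AY i) \<le> card (A i \<inter> Y)" using AY(1)[OF that] W by (intro card_mono) (auto intro: finite_subset)
    then show ?thesis using False by (simp add: A'_def)
  qed
  have "acyclic (restr R I A')"
  proof (rule acyclic_two_parts[where S = "W - Y" and T = Y])
    have "restr R I A' \<inter> (W - Y) \<times> (W - Y) \<subseteq> restr R I AZ"
      using AY(1) AZ(1) by (fastforce simp: restr_def A'_def split: if_splits)
    then show "acyclic (restr R I A' \<inter> (W - Y) \<times> (W - Y))" using AZ(2) acyclic_subset by blast
    have "restr R I A' \<inter> Y \<times> Y \<subseteq> restr R I AY"
      using AY(1) AZ(1) by (fastforce simp: restr_def A'_def split: if_splits)
    then show "acyclic (restr R I A' \<inter> Y \<times> Y)" using AY(2) acyclic_subset by blast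
    show "restr R I A' \<subseteq> (W - Y \<union> Y) \<times> (W - Y \<union> Y)" using sub W by (auto simp: restr_def)
    show "restr R I A' \<inter> Y \<times> (W - Y) = {}"
    proof (rule ccontr)
      assume "restr R I A' \<inter> Y \<times> (W - Y) \<noteq> {}"
      then obtain i y z where h: "i \<in> I" "(y, z) \<in> R i" "y \<in> A' i" "z \<in> A' i" "y \<in> Y" "z \<in> W - Y"
        by (auto simp: restr_def)
      then have "z \<in> outs R W i Y" by (auto simp: outs_def)
      then show False using h AZ(1)[OF h(1)] AY(1)[OF h(1)] by (auto simp: A'_def split: if_splits)
    qed
  qed auto
  moreover have "(\<Sum>i\<in>I. card (AY i)) + (\<Sum>i\<in>I. card (AZ i)) \<le> (\<Sum>i\<in>I. card (A' i)) + loss R A I W Y"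
    unfolding loss_def sum.distrib[symmetric] using cardA' by (rule sum_mono)
  ultimately show ?thesis using sub by blast
qed

text \<open>Each cut is paid by the nodes of its smaller side \<open>Y\<close>. For these log2 of
  the current part drops by at least 1, so a node pays at most log2 |W| times.\<close>

lemma acyclic_subsystem:
  fixes R :: "'i \<Rightarrow> ('a \<times> 'a) set" and A :: "'i \<Rightarrow> 'a set"
  assumes I: "finite I" and W: "finite W" "card W \<le> n" and m: "m > 0"
    and nb: "\<And>i x y Q. i \<in> I \<Longrightarrow> (x, y) \<in> R i \<Longrightarrow> Q \<subseteq> I - {i} \<Longrightarrow> \<not> rainbow R x Q y"
  shows "\<exists>A'. (\<forall>i\<in>I. A' i \<subseteq> A i \<inter> W) \<and> acyclic (restr R I A') \<and>
    real (\<Sum>i\<in>I. card (A i \<inter> W)) \<le> real (\<Sum>i\<in>I. card (A' i))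
      + log 2 (real (card W)) * (\<Sum>v\<in>W. cut_price A I n m v)"
  using W
proof (induction "card W" arbitrary: W rule: less_induct)
  case less
  let ?c = "cut_price A I n m"
  show ?case
  proof (cases "\<exists>i\<in>I. \<exists>x\<in>W. \<exists>y\<in>W. (x, y) \<in> R i")
    case False
    have c0: "?c v \<ge> 0" if "W \<noteq> {}" for v
    proof -
      have "n \<ge> 1" using that less.prems by (metis One_nat_def Suc_leI card_gt_0_iff le_trans)
      then show ?thesis unfolding cut_price_def by (intro add_nonneg_nonneg mult_nonneg_nonneg divide_nonneg_nonneg) auto
    qed
    have "log 2 (real (card W)) * (\<Sum>v\<in>W. ?c v) \<ge> 0"
    proof (cases "W = {}")
      case False
      then have "card W \<ge> 1" using less.prems by (metis One_nat_def Suc_leI card_gt_0_iff)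
      then show ?thesis using c0[OF False] by (intro mult_nonneg_nonneg sum_nonneg) auto
    qed simp
    moreover have "restr R I (\<lambda>i. A i \<inter> W) = {}" using False by (auto simp: restr_def)
    ultimately show ?thesis by (intro exI[of _ "\<lambda>i. A i \<inter> W"]) (simp add: acyclic_def)
  next
    case True
    then obtain i x y where h: "i \<in> I" "x \<in> W" "y \<in> W" "(x, y) \<in> R i" by blast
    obtain Y where Y: "Y \<subseteq> W" "Y \<noteq> {}" "2 * card Y \<le> card W"
      "real (loss R A I W Y) \<le> (\<Sum>v\<in>Y. ?c v) \<or> real (loss (\<lambda>i. (R i)\<inverse>) A I W Y) \<le> (\<Sum>v\<in>Y. ?c v)"
      using sparse_cut[OF I h(1) less.prems(1) h(2,3) less.prems(2) m nb[OF h(1,4)], of A] by blast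
    have fY: "finite Y" "finite (W - Y)" using Y less.prems finite_subset by blast+
    have cY: "card Y \<ge> 1" using Y fY by (metis One_nat_def Suc_leI card_gt_0_iff)
    have cZ: "card (W - Y) = card W - card Y" using Y fY by (simp add: card_Diff_subset)
    have lt: "card Y < card W" "card (W - Y) < card W" "card (W - Y) \<ge> 1" using Y cY cZ by linarith+
    obtain AY where AY: "\<forall>i\<in>I. AY i \<subseteq> A i \<inter> Y" "acyclic (restr R I AY)"
      "real (\<Sum>i\<in>I. card (A i \<inter> Y)) \<le> real (\<Sum>i\<in>I. card (AY i)) + log 2 (real (card Y)) * (\<Sum>v\<in>Y. ?c v)"
      using less.hyps[OF lt(1) fY(1)] lt less.prems by auto
    obtain AZ where AZ: "\<forall>i\<in>I. AZ i \<subseteq> A i \<inter> (W - Y)" "acyclic (restr R I AZ)"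
      "real (\<Sum>i\<in>I. card (A i \<inter> (W - Y))) \<le> real (\<Sum>i\<in>I. card (AZ i)) + log 2 (real (card (W - Y))) * (\<Sum>v\<in>W - Y. ?c v)"
      using less.hyps[OF lt(2) fY(2)] lt less.prems by auto
    have c0: "?c v \<ge> 0" for v
    proof -
      have "n \<ge> 1" using cY lt less.prems by linarith
      then show ?thesis unfolding cut_price_def by (intro add_nonneg_nonneg mult_nonneg_nonneg divide_nonneg_nonneg) auto
    qed
    obtain A' where A': "\<forall>i\<in>I. A' i \<subseteq> A i \<inter> W" "acyclic (restr R I A')"
      "real ((\<Sum>i\<in>I. card (AY i)) + (\<Sum>i\<in>I. card (AZ i))) \<le> real (\<Sum>i\<in>I. card (A' i)) + (\<Sum>v\<in>Y. ?c v)"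
      using Y(4)
    proof
      assume l: "real (loss R A I W Y) \<le> (\<Sum>v\<in>Y. ?c v)"
      from merge_cut[OF I less.prems(1) Y(1), of AY A R AZ] AY AZ obtain A' where
        "\<forall>i\<in>I. A' i \<subseteq> A i \<inter> W" "acyclic (restr R I A')"
        "(\<Sum>i\<in>I. card (AY i)) + (\<Sum>i\<in>I. card (AZ i)) \<le> (\<Sum>i\<in>I. card (A' i)) + loss R A I W Y" by blast
      with l show thesis by (intro that[of A']) linarith+
    next
      \<comment> \<open>The cut comes from an in-ball. Acyclicity is invariant under reversal, so
        the merge is done in the reversed system.\<close>
      assume l: "real (loss (\<lambda>i. (R i)\<inverse>) A I W Y) \<le> (\<Sum>v\<in>Y. ?c v)"
      from merge_cut[OF I less.prems(1) Y(1), of AY A "\<lambda>i. (R i)\<inverse>" AZ] AY AZ obtain A' where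
        "\<forall>i\<in>I. A' i \<subseteq> A i \<inter> W" "acyclic (restr R I A')"
        "(\<Sum>i\<in>I. card (AY i)) + (\<Sum>i\<in>I. card (AZ i)) \<le> (\<Sum>i\<in>I. card (A' i)) + loss (\<lambda>i. (R i)\<inverse>) A I W Y"
        unfolding restr_converse acyclic_converse by blast
      with l show thesis by (intro that[of A']) linarith+
    qed
    have split: "(\<Sum>i\<in>I. card (A i \<inter> W)) = (\<Sum>i\<in>I. card (A i \<inter> Y)) + (\<Sum>i\<in>I. card (A i \<inter> (W - Y)))"
      unfolding sum.distrib[symmetric]
    proof (rule sum.cong)
      fix i
      have "A i \<inter> W = (A i \<inter> Y) \<union> (A i \<inter> (W - Y))" using Y by blast
      then show "card (A i \<inter> W) = card (A i \<inter> Y) + card (A i \<inter> (W - Y))"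
        using fY by (simp, subst card_Un_disjoint) auto
    qed simp
    let ?L = "log 2 (real (card W))"
    have lY: "log 2 (real (card Y)) \<le> ?L - 1"
    proof -
      have "log 2 (2 * real (card Y)) \<le> ?L" using Y(3) cY by (subst log_le_cancel_iff) auto
      then show ?thesis using cY by (simp add: log_mult)
    qed
    have lZ: "log 2 (real (card (W - Y))) \<le> ?L" using lt by (subst log_le_cancel_iff) auto
    have "log 2 (real (card Y)) * (\<Sum>v\<in>Y. ?c v) \<le> (?L - 1) * (\<Sum>v\<in>Y. ?c v)"
      using lY c0 by (intro mult_right_mono sum_nonneg) auto
    moreover have "log 2 (real (card (W - Y))) * (\<Sum>v\<in>W - Y. ?c v) \<le> ?L * (\<Sum>v\<in>W - Y. ?c v)"
      using lZ c0 by (intro mult_right_mono sum_nonneg) auto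
    moreover have "(\<Sum>v\<in>W. ?c v) = (\<Sum>v\<in>W - Y. ?c v) + (\<Sum>v\<in>Y. ?c v)"
      using Y less.prems by (intro sum.subset_diff) auto
    ultimately have "log 2 (real (card Y)) * (\<Sum>v\<in>Y. ?c v) + log 2 (real (card (W - Y))) * (\<Sum>v\<in>W - Y. ?c v) + (\<Sum>v\<in>Y. ?c v)
        \<le> ?L * (\<Sum>v\<in>W. ?c v)" by (simp add: algebra_simps)
    then have "real (\<Sum>i\<in>I. card (A i \<inter> W)) \<le> real (\<Sum>i\<in>I. card (A' i)) + ?L * (\<Sum>v\<in>W. ?c v)"
      using AY(3) AZ(3) A'(3) split by linarith
    then show ?thesis using A' by blast
  qed
qed

subsection \<open>Random shifts\<close>

text \<open>The level reached by a greedy walk through the columns when the cells of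
  \<open>K\<close> are removed: a column is used if its cell of the current level survives and is
  skipped otherwise. A demand survives if level \<open>h\<close> is reached.\<close>

fun climb :: "('x \<times> nat) set \<Rightarrow> nat \<Rightarrow> nat \<Rightarrow> 'x list \<Rightarrow> nat list \<Rightarrow> nat" where
  "climb K h t (x # xs) (r # rs) = climb K h (if (x, (t + r) mod h) \<in> K then t else Suc t) xs rs"
| "climb K h t _ _ = t"

definition blocked :: "('x \<times> nat) set \<Rightarrow> nat \<Rightarrow> 'x \<Rightarrow> nat" where
  "blocked K h x = card {j \<in> {..<h}. (x, j) \<in> K}"

lemma climb_ge: "t \<le> climb K h t xs rs"
  by (induction K h t xs rs rule: climb.induct) (auto split: if_splits)

lemma climb_empty: "length rs = length xs \<Longrightarrow> climb {} h t xs rs = t + length xs"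
  by (induction "{} :: ('a \<times> nat) set" h t xs rs rule: climb.induct) auto

lemma blocked_le: "blocked K h x \<le> h"
  unfolding blocked_def using card_mono[of "{..<h}" "{j \<in> {..<h}. (x, j) \<in> K}"] by auto

lemma shift_mod_inj:
  fixes i j h :: nat
  assumes "i < h" "j < h" "(t + i) mod h = (t + j) mod h" shows "i = j"
proof -
  have *: "b = a" if "a \<le> b" "b < h" "(t + a) mod h = (t + b) mod h" for a b :: nat
  proof -
    have "h dvd (t + b) - (t + a)" using that mod_eq_dvd_iff_nat[of "t + a" "t + b" h] by simp
    then show ?thesis using that by (metis diff_add_inverse diff_is_0_eq dvd_imp_le le_antisym less_imp_diff_less
          not_gr_zero not_le diff_cancel)
  qed
  show ?thesis using assms *[of i j] *[of j i] by (metis nat_le_linear)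
qed

lemma bij_betw_shift:
  assumes "h > 0" shows "bij_betw (\<lambda>i. (t + i) mod h) {..<h} {..<h :: nat}"
proof -
  have inj: "inj_on (\<lambda>i. (t + i) mod h) {..<h}"
    by (rule inj_onI) (use shift_mod_inj in blast)
  have "(\<lambda>i. (t + i) mod h) ` {..<h} = {..<h}"
    using assms by (intro endo_inj_surj inj) auto
  with inj show ?thesis by (simp add: bij_betw_def)
qed

text \<open>Whatever the current level, a uniform shift makes the cell tried in the next column
  uniform among its \<open>h\<close> cells. The chance of success therefore does not depend on the
  past, and the generating function at 1/4 factorizes.\<close>

lemma climb_moment:
  assumes h: "h > 0"
  shows "(\<Sum>rs\<in>lists_of {..<h} (length xs). (1 / 4 :: real) ^ (climb K h t xs rs - t))
    = (\<Prod>x\<leftarrow>xs. (real h - real (blocked K h x)) / 4 + real (blocked K h x))"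
proof (induction xs arbitrary: t)
  case (Cons x xs)
  let ?w = "\<lambda>xs t. \<Sum>rs\<in>lists_of {..<h} (length xs). (1 / 4 :: real) ^ (climb K h t xs rs - t)"
  let ?P = "\<Prod>x\<leftarrow>xs. (real h - real (blocked K h x)) / 4 + real (blocked K h x)"
  have "?w (x # xs) t = (\<Sum>i<h. \<Sum>rs\<in>lists_of {..<h} (length xs). (1 / 4 :: real) ^ (climb K h t (x # xs) (i # rs) - t))"
    by (simp only: list.size sum_lists_of_Suc[OF finite_lessThan] add_Suc_right add_0_right) (rule sum.swap)
  also have "\<dots> = (\<Sum>i<h. ?P * (if (x, (t + i) mod h) \<in> K then 1 else 1 / 4))"
  proof (rule sum.cong)
    fix i
    show "(\<Sum>rs\<in>lists_of {..<h} (length xs). (1 / 4 :: real) ^ (climb K h t (x # xs) (i # rs) - t))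
      = ?P * (if (x, (t + i) mod h) \<in> K then 1 else 1 / 4)"
    proof (cases "(x, (t + i) mod h) \<in> K")
      case True
      then show ?thesis using Cons.IH[of t] by simp
    next
      case False
      have "(1 / 4 :: real) ^ (climb K h (Suc t) xs rs - t) = 1 / 4 * (1 / 4) ^ (climb K h (Suc t) xs rs - Suc t)" for rs
        using climb_ge[of "Suc t" K h xs rs] by (metis Suc_diff_le diff_Suc_Suc power_Suc)
      then have "(\<Sum>rs\<in>lists_of {..<h} (length xs). (1 / 4 :: real) ^ (climb K h (Suc t) xs rs - t)) = 1 / 4 * ?w xs (Suc t)"
        unfolding sum_distrib_left by (intro sum.cong refl)
      then show ?thesis using False Cons.IH[of "Suc t"] by simp
    qed
  qed simp
  also have "\<dots> = ?P * (\<Sum>i<h. if (x, (t + i) mod h) \<in> K then 1 else 1 / 4)" by (simp add: sum_distrib_left)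
  also have "(\<Sum>i<h. if (x, (t + i) mod h) \<in> K then 1 else 1 / 4 :: real) = (\<Sum>j<h. if (x, j) \<in> K then 1 else 1 / 4)"
    using sum.reindex_bij_betw[OF bij_betw_shift[OF h, of t], of "\<lambda>j. if (x, j) \<in> K then 1 else 1 / 4 :: real"] by simp
  also have "\<dots> = (\<Sum>j<h. 1 / 4 + (if (x, j) \<in> K then 3 / 4 else 0))" by (intro sum.cong) auto
  also have "\<dots> = (real h - real (blocked K h x)) / 4 + real (blocked K h x)"
    unfolding sum.distrib by (simp add: sum.If_cases blocked_def Int_def diff_divide_distrib)
  finally show ?case by simp
qed simp

definition dense :: "('x \<times> nat) set \<Rightarrow> nat \<Rightarrow> 'x \<Rightarrow> bool" where
  "dense K h x \<longleftrightarrow> h < 2 * blocked K h x"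

definition sparse_list :: "('x \<times> nat) set \<Rightarrow> nat \<Rightarrow> 'x list \<Rightarrow> bool" where
  "sparse_list K h xs \<longleftrightarrow> length xs \<le> 2 * length (filter (\<lambda>x. \<not> dense K h x) xs)"

lemma climb_product_le:
  assumes h: "h > 0"
  shows "(\<Prod>x\<leftarrow>xs. (real h - real (blocked K h x)) / 4 + real (blocked K h x))
    \<le> real h ^ length xs * (5 / 8) ^ length (filter (\<lambda>x. \<not> dense K h x) xs)"
proof (induction xs)
  case (Cons x xs)
  let ?f = "\<lambda>x. (real h - real (blocked K h x)) / 4 + real (blocked K h x)"
  have f: "?f x \<le> real h * (if dense K h x then 1 else 5 / 8)"
  proof (cases "dense K h x")
    case True
    have "real (blocked K h x) \<le> real h" using blocked_le[of K h x] by simp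
    then show ?thesis using True by (simp add: field_simps)
  next
    case False
    then have "2 * real (blocked K h x) \<le> real h" unfolding dense_def by linarith
    then show ?thesis using False by (simp add: field_simps)
  qed
  have f0: "0 \<le> ?f y" for y using blocked_le[of K h y] by simp
  have P0: "0 \<le> (\<Prod>x\<leftarrow>xs. ?f x)" by (induction xs) (use f0 in auto)
  have "(\<Prod>x\<leftarrow>x # xs. ?f x) = ?f x * (\<Prod>x\<leftarrow>xs. ?f x)" by simp
  also have "\<dots> \<le> (real h * (if dense K h x then 1 else 5 / 8)) * (real h ^ length xs * (5 / 8) ^ length (filter (\<lambda>x. \<not> dense K h x) xs))"
    using f f0 P0 Cons by (intro mult_mono) auto
  also have "\<dots> = real h ^ length (x # xs) * (5 / 8) ^ length (filter (\<lambda>x. \<not> dense K h x) (x # xs))"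
    by simp
  finally show ?case .
qed simp

text \<open>Chernoff bound. A column with at most half of its cells blocked contributes a factor 1/2
  * 1/4 + 1/2 = 5/8, and Markov's inequality costs 4^h. With h at most l/32 and at least l/2 such
  columns the exponent is at most l/16 - 3 l/16 = - l/8.\<close>

lemma killed_shifts:
  assumes h: "h > 0" "32 * h \<le> length xs" and sp: "sparse_list K h xs"
  shows "real (card {rs \<in> lists_of {..<h} (length xs). climb K h 0 xs rs < h})
    \<le> real h ^ length xs * exp (- real (length xs) / 8)"
proof -
  let ?L = "lists_of {..<h} (length xs)" and ?s = "length (filter (\<lambda>x. \<not> dense K h x) xs)"
  have fL: "finite ?L" by (simp add: finite_lists_of)
  have "real (card {rs \<in> ?L. climb K h 0 xs rs < h}) = (\<Sum>rs\<in>{rs \<in> ?L. climb K h 0 xs rs < h}. 1)" by simp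
  also have "\<dots> \<le> (\<Sum>rs\<in>{rs \<in> ?L. climb K h 0 xs rs < h}. 4 ^ h * (1 / 4 :: real) ^ climb K h 0 xs rs)"
  proof (rule sum_mono)
    fix rs assume "rs \<in> {rs \<in> ?L. climb K h 0 xs rs < h}"
    then have "(4 :: real) ^ climb K h 0 xs rs \<le> 4 ^ h" by (intro power_increasing) auto
    then show "1 \<le> 4 ^ h * (1 / 4 :: real) ^ climb K h 0 xs rs" by (simp add: power_divide)
  qed
  also have "\<dots> \<le> (\<Sum>rs\<in>?L. 4 ^ h * (1 / 4 :: real) ^ climb K h 0 xs rs)"
    using fL by (intro sum_mono2) auto
  also have "\<dots> = 4 ^ h * (\<Prod>x\<leftarrow>xs. (real h - real (blocked K h x)) / 4 + real (blocked K h x))"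
    using climb_moment[OF h(1), of K 0 xs] by (simp add: sum_distrib_left[symmetric])
  also have "\<dots> \<le> 4 ^ h * (real h ^ length xs * (5 / 8) ^ ?s)"
    using climb_product_le[OF h(1)] by (intro mult_left_mono) auto
  also have "\<dots> = real h ^ length xs * (4 ^ h * (5 / 8) ^ ?s)" by simp
  also have "4 ^ h * (5 / 8) ^ ?s \<le> exp (- real (length xs) / 8)"
  proof -
    have l4: "ln (4 :: real) \<le> 2"
    proof -
      have "ln (4 :: real) = 2 * ln 2" using ln_realpow[of 2 2] by simp
      then show ?thesis using ln_le_minus_one[of "2 :: real"] by simp
    qed
    have l8: "3 / 8 \<le> ln (8 / 5 :: real)" using ln_one_plus_ge[of "3 / 5"] by simp
    have "ln (4 ^ h * (5 / 8 :: real) ^ ?s) = real h * ln 4 - real ?s * ln (8 / 5)"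
    proof -
      have "ln (5 / 8 :: real) = - ln (8 / 5)" using ln_div[of 5 8] ln_div[of 8 5] by simp
      then show ?thesis by (simp add: ln_mult ln_realpow)
    qed
    also have "\<dots> \<le> real h * 2 - real ?s * (3 / 8)"
      using l4 l8 by (intro diff_mono mult_left_mono) auto
    also have "\<dots> \<le> - real (length xs) / 8"
    proof -
      have "real (length xs) \<le> 2 * real ?s" using sp unfolding sparse_list_def by linarith
      moreover have "32 * real h \<le> real (length xs)" using h(2) by linarith
      ultimately show ?thesis by linarith
    qed
    finally have "exp (ln (4 ^ h * (5 / 8 :: real) ^ ?s)) \<le> exp (- real (length xs) / 8)"
      by (simp only: exp_le_cancel_iff)
    moreover have "exp (ln (4 ^ h * (5 / 8 :: real) ^ ?s)) = 4 ^ h * (5 / 8) ^ ?s" by (rule exp_ln) simp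
    ultimately show ?thesis by simp
  qed
  finally show ?thesis by (simp add: mult_left_mono)
qed

section \<open>Shifts that are good for all sets of cells at once\<close>

lemma one_plus_inverse_power_le: "(1 + 1 / real n) ^ n \<le> exp 1"
proof (cases "n = 0")
  case False
  have "(1 + 1 / real n) ^ n \<le> exp (1 / real n) ^ n"
    by (intro power_mono exp_ge_add_one_self) auto
  also have "\<dots> = exp 1" using False by (simp add: exp_of_nat_mult[symmetric])
  finally show ?thesis .
qed simp

lemma sum_Pow_power:
  fixes y :: real
  assumes "finite C" shows "(\<Sum>K\<in>Pow C. y ^ card K) = (1 + y) ^ card C"
  using prod_add[OF assms, of "\<lambda>_. y" "\<lambda>_. 1"] by (simp add: add.commute)

text \<open>For random shifts, the sum over all sets K of cells of M^(-|K|) z^(number of killed sparse lists),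
  where M is the number of cells and z = exp(l/8) / p, has expectation at most e^2.\<close>

lemma exists_shifts:
  fixes col :: "nat \<Rightarrow> 'x list"
  assumes h: "h > 0" "32 * h \<le> l" and col: "\<And>c. c < p \<Longrightarrow> length (col c) = l" and p: "p > 0"
    and X: "finite X" "X \<noteq> {}"
  shows "\<exists>r. (\<forall>c<p. r c \<in> lists_of {..<h} l) \<and> (\<forall>K \<subseteq> X \<times> {..<h}.
    real (card {c \<in> {..<p}. sparse_list K h (col c) \<and> climb K h 0 (col c) (r c) < h}) * (real l / 8 - ln (real p))
      \<le> 2 + real (card K) * ln (real (card X * h)))"
proof -
  define L where "L = lists_of {..<h} l"
  define C where "C = X \<times> {..<h}"
  define M where "M = card C"
  \<comment> \<open>The largest weight that the Chernoff bound allows: z exp(- l/8) = 1/p, so each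
    list contributes a factor 1 + 1/p and all of them at most e.\<close>
  define z where "z = exp (real l / 8) / real p"
  have z0: "z > 0" using p by (simp add: z_def)
  have fC: "finite C" and M: "M = card X * h" "M > 0"
    using X h by (auto simp: C_def M_def card_cartesian_product card_gt_0_iff)
  have fL: "finite L" and cL: "real (card L) = real h ^ l" by (auto simp: L_def finite_lists_of card_lists_of)
  have cL0: "real (card L) > 0" using cL h by simp
  define kill where "kill K r c \<longleftrightarrow> sparse_list K h (col c) \<and> climb K h 0 (col c) (r c) < h" for K r c
  let ?F = "Pi\<^sub>E {..<p} (\<lambda>_. L)"
  have one: "(\<Sum>r\<in>?F. z ^ card {c \<in> {..<p}. kill K r c}) \<le> real (card L) ^ p * exp 1" for K
  proof -
    have "(\<Sum>r\<in>?F. z ^ card {c \<in> {..<p}. kill K r c}) = (\<Sum>r\<in>?F. \<Prod>c<p. if sparse_list K h (col c) \<and> climb K h 0 (col c) (r c) < h then z else 1)"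
      by (intro sum.cong refl) (simp add: prod.If_cases kill_def Int_def)
    also have "\<dots> = (\<Prod>c<p. \<Sum>rs\<in>L. if sparse_list K h (col c) \<and> climb K h 0 (col c) rs < h then z else 1)"
      using fL by (intro prod_sum_PiE[symmetric]) auto
    also have "\<dots> \<le> (\<Prod>c<p. real (card L) * (1 + 1 / real p))"
    proof (rule prod_mono, intro conjI)
      fix c assume c: "c \<in> {..<p}"
      show "0 \<le> (\<Sum>rs\<in>L. if sparse_list K h (col c) \<and> climb K h 0 (col c) rs < h then z else 1)"
        using z0 by (intro sum_nonneg) auto
      show "(\<Sum>rs\<in>L. if sparse_list K h (col c) \<and> climb K h 0 (col c) rs < h then z else 1) \<le> real (card L) * (1 + 1 / real p)"
      proof (cases "sparse_list K h (col c)")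
        case True
        have "(\<Sum>rs\<in>L. if climb K h 0 (col c) rs < h then z else 1) \<le> (\<Sum>rs\<in>L. 1 + (if climb K h 0 (col c) rs < h then z else 0))"
          by (intro sum_mono) auto
        also have "\<dots> = real (card L) + z * real (card {rs \<in> L. climb K h 0 (col c) rs < h})"
          using fL by (simp add: sum.distrib sum.If_cases Int_def)
        also have "\<dots> \<le> real (card L) + z * (real h ^ l * exp (- real l / 8))"
          using killed_shifts[OF h(1) _ True] h(2) col c z0 by (intro add_left_mono mult_left_mono) (auto simp: L_def)
        also have "\<dots> = real (card L) * (1 + 1 / real p)"
          using p by (simp add: z_def cL field_simps exp_minus)
        finally show ?thesis using True by simp
      next
        case False
        then show ?thesis using p by (simp add: field_simps)
      qed
    qed
    also have "\<dots> = real (card L) ^ p * (1 + 1 / real p) ^ p" by (simp add: power_mult_distrib)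
    also have "\<dots> \<le> real (card L) ^ p * exp 1" using one_plus_inverse_power_le by (intro mult_left_mono) auto
    finally show ?thesis .
  qed
  define \<Phi> where "\<Phi> r = (\<Sum>K\<in>Pow C. (1 / real M) ^ card K * z ^ card {c \<in> {..<p}. kill K r c})" for r
  have fF: "finite ?F" using fL by (intro finite_PiE) auto
  have cF: "real (card ?F) = real (card L) ^ p" by (simp add: card_PiE)
  have "(\<Sum>r\<in>?F. \<Phi> r) = (\<Sum>K\<in>Pow C. (1 / real M) ^ card K * (\<Sum>r\<in>?F. z ^ card {c \<in> {..<p}. kill K r c}))"
    unfolding \<Phi>_def sum_distrib_left by (rule sum.swap)
  also have "\<dots> \<le> (\<Sum>K\<in>Pow C. (1 / real M) ^ card K * (real (card L) ^ p * exp 1))"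
    using one by (intro sum_mono mult_left_mono) auto
  also have "\<dots> = (1 + 1 / real M) ^ M * (real (card L) ^ p * exp 1)"
    unfolding sum_distrib_right[symmetric] sum_Pow_power[OF fC] M_def ..
  also have "\<dots> \<le> exp 1 * (real (card L) ^ p * exp 1)"
    using one_plus_inverse_power_le by (intro mult_right_mono) auto
  also have "\<dots> = exp 2 * real (card ?F)" unfolding cF by (simp add: exp_add[symmetric])
  finally have "(\<Sum>r\<in>?F. \<Phi> r) \<le> exp 2 * real (card ?F)" .
  moreover have "?F \<noteq> {}" using cL0 by (auto simp: PiE_eq_empty_iff)
  ultimately obtain r where r: "r \<in> ?F" "\<Phi> r \<le> exp 2" using exists_le_average[OF fF] by blast
  have "real (card {c \<in> {..<p}. kill K r c}) * (real l / 8 - ln (real p)) \<le> 2 + real (card K) * ln (real M)"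
    if "K \<subseteq> C" for K
  proof -
    let ?k = "card {c \<in> {..<p}. kill K r c}"
    \<comment> \<open>All summands are nonnegative, so the bound on the sum holds for each
      \<open>K\<close> separately; logarithms turn it into a bound linear in |K|.\<close>
    have "(1 / real M) ^ card K * z ^ ?k \<le> \<Phi> r"
      unfolding \<Phi>_def using that fC z0 M by (intro member_le_sum[where f = "\<lambda>K. (1 / real M) ^ card K * z ^ card {c \<in> {..<p}. kill K r c}"]) auto
    then have "(1 / real M) ^ card K * z ^ ?k \<le> exp 2" using r by linarith
    then have "ln ((1 / real M) ^ card K * z ^ ?k) \<le> ln (exp 2)" using z0 M by (subst ln_le_cancel_iff) auto
    moreover have "ln ((1 / real M) ^ card K * z ^ ?k) = real ?k * ln z - real (card K) * ln (real M)"
      using z0 M(2) by (simp add: ln_mult ln_realpow ln_div)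
    moreover have "ln z = real l / 8 - ln (real p)" using p by (simp add: z_def ln_div)
    ultimately show ?thesis by simp
  qed
  then show ?thesis using r M unfolding kill_def C_def L_def by (intro exI[of _ r]) (auto simp: PiE_def Pi_def)
qed

subsection \<open>The gap instance\<close>

datatype 'x vertex = VIn 'x nat | VOut 'x nat | Src nat | Snk nat

instance vertex :: (countable) countable
  by countable_datatype

text \<open>A cut edge is charged to the cell that it enters, or else to the cell that it leaves.\<close>

fun edge_cell :: "'x vertex \<times> 'x vertex \<Rightarrow> 'x \<times> nat" where
  "edge_cell (_, VIn x j) = (x, j)"
| "edge_cell (VIn x j, _) = (x, j)"
| "edge_cell (VOut x j, _) = (x, j)"
| "edge_cell _ = undefined"

text \<open>Each list of columns carries h levels; level t occupies, in column a, the cell with index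
  t + r a (mod h), where r a is the shift of that column.\<close>

locale shifted_columns =
  fixes col :: "nat \<Rightarrow> 'x :: countable list" and r :: "nat \<Rightarrow> nat list" and X :: "'x set" and p l h \<Delta> :: nat
  assumes len: "\<And>c. c < p \<Longrightarrow> length (col c) = l" "\<And>c. c < p \<Longrightarrow> length (r c) = l"
    and dist: "\<And>c. c < p \<Longrightarrow> distinct (col c)" and sub: "\<And>c. c < p \<Longrightarrow> set (col c) \<subseteq> X"
    and X: "finite X" and p: "p > 0" and h: "h > 0" and hl: "h \<le> l"
    and deg: "\<And>x. x \<in> X \<Longrightarrow> card {c \<in> {..<p}. x \<in> set (col c)} \<le> \<Delta>"
    and separate: "\<And>c x y. c < p \<Longrightarrow> x \<in> set (col c) \<Longrightarrow> y \<in> set (col c) \<Longrightarrow>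
      (x, y) \<notin> (\<Union>c'\<in>{..<p} - {c}. {(u, w). precedes (col c') u w})\<^sup>+"
begin

definition idx :: "nat \<Rightarrow> nat \<Rightarrow> nat \<Rightarrow> nat" where
  "idx c a t = (t + r c ! a) mod h"

definition cell_edges :: "('x vertex \<times> 'x vertex) set" where
  "cell_edges = (\<lambda>(x, j). (VIn x j, VOut x j)) ` (X \<times> {..<h})"

text \<open>Hops lead to every later column, not just to the next one, so that a column with a
  blocked cell can be skipped, as in \<open>climb\<close>. Lists interact only through shared
  cells.\<close>

definition edges :: "('x vertex \<times> 'x vertex) set" where
  "edges = cell_edges
    \<union> {(Src c, VIn (col c ! a) (idx c a 0)) | c a. c < p \<and> a < l}
    \<union> {(VOut (col c ! a) (idx c a (h - 1)), Snk c) | c a. c < p \<and> a < l}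
    \<union> {(VOut (col c ! a) (idx c a t), VIn (col c ! b) (idx c b (Suc t))) | c a b t. c < p \<and> a < b \<and> b < l \<and> Suc t < h}"

definition verts :: "'x vertex set" where
  "verts = (\<lambda>(x, j). VIn x j) ` (X \<times> {..<h}) \<union> (\<lambda>(x, j). VOut x j) ` (X \<times> {..<h}) \<union> Src ` {..<p} \<union> Snk ` {..<p}"

definition pairs :: "('x vertex \<times> 'x vertex) set" where
  "pairs = (\<lambda>c. (Src c, Snk c)) ` {..<p}"

lemma colX: "c < p \<Longrightarrow> a < l \<Longrightarrow> col c ! a \<in> X"
  using sub[of c] len(1)[of c] by (metis nth_mem subsetD)

lemma idx_less [simp]: "idx c a t < h"
  using h by (simp add: idx_def)

lemma idx_inj: "t < h \<Longrightarrow> t' < h \<Longrightarrow> idx c a t = idx c a t' \<Longrightarrow> t = t'"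
  unfolding idx_def using shift_mod_inj[of t h t' "r c ! a"] by (simp add: add.commute)

lemma idx_surj:
  assumes "j < h" shows "\<exists>t<h. idx c a t = j"
proof -
  have "j \<in> (\<lambda>i. (r c ! a + i) mod h) ` {..<h}"
    using bij_betw_shift[OF h, of "r c ! a"] assms by (simp add: bij_betw_def)
  then obtain t where "t < h" "j = (r c ! a + t) mod h" by (auto simp: image_iff)
  then show ?thesis by (auto simp: idx_def add.commute)
qed

lemma verts_iff:
  "VIn x j \<in> verts \<longleftrightarrow> x \<in> X \<and> j < h" "VOut x j \<in> verts \<longleftrightarrow> x \<in> X \<and> j < h"
  "Src c \<in> verts \<longleftrightarrow> c < p" "Snk c \<in> verts \<longleftrightarrow> c < p"
  by (auto simp: verts_def image_iff)

lemma edges_verts: "edges \<subseteq> verts \<times> verts"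
  unfolding edges_def cell_edges_def by (auto simp: verts_iff colX)

lemma finite_verts: "finite verts"
  unfolding verts_def using X by auto

lemma card_verts: "card verts \<le> 2 * card X * h + 2 * p"
proof -
  have "card verts \<le> card ((\<lambda>(x, j). VIn x j) ` (X \<times> {..<h})) + card ((\<lambda>(x, j). VOut x j) ` (X \<times> {..<h}))
      + card (Src ` {..<p} :: 'x vertex set) + card (Snk ` {..<p} :: 'x vertex set)"
    unfolding verts_def by (meson add_mono card_Un_le le_refl order_trans)
  also have "\<dots> \<le> card (X \<times> {..<h}) + card (X \<times> {..<h}) + card {..<p} + card {..<p}"
    using X by (intro add_mono card_image_le) auto
  finally show ?thesis by (simp add: card_cartesian_product)
qed

definition level :: "nat \<Rightarrow> 'x \<Rightarrow> nat \<Rightarrow> nat" where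
  "level c x j = (THE t. t < h \<and> (\<exists>a<l. col c ! a = x \<and> idx c a t = j))"

lemma level_unique:
  assumes "c < p" "a < l" "t < h" shows "level c (col c ! a) (idx c a t) = t"
  unfolding level_def
proof (rule the_equality)
  fix t' assume "t' < h \<and> (\<exists>a'<l. col c ! a' = col c ! a \<and> idx c a' t' = idx c a t)"
  then obtain a' where a': "t' < h" "a' < l" "col c ! a' = col c ! a" "idx c a' t' = idx c a t" by blast
  then have "a' = a" using assms dist[OF assms(1)] len(1)[OF assms(1)] by (simp add: nth_eq_iff_index_eq)
  then show "t' = t" using a' assms idx_inj by blast
qed (use assms in blast)

lemma level_less:
  assumes "c < p" "x \<in> set (col c)" "j < h" shows "level c x j < h"
proof -
  obtain a where a: "a < l" "x = col c ! a" using assms len(1) by (metis in_set_conv_nth)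
  obtain t where "t < h" "idx c a t = j" using idx_surj[OF assms(3)] by blast
  then show ?thesis using level_unique[OF assms(1) a(1)] a by metis
qed

definition others :: "nat \<Rightarrow> ('x \<times> 'x) set" where
  "others c = (\<Union>c'\<in>{..<p} - {c}. {(u, w). precedes (col c') u w})"

text \<open>A walk that has left list c along other lists never returns to it, so its potential may drop to 0.\<close>

definition off :: "nat \<Rightarrow> 'x \<Rightarrow> nat" where
  "off c y = (if \<exists>x\<in>set (col c). (x, y) \<in> (others c)\<^sup>+ then 0 else h)"

text \<open>The dual potential of demand \<open>c\<close>: on its own list it counts the cells
  passed. Foreign sources get the maximum \<open>h\<close> and foreign sinks the minimum 0, so their
  edges never raise it.\<close>

fun pot :: "nat \<Rightarrow> 'x vertex \<Rightarrow> nat" where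
  "pot c (VIn x j) = (if x \<in> set (col c) then level c x j else off c x)"
| "pot c (VOut x j) = (if x \<in> set (col c) then Suc (level c x j) else off c x)"
| "pot c (Src c') = (if c' = c then 0 else h)"
| "pot c (Snk c') = (if c' = c then h else 0)"

lemma off_le: "off c y \<le> h"
  by (simp add: off_def)

lemma pot_in_le: "c < p \<Longrightarrow> j < h \<Longrightarrow> pot c (VIn x j) \<le> h"
  using level_less[of c x j] off_le[of c x] by auto

lemma pot_step:
  assumes c: "c < p" and e: "e \<in> edges"
  shows "pot c (snd e) \<le> pot c (fst e) + of_bool (e \<in> cell_edges)"
proof -
  from e consider (cell) "e \<in> cell_edges"
    | (src) c' a where "e = (Src c', VIn (col c' ! a) (idx c' a 0))" "c' < p" "a < l"
    | (snk) c' a where "e = (VOut (col c' ! a) (idx c' a (h - 1)), Snk c')" "c' < p" "a < l"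
    | (hop) c' a b t where "e = (VOut (col c' ! a) (idx c' a t), VIn (col c' ! b) (idx c' b (Suc t)))"
        "c' < p" "a < b" "b < l" "Suc t < h"
    unfolding edges_def by blast
  then show ?thesis
  proof cases
    case cell
    then show ?thesis by (auto simp: cell_edges_def)
  next
    case src
    show ?thesis
    proof (cases "c' = c")
      case True
      then show ?thesis using src level_unique[OF c src(3) h] len(1)[OF c] by simp
    next
      case False
      then show ?thesis using src pot_in_le[OF c idx_less, of "col c' ! a" c' a 0] by simp
    qed
  next
    case snk
    show ?thesis
    proof (cases "c' = c")
      case True
      then show ?thesis using snk level_unique[OF c snk(3), of "h - 1"] len(1)[OF c] h by simp
    qed (use snk in simp)
  next
    case hop
    show ?thesis
    proof (cases "c' = c")
      case True
      then show ?thesis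
        using hop level_unique[OF c, of a t] level_unique[OF c, of b "Suc t"] len(1)[OF c] by simp
    next
      case False
      define x y where "x = col c' ! a" and "y = col c' ! b"
      have "precedes (col c') x y" unfolding precedes_def x_def y_def using hop len(1)[of c'] by auto
      then have xy: "(x, y) \<in> others c" using hop(2) False by (auto simp: others_def)
      have sep: "(u, w) \<notin> (others c)\<^sup>+" if "u \<in> set (col c)" "w \<in> set (col c)" for u w
        using separate[OF c that] by (simp add: others_def)
      have "pot c (VIn y j) \<le> pot c (VOut x i)" if "j < h" for i j
      \<comment> \<open>If \<open>x\<close> lies on list \<open>c\<close> or has been reached from
        it along other lists, then \<open>y\<close> is reached too, cannot lie on list
        \<open>c\<close> by \<open>separate\<close>, and has potential 0. Otherwise \<open>x\<close>
        already has the maximum \<open>h\<close>.\<close>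
      proof (cases "\<exists>u\<in>set (col c). (u, x) \<in> (others c)\<^sup>+ \<or> u = x")
        case True
        then obtain u where u: "u \<in> set (col c)" "(u, y) \<in> (others c)\<^sup>+" using xy by (auto intro: trancl_into_trancl)
        then have "y \<notin> set (col c)" using sep by blast
        then show ?thesis using u by (auto simp: off_def)
      next
        case False
        then have "pot c (VOut x i) = h" by (auto simp: off_def)
        then show ?thesis using pot_in_le[OF c that] by simp
      qed
      from this[OF idx_less] show ?thesis unfolding hop(1) x_def y_def by (simp add: trans_le_add1)
    qed
  qed
qed

lemma survivor_path:
  assumes c: "c < p" and E': "E' \<subseteq> edges" and K: "K = edge_cell ` E'"
    and up: "h \<le> climb K h 0 (col c) (r c)"
  shows "(Src c, Snk c) \<in> (edges - E')\<^sup>*"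
proof -
  have free: "e \<in> edges - E'" if "e \<in> edges" "edge_cell e \<notin> K" for e
    using that K by blast
  \<comment> \<open>Invariant of the greedy climb: some column before \<open>a\<close> was left at
    level \<open>t - 1\<close> through a cell outside \<open>K\<close>. The last condition is kept
    because the edge into the sink is charged to the cell it leaves.\<close>
  define cur where "cur t a \<longleftrightarrow> (if t = 0 then True else
     \<exists>a'<a. a' < l \<and> (Src c, VOut (col c ! a') (idx c a' (t - 1))) \<in> (edges - E')\<^sup>* \<and> (col c ! a', idx c a' (t - 1)) \<notin> K)" for t a
  have top: "(Src c, Snk c) \<in> (edges - E')\<^sup>*" if "cur h a" for a
  proof -
    from that h obtain a' where a': "a' < l" "(Src c, VOut (col c ! a') (idx c a' (h - 1))) \<in> (edges - E')\<^sup>*"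
      "(col c ! a', idx c a' (h - 1)) \<notin> K" by (auto simp: cur_def split: if_splits)
    have "(VOut (col c ! a') (idx c a' (h - 1)), Snk c) \<in> edges - E'"
      using a' c by (intro free) (auto simp: edges_def)
    with a'(2) show ?thesis by (rule rtrancl_into_rtrancl)
  qed
  have "(Src c, Snk c) \<in> (edges - E')\<^sup>*"
    if "cur t a" "t \<le> h" "a \<le> l" "h \<le> climb K h t (drop a (col c)) (drop a (r c))" for t a
    using that
  proof (induction "l - a" arbitrary: t a)
    case 0
    then have "t = h" using len[OF c] by simp
    then show ?case using 0 top by blast
  next
    case (Suc k)
    then have a: "a < l" by simp
    show ?case
    proof (cases "t = h")
      case True
      then show ?thesis using Suc top by blast
    next
      case False
      then have t: "t < h" using Suc.prems by simp
      have d: "drop a (col c) = col c ! a # drop (Suc a) (col c)" "drop a (r c) = r c ! a # drop (Suc a) (r c)"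
        using a len[OF c] by (simp_all add: Cons_nth_drop_Suc)
      show ?thesis
      proof (cases "(col c ! a, idx c a t) \<in> K")
        case True
        have "cur t (Suc a)" using Suc.prems(1) unfolding cur_def using less_SucI by metis
        moreover have "h \<le> climb K h t (drop (Suc a) (col c)) (drop (Suc a) (r c))"
          using Suc.prems(4) True unfolding d idx_def by simp
        ultimately show ?thesis using Suc.hyps(1)[of "Suc a" t] Suc.hyps(2) t a by simp
      next
        case F: False
        have cells: "(VIn (col c ! a) (idx c a t), VOut (col c ! a) (idx c a t)) \<in> edges - E'"
          using colX[OF c a] F by (intro free) (auto simp: edges_def cell_edges_def)
        have "(Src c, VIn (col c ! a) (idx c a t)) \<in> (edges - E')\<^sup>*"
        proof (cases "t = 0")
          case True
          have "(Src c, VIn (col c ! a) (idx c a t)) \<in> edges - E'"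
            using c a F True by (intro free) (auto simp: edges_def)
          then show ?thesis by blast
        next
          case False
          then obtain a' where a': "a' < a" "(Src c, VOut (col c ! a') (idx c a' (t - 1))) \<in> (edges - E')\<^sup>*"
            using Suc.prems(1) by (auto simp: cur_def)
          have "(VOut (col c ! a') (idx c a' (t - 1)), VIn (col c ! a) (idx c a (Suc (t - 1)))) \<in> edges"
            unfolding edges_def using c a a'(1) t False
            by (intro UnI2 CollectI exI[of _ c] exI[of _ a'] exI[of _ a] exI[of _ "t - 1"]) simp
          then have "(VOut (col c ! a') (idx c a' (t - 1)), VIn (col c ! a) (idx c a t)) \<in> edges - E'"
            using F False by (intro free) auto
          with a'(2) show ?thesis by (rule rtrancl_into_rtrancl)
        qed
        then have "(Src c, VOut (col c ! a) (idx c a t)) \<in> (edges - E')\<^sup>*"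
          using cells by (rule rtrancl_into_rtrancl)
        then have "cur (Suc t) (Suc a)" using F a by (auto simp: cur_def)
        moreover have "h \<le> climb K h (Suc t) (drop (Suc a) (col c)) (drop (Suc a) (r c))"
          using Suc.prems(4) F unfolding d idx_def by simp
        ultimately show ?thesis using Suc.hyps(1)[of "Suc a" "Suc t"] Suc.hyps(2) t a by simp
      qed
    qed
  qed
  from this[of 0 0] show ?thesis using up by (simp add: cur_def)
qed

lemma edge_cell_in:
  assumes "e \<in> edges" shows "edge_cell e \<in> X \<times> {..<h}"
  using assms unfolding edges_def cell_edges_def by (auto simp: colX)

text \<open>Double counting: a dense node owns more than h/2 cells of \<open>K\<close>, a list that
  is not sparse contains at least l/2 dense nodes, and a node lies on at most
  \<open>\<Delta>\<close> lists.\<close>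

lemma nonsparse_le:
  assumes K: "finite K"
  shows "real (card {c \<in> {..<p}. \<not> sparse_list K h (col c)}) \<le> 4 * real \<Delta> / (real h * real l) * real (card K)"
proof -
  let ?N = "{c \<in> {..<p}. \<not> sparse_list K h (col c)}"
  define D where "D = {x \<in> X. dense K h x}"
  have fD: "finite D" using X by (simp add: D_def)
  have "h * card D \<le> 2 * card K"
  proof -
    have "h * card D = (\<Sum>x\<in>D. h)" by simp
    also have "\<dots> \<le> (\<Sum>x\<in>D. 2 * blocked K h x)" by (intro sum_mono) (auto simp: D_def dense_def)
    also have "\<dots> = 2 * (\<Sum>x\<in>D. card (Pair x ` {j \<in> {..<h}. (x, j) \<in> K}))"
      unfolding sum_distrib_left by (intro sum.cong refl) (simp add: blocked_def card_image inj_on_def)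
    also have "(\<Sum>x\<in>D. card (Pair x ` {j \<in> {..<h}. (x, j) \<in> K})) = card (\<Union>x\<in>D. Pair x ` {j \<in> {..<h}. (x, j) \<in> K})"
      using fD by (intro card_UN_disjoint[symmetric]) auto
    also have "\<dots> \<le> card K" using K by (intro card_mono) auto
    finally show ?thesis by simp
  qed
  moreover have "card ?N * l \<le> 2 * (\<Delta> * card D)"
  proof -
    have "card ?N * l = (\<Sum>c\<in>?N. l)" by simp
    also have "\<dots> \<le> (\<Sum>c\<in>?N. 2 * card {x \<in> D. x \<in> set (col c)})"
    proof (rule sum_mono)
      fix c assume c: "c \<in> ?N"
      then have cp: "c < p" by simp
      have "length (filter (dense K h) (col c)) = card (set (filter (dense K h) (col c)))"
        using dist[OF cp] by (intro distinct_card[symmetric]) simp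
      also have "\<dots> \<le> card {x \<in> D. x \<in> set (col c)}"
        using fD sub[OF cp] by (intro card_mono) (auto simp: D_def)
      finally show "l \<le> 2 * card {x \<in> D. x \<in> set (col c)}"
        using c sum_length_filter_compl[of "dense K h" "col c"] len(1)[OF cp] by (simp add: sparse_list_def)
    qed
    also have "\<dots> \<le> 2 * (\<Sum>c<p. card {x \<in> D. x \<in> set (col c)})"
      unfolding sum_distrib_left[symmetric] by (intro mult_left_mono sum_mono2) auto
    also have "(\<Sum>c<p. card {x \<in> D. x \<in> set (col c)}) = (\<Sum>x\<in>D. card {c \<in> {..<p}. x \<in> set (col c)})"
      using fD by (intro sum_multicount_gen[symmetric]) auto
    also have "\<dots> \<le> (\<Sum>x\<in>D. \<Delta>)" using deg by (intro sum_mono) (auto simp: D_def)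
    finally show ?thesis by (simp add: mult.commute)
  qed
  ultimately have 1: "real h * real (card D) \<le> 2 * real (card K)" "real (card ?N) * real l \<le> 2 * (real \<Delta> * real (card D))"
    by (metis of_nat_le_iff of_nat_mult of_nat_numeral)+
  have "real (card ?N) * real l * real h \<le> 2 * (real \<Delta> * real (card D)) * real h" using 1(2) by (intro mult_right_mono) auto
  also have "\<dots> = 2 * real \<Delta> * (real h * real (card D))" by simp
  also have "\<dots> \<le> 2 * real \<Delta> * (2 * real (card K))" using 1(1) by (intro mult_left_mono) auto
  finally show ?thesis using h hl by (simp add: field_simps)
qed

text \<open>The distance \<open>h\<close> in the dual certificate cancels against the
  \<open>h\<close> cells of each node, so the cloud size disappears from the conclusion.\<close>

lemma SCG_bound:
  assumes N: "2 * card X * h + 2 * p \<le> N" and k: "\<kappa> > 0"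
    and kill: "\<And>K. K \<subseteq> X \<times> {..<h} \<Longrightarrow> real (card {c \<in> {..<p}. climb K h 0 (col c) (r c) < h}) \<le> \<kappa> * real (card K)"
  shows "real p \<le> real (SCG N) * \<kappa> * real (card X)"
proof -
  have cp: "card pairs = p" unfolding pairs_def by (subst card_image) (auto simp: inj_on_def)
  have csp: "card cell_edges = card X * h"
    unfolding cell_edges_def by (subst card_image) (auto simp: inj_on_def card_cartesian_product)
  define src where "src v = (case v of Src c \<Rightarrow> c | _ \<Rightarrow> 0)" for v :: "'x vertex"
  have "real h * real (card pairs) \<le> real (SCG N) * \<kappa> * real (card cell_edges)"
  proof (rule SCG_lower_bound[OF finite_verts edges_verts, where enc = to_nat and \<theta> = "\<lambda>q v. real (pot (src (fst q)) v)"])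
    show "pairs \<subseteq> verts \<times> verts" "pairs \<noteq> {}" "\<forall>(s, t)\<in>pairs. s \<noteq> t"
      using p by (auto simp: pairs_def verts_def)
    show "card verts \<le> N" using card_verts N by linarith
    show "inj (to_nat :: 'x vertex \<Rightarrow> nat)" by simp
    show "cell_edges \<subseteq> edges" by (auto simp: edges_def)
    show "0 < real h" "0 < \<kappa>" using h k by auto
  next
    fix q e assume "q \<in> pairs" "e \<in> edges"
    then have "pot (src (fst q)) (snd e) \<le> pot (src (fst q)) (fst e) + of_bool (e \<in> cell_edges)"
      by (intro pot_step) (auto simp: pairs_def src_def)
    then show "real (pot (src (fst q)) (snd e)) - real (pot (src (fst q)) (fst e)) \<le> of_bool (e \<in> cell_edges)"
      by (cases "e \<in> cell_edges") auto
  next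
    fix q assume "q \<in> pairs"
    then show "real h \<le> real (pot (src (fst q)) (snd q)) - real (pot (src (fst q)) (fst q))"
      by (auto simp: pairs_def src_def)
  next
    fix E' assume E': "E' \<subseteq> edges"
    define K where "K = edge_cell ` E'"
    have fE: "finite E'" using E' edges_verts finite_verts by (meson finite_SigmaI finite_subset)
    have KX: "K \<subseteq> X \<times> {..<h}" unfolding K_def using E' edge_cell_in by blast
    let ?D = "{c \<in> {..<p}. climb K h 0 (col c) (r c) < h}"
    have "separated edges pairs E' \<subseteq> (\<lambda>c. (Src c, Snk c)) ` ?D"
      using survivor_path[OF _ E' K_def] by (force simp: separated_def pairs_def not_le[symmetric])
    then have "card (separated edges pairs E') \<le> card ((\<lambda>c. (Src c, Snk c) :: 'x vertex \<times> 'x vertex) ` ?D)"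
      by (intro card_mono) auto
    also have "\<dots> \<le> card ?D" by (rule card_image_le) simp
    finally have "real (card (separated edges pairs E')) \<le> \<kappa> * real (card K)" using kill[OF KX] by linarith
    also have "\<dots> \<le> \<kappa> * real (card E')" unfolding K_def using k card_image_le[OF fE] by (intro mult_left_mono) auto
    finally show "real (card (separated edges pairs E')) \<le> \<kappa> * real (card E')" .
  qed
  then have "real h * real p \<le> real h * (real (SCG N) * \<kappa> * real (card X))" unfolding cp csp by (simp add: mult_ac)
  then show ?thesis using h by simp
qed

end

lemma SCG_ge_of_columns:
  fixes col :: "nat \<Rightarrow> 'x :: countable list"
  assumes len: "\<And>c. c < p \<Longrightarrow> length (col c) = l" and dist: "\<And>c. c < p \<Longrightarrow> distinct (col c)"
    and sub: "\<And>c. c < p \<Longrightarrow> set (col c) \<subseteq> X"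
    and X: "finite X" and p: "p > 0" and h: "h > 0" "32 * h \<le> l"
    and deg: "\<And>x. x \<in> X \<Longrightarrow> card {c \<in> {..<p}. x \<in> set (col c)} \<le> \<Delta>"
    and separate: "\<And>c x y. c < p \<Longrightarrow> x \<in> set (col c) \<Longrightarrow> y \<in> set (col c) \<Longrightarrow>
      (x, y) \<notin> (\<Union>c'\<in>{..<p} - {c}. {(u, w). precedes (col c') u w})\<^sup>+"
    and lp: "real l / 8 - ln (real p) > 0" and N: "2 * card X * h + 2 * p \<le> N"
  shows "real p \<le> real (SCG N) *
    (4 * real \<Delta> / (real h * real l) + (2 + ln (real (card X * h))) / (real l / 8 - ln (real p))) * real (card X)"
proof -
  have X0: "X \<noteq> {}" using sub[OF p] len[OF p] h by auto
  have M: "card X * h > 0" using X X0 h by (simp add: card_gt_0_iff)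
  let ?lam = "real l / 8 - ln (real p)"
  obtain r where r: "\<And>c. c < p \<Longrightarrow> r c \<in> lists_of {..<h} l" and
    kill: "\<And>K. K \<subseteq> X \<times> {..<h} \<Longrightarrow>
      real (card {c \<in> {..<p}. sparse_list K h (col c) \<and> climb K h 0 (col c) (r c) < h}) * ?lam
      \<le> 2 + real (card K) * ln (real (card X * h))"
    using exists_shifts[where col = col, OF h len p X X0] by blast
  interpret shifted_columns col r X p l h \<Delta>
  proof
    show "length (r c) = l" if "c < p" for c using r[OF that] by (simp add: lists_of_def)
    show "h \<le> l" using h by simp
  qed (fact len dist sub X p h(1) deg separate)+
  show ?thesis
  proof (rule SCG_bound[OF N])
    let ?\<kappa> = "4 * real \<Delta> / (real h * real l) + (2 + ln (real (card X * h))) / ?lam"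
    have ln0: "ln (real (card X * h)) \<ge> 0" using M by (intro ln_ge_zero) linarith
    then show "0 < ?\<kappa>" using lp by (intro add_nonneg_pos) auto
    fix K assume K: "K \<subseteq> X \<times> {..<h}"
    show "real (card {c \<in> {..<p}. climb K h 0 (col c) (r c) < h}) \<le> ?\<kappa> * real (card K)"
    \<comment> \<open>The additive 2 in the bound for the shifts is absorbed by |K| at least 1. The
      empty set is settled directly: nothing is skipped and level \<open>l\<close> is
      reached.\<close>
    proof (cases "K = {}")
      case True
      have "climb {} h 0 (col c) (r c) \<ge> h" if "c < p" for c
      proof -
        have "climb {} h 0 (col c) (r c) = l" using climb_empty[of "r c" "col c" h 0] that len r by (auto simp: lists_of_def)
        then show ?thesis using hl by simp
      qed
      then have "{c \<in> {..<p}. climb K h 0 (col c) (r c) < h} = {}" using True by (auto simp flip: not_le)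
      then show ?thesis using True by simp
    next
      case False
      have fK: "finite K" by (rule finite_subset[OF K]) (simp add: X)
      then have "card K > 0" using False by (simp add: card_gt_0_iff)
      then have K1: "real (card K) \<ge> 1" by linarith
      let ?S = "{c \<in> {..<p}. sparse_list K h (col c) \<and> climb K h 0 (col c) (r c) < h}"
      have "real (card ?S) * ?lam \<le> (2 + ln (real (card X * h))) * real (card K)"
      proof -
        have "(2 + ln (real (card X * h))) * real (card K) = 2 * real (card K) + real (card K) * ln (real (card X * h))"
          by (simp add: distrib_right)
        then show ?thesis using kill[OF K] K1 by linarith
      qed
      then have s: "real (card ?S) \<le> (2 + ln (real (card X * h))) / ?lam * real (card K)"
        using lp by (simp only: times_divide_eq_left pos_le_divide_eq)
      have "card {c \<in> {..<p}. climb K h 0 (col c) (r c) < h} \<le> card ({c \<in> {..<p}. \<not> sparse_list K h (col c)} \<union> ?S)"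
      proof (rule card_mono)
        show "{c \<in> {..<p}. climb K h 0 (col c) (r c) < h} \<subseteq> {c \<in> {..<p}. \<not> sparse_list K h (col c)} \<union> ?S" by blast
      qed simp
      also have "\<dots> \<le> card {c \<in> {..<p}. \<not> sparse_list K h (col c)} + card ?S" by (rule card_Un_le)
      finally have "real (card {c \<in> {..<p}. climb K h 0 (col c) (r c) < h})
          \<le> real (card {c \<in> {..<p}. \<not> sparse_list K h (col c)}) + real (card ?S)" by linarith
      then show ?thesis using s nonsparse_le[OF fK] unfolding distrib_right by linarith
    qed
  qed
qed

subsection \<open>A polynomial lower bound\<close>

lemma ps_size_le:
  assumes "path_system {..<n} Ps"
  shows "ps_size Ps \<le> length Ps * n"
proof -
  have "length \<pi> \<le> n" if "\<pi> \<in> set Ps" for \<pi>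
  proof -
    have "distinct \<pi>" "set \<pi> \<subseteq> {..<n}" using assms that by (auto simp: path_system_def)
    then show ?thesis using card_mono[of "{..<n}" "set \<pi>"] by (simp add: distinct_card)
  qed
  then have "ps_size Ps \<le> (\<Sum>\<pi>\<leftarrow>Ps. n)" unfolding ps_size_def by (intro sum_list_mono) auto
  then show ?thesis by (simp add: sum_list_const_mult sum_list_triv)
qed

lemma beta_candidates_finite:
  "finite {ps_size Ps | Ps. path_system {..<n::nat} Ps \<and> length Ps = p \<and> girth_gt {..<n} Ps k}"
  by (rule finite_subset[of _ "{..p * n}"]) (auto dest: ps_size_le)

lemma beta_ge:
  assumes "path_system {..<n} Ps" "length Ps = p" "girth_gt {..<n} Ps k"
  shows "ps_size Ps \<le> beta n p k"
  unfolding beta_def using assms by (intro Max_ge beta_candidates_finite) auto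

lemma precedes_Nil [simp]: "\<not> precedes [] x y"
  by (simp add: precedes_def)

lemma beta_attained:
  obtains Ps where "path_system {..<n} Ps" "length Ps = p" "girth_gt {..<n} Ps k" "ps_size Ps = beta n p k"
proof -
  let ?S = "{ps_size Ps | Ps. path_system {..<n} Ps \<and> length Ps = p \<and> girth_gt {..<n} Ps k}"
  \<comment> \<open>Empty paths show that the maximum in \<open>beta\<close> is over a nonempty
    set.\<close>
  have "\<not> has_bridge {..<n} (replicate p []) b" for b
  proof
    assume h: "has_bridge {..<n} (replicate p []) b"
    then obtain v idx where b: "b \<ge> 1" "\<forall>i\<in>{1..b}. idx i < p"
      "precedes (replicate p [] ! idx b) (v 1) (v b)" unfolding has_bridge_def by auto
    then show False by simp
  qed
  then have "ps_size (replicate p ([] :: nat list)) \<in> ?S"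
    by (intro CollectI exI[of _ "replicate p []"]) (auto simp: path_system_def girth_gt_def)
  then have "Max ?S \<in> ?S" by (intro Max_in beta_candidates_finite) auto
  then show thesis using that unfolding beta_def by auto
qed

text \<open>The nodes are the points (t, x, y) of a box, numbered by mixed radix; a path moves along
  (t, x + t a, y + t a^2), so that strict convexity of the square function excludes bridges.\<close>

definition pt :: "nat \<Rightarrow> nat \<Rightarrow> nat \<Rightarrow> nat \<Rightarrow> nat" where
  "pt T t x y = t + T * (x + 2 * T ^ 2 * y)"

lemma pt_inj:
  assumes "pt T t x y = pt T t' x' y'" "t < T" "t' < T" "x < 2 * T ^ 2" "x' < 2 * T ^ 2"
  shows "t = t' \<and> x = x' \<and> y = y'"
proof -
  have "t = pt T t x y mod T" "t' = pt T t' x' y' mod T" using assms(2,3) by (simp_all add: pt_def)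
  then have t: "t = t'" using assms(1) by simp
  have "pt T t x y div T = x + 2 * T ^ 2 * y" "pt T t' x' y' div T = x' + 2 * T ^ 2 * y'"
    using assms(2,3) by (simp_all add: pt_def)
  then have e: "x + 2 * T ^ 2 * y = x' + 2 * T ^ 2 * y'" using assms(1) by simp
  have "x = (x + 2 * T ^ 2 * y) mod (2 * T ^ 2)" "x' = (x' + 2 * T ^ 2 * y') mod (2 * T ^ 2)"
    using assms(4,5) by simp_all
  then have x: "x = x'" using e by simp
  then show ?thesis using e t assms by auto
qed

lemma pt_less:
  assumes "t < T" "x < 2 * T ^ 2" "y < 2 * T ^ 3"
  shows "pt T t x y < 4 * T ^ 6"
proof -
  have "x + 2 * T ^ 2 * y + 1 \<le> 2 * T ^ 2 * (y + 1)" using assms by (simp add: algebra_simps)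
  also have "\<dots> \<le> 2 * T ^ 2 * (2 * T ^ 3)" using assms by (intro mult_le_mono) auto
  finally have 1: "T * (x + 2 * T ^ 2 * y + 1) \<le> T * (2 * T ^ 2 * (2 * T ^ 3))" by (rule mult_le_mono2)
  have "T * (2 * T ^ 2 * (2 * T ^ 3)) = 4 * T ^ 6" by (simp add: power2_eq_square power3_eq_cube eval_nat_numeral algebra_simps)
  then show ?thesis using 1 assms by (simp add: pt_def algebra_simps)
qed

definition par_path :: "nat \<Rightarrow> nat \<Rightarrow> nat \<Rightarrow> nat \<Rightarrow> nat list" where
  "par_path T a x y = map (\<lambda>t. pt T t (x + t * a) (y + t * a ^ 2)) [0..<T]"

text \<open>Moving along a line at most doubles the ranges of the starting points. This explains the
  radix 2 T^2 in \<open>pt\<close> and the T * 2 T^2 * 2 T^3 = 4 T^6 points of the box.\<close>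

lemma par_path_bounds:
  fixes T :: nat
  assumes "t < T" "a < T" "x < T ^ 2" "y < T ^ 3"
  shows "x + t * a < 2 * T ^ 2" "y + t * a ^ 2 < 2 * T ^ 3"
proof -
  have "t * a \<le> T * T" using assms by (simp add: mult_le_mono)
  then show "x + t * a < 2 * T ^ 2" using assms by (simp add: power2_eq_square)
  have "t * (a * a) \<le> T * (T * T)" using assms by (simp add: mult_le_mono)
  then show "y + t * a ^ 2 < 2 * T ^ 3" using assms by (simp add: power2_eq_square power3_eq_cube mult.assoc)
qed

lemma par_path_precedes:
  assumes "precedes (par_path T a x y) u w"
  obtains t t' where "t < t'" "t' < T" "u = pt T t (x + t * a) (y + t * a ^ 2)"
    "w = pt T t' (x + t' * a) (y + t' * a ^ 2)"
  using assms by (auto simp: precedes_def par_path_def)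

lemma par_paths_path_system:
  assumes "4 * T ^ 6 \<le> n" "a < T" "x < T ^ 2" "y < T ^ 3"
  shows "distinct (par_path T a x y)" "set (par_path T a x y) \<subseteq> {..<n}"
proof -
  show "distinct (par_path T a x y)"
    unfolding par_path_def distinct_map
  proof (intro conjI inj_onI)
    fix t t' assume "t \<in> set [0..<T]" "t' \<in> set [0..<T]"
      "pt T t (x + t * a) (y + t * a ^ 2) = pt T t' (x + t' * a) (y + t' * a ^ 2)"
    then show "t = t'" using pt_inj par_path_bounds assms by (metis atLeastLessThan_iff set_upt)
  qed simp
  show "set (par_path T a x y) \<subseteq> {..<n}"
  proof
    fix w assume "w \<in> set (par_path T a x y)"
    then obtain t where "t < T" "w = pt T t (x + t * a) (y + t * a ^ 2)" by (auto simp: par_path_def)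
    then have "w < 4 * T ^ 6" using pt_less par_path_bounds[OF _ assms(2-4)] by simp
    then show "w \<in> {..<n}" using assms(1) by simp
  qed
qed

text \<open>The weighted variance about c vanishes; this is the equality case of strict convexity of
  the square.\<close>

lemma weighted_square_zero:
  fixes \<tau> a :: "nat \<Rightarrow> real"
  assumes fin: "finite I" and pos: "\<And>i. i \<in> I \<Longrightarrow> \<tau> i > 0"
    and 1: "(\<Sum>i\<in>I. \<tau> i * a i) = c * (\<Sum>i\<in>I. \<tau> i)"
    and 2: "(\<Sum>i\<in>I. \<tau> i * a i ^ 2) = c ^ 2 * (\<Sum>i\<in>I. \<tau> i)" and i: "i \<in> I"
  shows "a i = c"
proof -
  have "(\<Sum>i\<in>I. \<tau> i * (a i - c) ^ 2)
      = (\<Sum>i\<in>I. \<tau> i * a i ^ 2) - 2 * c * (\<Sum>i\<in>I. \<tau> i * a i) + c ^ 2 * (\<Sum>i\<in>I. \<tau> i)"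
    by (simp add: sum_distrib_left sum.distrib[symmetric] sum_subtractf[symmetric])
      (intro sum.cong refl, simp add: power2_eq_square algebra_simps)
  also have "\<dots> = 0" unfolding 1 2 by (simp add: power2_eq_square)
  finally have "(\<Sum>i\<in>I. \<tau> i * (a i - c) ^ 2) = 0" .
  then have "\<tau> i * (a i - c) ^ 2 = 0"
    using fin i pos by (subst (asm) sum_nonneg_eq_0_iff) (auto simp: less_imp_le)
  then show ?thesis using pos[OF i] by simp
qed

text \<open>There are T slopes and T^2 * T^3 starting points, hence T^6 lines with T nodes each. In
  a bridge the displacements telescope to that of the chord, so the slopes a and their squares have
  weighted means equal to the slope of the chord and its square; all slopes then agree.\<close>

lemma beta_ge_power:
  assumes n: "4 * T ^ 6 \<le> n"
  shows "T ^ 7 \<le> beta n n \<infinity>"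
proof (cases "T = 0")
  case False
  then have T: "T > 0" by simp
  define pth where "pth j = par_path T (j mod T) (j div T mod T ^ 2) (j div T div T ^ 2)" for j
  \<comment> \<open>Empty paths fill up the number of paths to exactly \<open>n\<close> without
    creating bridges.\<close>
  define Ps where "Ps = map (\<lambda>j. if j < T ^ 6 then pth j else []) [0..<n]"
  have T6: "T ^ 6 \<le> n" using n by simp
  have len: "length Ps = n" by (simp add: Ps_def)
  have par: "j mod T < T" "j div T mod T ^ 2 < T ^ 2" "j div T div T ^ 2 < T ^ 3" if "j < T ^ 6" for j
  proof -
    show "j mod T < T" "j div T mod T ^ 2 < T ^ 2" using T by auto
    have "T ^ 6 = T ^ 3 * (T * T ^ 2)" by (simp add: eval_nat_numeral)
    then show "j div T div T ^ 2 < T ^ 3"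
      using that by (simp add: div_mult2_eq[symmetric] less_mult_imp_div_less)
  qed
  have ps: "path_system {..<n} Ps"
    unfolding path_system_def
  proof (intro conjI ballI)
    fix \<pi> assume "\<pi> \<in> set Ps"
    then obtain j where "\<pi> = (if j < T ^ 6 then pth j else [])" 
      unfolding Ps_def set_map by (rule imageE)
    then show "distinct \<pi>" "set \<pi> \<subseteq> {..<n}"
      using par_paths_path_system[OF n par(1) par(2) par(3), of j j j]
      by (auto simp: pth_def split: if_splits)
  qed simp
  have nth: "Ps ! j = (if j < T ^ 6 then pth j else [])" if "j < n" for j
    using that by (simp add: Ps_def)
  have nobr: "\<not> has_bridge {..<n} Ps b" for b
  proof
    assume "has_bridge {..<n} Ps b"
    then obtain v idx where b: "b \<ge> 1" and inj: "inj_on idx {1..b}" and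
      idx: "\<And>i. i \<in> {1..b} \<Longrightarrow> idx i < n" and
      st: "\<And>i. i \<in> {1..<b} \<Longrightarrow> precedes (Ps ! idx i) (v i) (v (Suc i))" and
      ch: "precedes (Ps ! idx b) (v 1) (v b)" unfolding has_bridge_def len by blast
    define A X Y where "A i = idx i mod T" and "X i = idx i div T mod T ^ 2" and "Y i = idx i div T div T ^ 2" for i
    have small: "idx i < T ^ 6" if "i \<in> {1..b}" for i
    proof (rule ccontr)
      assume "\<not> idx i < T ^ 6"
      then have "Ps ! idx i = []" using nth idx[OF that] by simp
      then show False using that b st[of i] ch by (cases "i = b") auto
    qed
    have path: "Ps ! idx i = par_path T (A i) (X i) (Y i)" if "i \<in> {1..b}" for i
      using nth[OF idx[OF that]] small[OF that] by (simp add: pth_def A_def X_def Y_def)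
    have AXY: "A i < T" "X i < T ^ 2" "Y i < T ^ 3" if "i \<in> {1..b}" for i
      using par[OF small[OF that]] by (auto simp: A_def X_def Y_def)
    define D where "D u = (SOME q. \<exists>t x y. q = (t, x, y) \<and> u = pt T t x y \<and> t < T \<and> x < 2 * T ^ 2)" for u
    have D: "D (pt T t x y) = (t, x, y)" if "t < T" "x < 2 * T ^ 2" for t x y
    proof -
      have "\<exists>t' x' y'. D (pt T t x y) = (t', x', y') \<and> pt T t x y = pt T t' x' y' \<and> t' < T \<and> x' < 2 * T ^ 2"
        unfolding D_def by (rule someI_ex) (use that in blast)
      then show ?thesis using pt_inj that by blast
    qed
    define dt dx dy where "dt u = real (fst (D u))" and "dx u = real (fst (snd (D u)))"
      and "dy u = real (snd (snd (D u)))" for u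
    have move: "dt u < dt w \<and> dx w - dx u = A i * (dt w - dt u) \<and> dy w - dy u = A i ^ 2 * (dt w - dt u)
        \<and> dx u = X i + A i * dt u \<and> dy u = Y i + A i ^ 2 * dt u"
      if i: "i \<in> {1..b}" and p: "precedes (Ps ! idx i) u w" for i u w
    proof -
      from p obtain t t' where t: "t < t'" "t' < T" "u = pt T t (X i + t * A i) (Y i + t * A i ^ 2)"
        "w = pt T t' (X i + t' * A i) (Y i + t' * A i ^ 2)"
        unfolding path[OF i] by (rule par_path_precedes)
      have "D u = (t, X i + t * A i, Y i + t * A i ^ 2)" "D w = (t', X i + t' * A i, Y i + t' * A i ^ 2)"
        unfolding t(3,4) using t(1,2) par_path_bounds[OF _ AXY[OF i]] by (auto intro!: D)
      then show ?thesis using t(1) by (simp add: dt_def dx_def dy_def algebra_simps)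
    qed
    have bb: "b \<in> {1..b}" and b1: "1 \<in> {1..b}" using b by auto
    have m: "dt (v i) < dt (v (Suc i)) \<and> dx (v (Suc i)) - dx (v i) = A i * (dt (v (Suc i)) - dt (v i))
       \<and> dy (v (Suc i)) - dy (v i) = A i ^ 2 * (dt (v (Suc i)) - dt (v i))" if "i \<in> {1..<b}" for i
      using move[OF _ st[OF that]] that by auto
    note c = move[OF bb ch]
    define \<tau> where "\<tau> i = dt (v (Suc i)) - dt (v i)" for i
    have tele: "(\<Sum>i\<in>{1..<b}. f (v (Suc i)) - f (v i)) = f (v b) - f (v 1)" for f :: "nat \<Rightarrow> real"
      using sum_Suc_diff'[of 1 b "\<lambda>i. f (v i)"] b by simp
    have s0: "(\<Sum>i\<in>{1..<b}. \<tau> i) = dt (v b) - dt (v 1)" unfolding \<tau>_def by (rule tele)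
    have s1: "(\<Sum>i\<in>{1..<b}. \<tau> i * real (A i)) = real (A b) * (\<Sum>i\<in>{1..<b}. \<tau> i)"
    proof -
      have "(\<Sum>i\<in>{1..<b}. \<tau> i * real (A i)) = (\<Sum>i\<in>{1..<b}. dx (v (Suc i)) - dx (v i))"
        using m by (intro sum.cong) (auto simp: \<tau>_def)
      also have "\<dots> = real (A b) * (\<Sum>i\<in>{1..<b}. \<tau> i)" unfolding tele s0 using c by simp
      finally show ?thesis .
    qed
    have s2: "(\<Sum>i\<in>{1..<b}. \<tau> i * real (A i) ^ 2) = real (A b) ^ 2 * (\<Sum>i\<in>{1..<b}. \<tau> i)"
    proof -
      have "(\<Sum>i\<in>{1..<b}. \<tau> i * real (A i) ^ 2) = (\<Sum>i\<in>{1..<b}. dy (v (Suc i)) - dy (v i))"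
        using m by (intro sum.cong) (auto simp: \<tau>_def)
      also have "\<dots> = real (A b) ^ 2 * (\<Sum>i\<in>{1..<b}. \<tau> i)" unfolding tele s0 using c by simp
      finally show ?thesis .
    qed
    have "b \<noteq> 1" using c by auto
    then have i1: "1 \<in> {1..<b}" using b by auto
    have "real (A 1) = real (A b)"
      by (rule weighted_square_zero[OF _ _ s1 s2 i1]) (use m in \<open>auto simp: \<tau>_def\<close>)
    then have A: "A 1 = A b" by simp
    \<comment> \<open>Paths 1 and \<open>b\<close> share the node \<open>v 1\<close> and the slope,
      so they have the same starting point and are the same line, although the bridge uses distinct
      paths.\<close>
    have "real (X 1) = real (X b)" "real (Y 1) = real (Y b)"
      using move[OF b1 st[OF i1]] c A by auto
    then have XY: "X 1 = X b" "Y 1 = Y b" by auto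
    have "idx 1 div T = idx b div T" using XY unfolding X_def Y_def by (metis mult_div_mod_eq)
    then have "idx 1 = idx b" using A unfolding A_def by (metis mult_div_mod_eq)
    then show False using inj b1 bb \<open>b \<noteq> 1\<close> by (auto dest: inj_onD)
  qed
  have "T ^ 7 = (\<Sum>j\<leftarrow>[0..<T ^ 6]. T)" by (simp add: sum_list_triv eval_nat_numeral)
  also have "\<dots> = (\<Sum>j\<leftarrow>[0..<T ^ 6]. length (if j < T ^ 6 then pth j else []))"
    by (intro arg_cong[where f = sum_list] map_cong refl) (auto simp: pth_def par_path_def)
  also have "\<dots> \<le> ps_size Ps"
  proof -
    have "[0..<n] = [0..<T ^ 6] @ [T ^ 6..<n]" using T6 by (metis le_add_diff_inverse upt_add_eq_append zero_le)
    then show ?thesis by (simp add: ps_size_def Ps_def comp_def)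
  qed
  also have "\<dots> \<le> beta n n \<infinity>" using ps len nobr by (intro beta_ge) (auto simp: girth_gt_def)
  finally show ?thesis .
qed simp

subsection \<open>Pieces of an acyclic system\<close>

lemma rainbow_mono:
  assumes "rainbow R x Q y" "\<And>i. R i \<subseteq> R' i" shows "rainbow R' x Q y"
  using assms(1)
proof (induction rule: rainbow.induct)
  case (rainbow_step x Q y q z)
  then show ?case using assms(2) by (intro rainbow.rainbow_step) blast+
qed (rule rainbow_refl)

lemma rainbow_last_use:
  assumes "rainbow R x Q y" "q \<in> Q"
  shows "\<exists>Q0 a b. Q0 \<subseteq> Q - {q} \<and> rainbow R x Q0 a \<and> (a, b) \<in> R q \<and> (b, y) \<in> (\<Union>i\<in>Q. R i)\<^sup>*"
  using assms
proof (induction rule: rainbow.induct)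
  case (rainbow_step x Q y q' z)
  show ?case
  proof (cases "q = q'")
    case True
    then show ?thesis using rainbow_step.hyps by (intro exI[of _ Q] exI[of _ y] exI[of _ z]) auto
  next
    case False
    then obtain Q0 a b where h: "Q0 \<subseteq> Q - {q}" "rainbow R x Q0 a" "(a, b) \<in> R q" "(b, y) \<in> (\<Union>i\<in>Q. R i)\<^sup>*"
      using rainbow_step by blast
    have "(b, y) \<in> (\<Union>i\<in>insert q' Q. R i)\<^sup>*" using h(4) by (rule rtrancl_mono[THEN subsetD, rotated]) auto
    then have "(b, z) \<in> (\<Union>i\<in>insert q' Q. R i)\<^sup>*"
      by (rule rtrancl_into_rtrancl) (use rainbow_step.hyps in blast)
    then show ?thesis using h by blast
  qed
qed simp

text \<open>In an acyclic system a label that is used twice can be skipped: the first source and the last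
  target are comparable on that path, and the reverse order would close a cycle.\<close>

lemma rainbow_of_rtrancl:
  assumes acyc: "acyclic (\<Union>q\<in>J. R q)"
    and lin: "\<And>q a b c d. q \<in> J \<Longrightarrow> (a, b) \<in> R q \<Longrightarrow> (c, d) \<in> R q \<Longrightarrow> a = d \<or> (a, d) \<in> R q \<or> (d, a) \<in> R q"
    and xy: "(x, y) \<in> (\<Union>q\<in>J. R q)\<^sup>*"
  shows "\<exists>Q\<subseteq>J. rainbow R x Q y"
  using xy
proof (induction rule: rtrancl_induct)
  case base
  show ?case by (intro exI[of _ "{}"]) (simp add: rainbow_refl)
next
  case (step y z)
  then obtain q where q: "q \<in> J" "(y, z) \<in> R q" by blast
  from step obtain Q where Q: "Q \<subseteq> J" "rainbow R x Q y" by blast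
  show ?case
  proof (cases "q \<in> Q")
    case False
    then have "rainbow R x (insert q Q) z" using Q q by (intro rainbow_step)
    then show ?thesis using Q q by (metis insert_subset)
  next
    case True
    from rainbow_last_use[OF Q(2) True] obtain Q0 a b where
      h: "Q0 \<subseteq> Q - {q}" "rainbow R x Q0 a" "(a, b) \<in> R q" "(b, y) \<in> (\<Union>i\<in>Q. R i)\<^sup>*" by blast
    let ?U = "\<Union>q\<in>J. R q"
    have bty: "(b, y) \<in> ?U\<^sup>*" using h(4) by (rule rtrancl_mono[THEN subsetD, rotated]) (use Q in blast)
    have ab: "(a, b) \<in> ?U" "(y, z) \<in> ?U" using h(3) q by blast+
    have az: "(a, z) \<in> ?U\<^sup>+"
      using rtrancl_into_trancl1[OF converse_rtrancl_into_rtrancl[OF ab(1) bty] ab(2)] .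
    have "a \<noteq> z" using az acyc by (auto simp: acyclic_def)
    moreover have "(z, a) \<notin> R q"
    proof
      assume "(z, a) \<in> R q"
      then have "(z, a) \<in> ?U" using q(1) by blast
      with az have "(a, a) \<in> ?U\<^sup>+" by (rule trancl_into_trancl)
      then show False using acyc by (auto simp: acyclic_def)
    qed
    ultimately have "(a, z) \<in> R q" using lin[OF q(1) h(3) q(2)] by blast
    then have "rainbow R x (insert q Q0) z" using h by (intro rainbow_step) auto
    then show ?thesis using h(1) Q(1) q(1) by (intro exI[of _ "insert q Q0"]) auto
  qed
qed

lemma precedes_linear:
  assumes "x \<in> set \<pi>" "y \<in> set \<pi>" "x \<noteq> y" shows "precedes \<pi> x y \<or> precedes \<pi> y x"
proof -
  obtain i j where ij: "i < length \<pi>" "\<pi> ! i = x" "j < length \<pi>" "\<pi> ! j = y"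
    using assms by (metis in_set_conv_nth)
  then have "i < j \<or> j < i" using assms by (metis nat_neq_iff)
  then show ?thesis using ij unfolding precedes_def by blast
qed

text \<open>A walk from x to y forces x to precede y on path \<open>i\<close>, since the other order
  would close a cycle. Without cycles the walk can be made rainbow, and then path \<open>i\<close>
  is the chord of a bridge.\<close>

lemma acyclic_system_separate:
  assumes ps: "path_system V Ps" and g: "girth_gt V Ps \<infinity>"
    and A: "\<And>i. i < length Ps \<Longrightarrow> A i \<subseteq> set (Ps ! i)"
    and acyc: "acyclic (restr (path_rel Ps) {..<length Ps} A)"
    and i: "i < length Ps" "x \<in> A i" "y \<in> A i"
  shows "(x, y) \<notin> (\<Union>q\<in>{..<length Ps} - {i}. path_rel Ps q \<inter> A q \<times> A q)\<^sup>+"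
proof
  define R where "R q = path_rel Ps q \<inter> A q \<times> A q" for q
  let ?J = "{..<length Ps} - {i}"
  assume "(x, y) \<in> (\<Union>q\<in>?J. path_rel Ps q \<inter> A q \<times> A q)\<^sup>+"
  then have xy: "(x, y) \<in> (\<Union>q\<in>?J. R q)\<^sup>+" by (simp add: R_def)
  have full: "acyclic (\<Union>q\<in>{..<length Ps}. R q)" using acyc by (simp add: restr_def R_def)
  have xy': "(x, y) \<in> (\<Union>q\<in>{..<length Ps}. R q)\<^sup>+" using xy by (rule trancl_mono) auto
  have lin: "a = d \<or> (a, d) \<in> R q \<or> (d, a) \<in> R q" if "q < length Ps" "a \<in> A q" "d \<in> A q" for q a d
    using that A[OF that(1)] precedes_linear[of a "Ps ! q" d] by (auto simp: R_def path_rel_def)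
  have "x \<noteq> y" using xy' full by (auto simp: acyclic_def)
  moreover have "(y, x) \<notin> R i"
  proof
    assume "(y, x) \<in> R i"
    then have "(y, x) \<in> (\<Union>q\<in>{..<length Ps}. R q)" using i(1) by blast
    with xy' have "(x, x) \<in> (\<Union>q\<in>{..<length Ps}. R q)\<^sup>+" by (rule trancl_into_trancl)
    then show False using full by (auto simp: acyclic_def)
  qed
  ultimately have xyi: "(x, y) \<in> path_rel Ps i" using lin[OF i] by (auto simp: R_def)
  have "acyclic (\<Union>q\<in>?J. R q)" using full by (rule acyclic_subset) auto
  then have "\<exists>Q\<subseteq>?J. rainbow R x Q y"
  proof (rule rainbow_of_rtrancl)
    show "(x, y) \<in> (\<Union>q\<in>?J. R q)\<^sup>*" using xy by (rule trancl_into_rtrancl)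
    fix q a b c d assume "q \<in> ?J" "(a, b) \<in> R q" "(c, d) \<in> R q"
    then show "a = d \<or> (a, d) \<in> R q \<or> (d, a) \<in> R q" using lin[of q a d] by (auto simp: R_def)
  qed
  then obtain Q where Q: "Q \<subseteq> ?J" "rainbow R x Q y" by blast
  have "rainbow (path_rel Ps) x Q y" using Q(2) by (rule rainbow_mono) (auto simp: R_def)
  then show False using no_rainbow_of_girth[OF ps g i(1) xyi Q(1)] by blast
qed

lemma precedes_take_drop:
  "precedes (take l (drop s xs)) x y \<Longrightarrow> precedes xs x y"
  unfolding precedes_def
proof (elim exE conjE)
  fix i j assume "i < j" "j < length (take l (drop s xs))" "take l (drop s xs) ! i = x" "take l (drop s xs) ! j = y"
  then show "\<exists>i j. i < j \<and> j < length xs \<and> xs ! i = x \<and> xs ! j = y"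
    by (intro exI[of _ "s + i"] exI[of _ "s + j"]) auto
qed

lemma precedes_filter:
  "precedes (filter P xs) x y \<Longrightarrow> precedes xs x y"
proof (induction xs)
  case (Cons z xs)
  have ext: "precedes (z # xs) u w" if "precedes xs u w" for u w
    using that unfolding precedes_def by (metis Suc_less_eq length_Cons nth_Cons_Suc)
  show ?case
  proof (cases "P z")
    case False
    then show ?thesis using Cons ext by simp
  next
    case True
    from Cons.prems obtain i j where ij: "i < j" "j < length (z # filter P xs)"
      "(z # filter P xs) ! i = x" "(z # filter P xs) ! j = y" using True by (auto simp: precedes_def)
    show ?thesis
    proof (cases i)
      case 0
      then have "x = z" "y \<in> set xs" using ij by (auto simp: nth_Cons split: nat.splits dest: nth_mem)
      then obtain k where "k < length xs" "xs ! k = y" by (metis in_set_conv_nth)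
      then show ?thesis using \<open>x = z\<close> unfolding precedes_def by (intro exI[of _ 0] exI[of _ "Suc k"]) auto
    next
      case (Suc i')
      then obtain j' where "j = Suc j'" using ij by (cases j) auto
      then have "precedes (filter P xs) x y" using Suc ij unfolding precedes_def by auto
      then show ?thesis using Cons.IH ext by blast
    qed
  qed
qed simp

lemma chunks_disjoint:
  assumes "distinct xs" "v \<in> set (take l (drop (c * l) xs))" "v \<in> set (take l (drop (c' * l) xs))"
  shows "c = c'"
proof -
  have *: "\<exists>j<length xs. xs ! j = v \<and> j div l = c" if "v \<in> set (take l (drop (c * l) xs))" for c
  proof -
    from that obtain i where i: "i < l" "c * l + i < length xs" "xs ! (c * l + i) = v"
      by (auto simp: in_set_conv_nth)
    then have "(c * l + i) div l = c" by simp
    then show ?thesis using i by blast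
  qed
  from *[OF assms(2)] *[OF assms(3)] show ?thesis using assms(1) by (metis nth_eq_iff_index_eq)
qed

lemma exists_chunks:
  assumes ps: "path_system V Ps" and g: "girth_gt V Ps \<infinity>"
    and A: "\<And>i. i < length Ps \<Longrightarrow> A i \<subseteq> set (Ps ! i)"
    and acyc: "acyclic (restr (path_rel Ps) {..<length Ps} A)" and l: "l > 0"
  defines "p \<equiv> \<Sum>i<length Ps. card (A i) div l"
  shows "\<exists>col. \<forall>k<p. length (col k) = l \<and> distinct (col k) \<and> set (col k) \<subseteq> V \<and>
    (\<forall>x\<in>set (col k). \<forall>y\<in>set (col k). (x, y) \<notin> (\<Union>k'\<in>{..<p} - {k}. {(u, w). precedes (col k') u w})\<^sup>+)"
proof -
  define q where "q i = filter (\<lambda>v. v \<in> A i) (Ps ! i)" for i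
  have qd: "distinct (q i)" "set (q i) = A i" "length (q i) = card (A i)" if "i < length Ps" for i
  proof -
    have "distinct (Ps ! i)" using ps that by (auto simp: path_system_def)
    then show d: "distinct (q i)" by (simp add: q_def)
    show s: "set (q i) = A i" using A[OF that] by (auto simp: q_def)
    show "length (q i) = card (A i)" using distinct_card[OF d] s by simp
  qed
  define S where "S = (SIGMA i:{..<length Ps}. {..<card (A i) div l})"
  have cS: "card S = p" by (simp add: S_def p_def)
  have fS: "finite S" by (simp add: S_def)
  from ex_bij_betw_nat_finite[OF fS] obtain f where f: "bij_betw f {0..<card S} S" by blast
  have fk: "fst (f k) < length Ps" "snd (f k) < card (A (fst (f k))) div l" if "k < p" for k
  proof -
    have "f k \<in> S" using f that cS by (auto simp: bij_betw_def)
    then show "fst (f k) < length Ps" "snd (f k) < card (A (fst (f k))) div l" by (auto simp: S_def)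
  qed
  have finj: "f k = f k' \<Longrightarrow> k = k'" if "k < p" "k' < p" for k k'
    using f that cS by (auto simp: bij_betw_def dest: inj_onD)
  define col where "col k = take l (drop (snd (f k) * l) (q (fst (f k))))" for k
  have sub: "set (col k) \<subseteq> A (fst (f k))" if "k < p" for k
    using qd(2)[OF fk(1)[OF that]] set_take_subset set_drop_subset unfolding col_def by (metis order_trans)
  have prec: "(u, w) \<in> path_rel Ps (fst (f k)) \<inter> A (fst (f k)) \<times> A (fst (f k))" if "k < p" "precedes (col k) u w" for k u w
    using that sub[OF that(1)] precedes_set[OF that(2)] unfolding col_def path_rel_def q_def
    by (auto dest!: precedes_take_drop precedes_filter)
  have disj: "k = k'" if "k < p" "k' < p" "fst (f k) = fst (f k')" "v \<in> set (col k)" "v \<in> set (col k')" for k k' v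
  proof -
    have "snd (f k) = snd (f k')"
      using chunks_disjoint[OF qd(1)[OF fk(1)[OF that(1)]]] that unfolding col_def by metis
    then show ?thesis using finj that by (simp add: prod_eq_iff)
  qed
  have main: "(x, y) \<notin> (\<Union>k'\<in>{..<p} - {k}. {(u, w). precedes (col k') u w})\<^sup>+"
    if k: "k < p" and x: "x \<in> set (col k)" and y: "y \<in> set (col k)" for k x y
  proof
    let ?i = "fst (f k)"
    let ?T = "(\<Union>q\<in>{..<length Ps} - {?i}. path_rel Ps q \<inter> A q \<times> A q)"
    note sep = acyclic_system_separate[OF ps g A acyc fk(1)[OF k]]
    have xi: "x \<in> A ?i" using x sub[OF k] by blast
    assume "(x, y) \<in> (\<Union>k'\<in>{..<p} - {k}. {(u, w). precedes (col k') u w})\<^sup>+"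
    \<comment> \<open>Other pieces of the same path must be excluded as well. The first step avoids
      them because pieces of one path are disjoint; a later step cannot use them, since the walk
      would have returned to that path, which \<open>sep\<close> forbids.\<close>
    then have "(x, y) \<in> ?T\<^sup>+"
    proof (induction rule: trancl_induct)
      case (base y)
      then obtain k' where k': "k' < p" "k' \<noteq> k" "precedes (col k') x y" by auto
      have "fst (f k') \<noteq> ?i" using disj[OF k'(1) k, of x] x k' precedes_set[OF k'(3)] by blast
      then show ?case using prec[OF k'(1,3)] fk(1)[OF k'(1)] by (intro r_into_trancl) blast
    next
      case (step y z)
      then obtain k' where k': "k' < p" "k' \<noteq> k" "precedes (col k') y z" by auto
      have "fst (f k') \<noteq> ?i"
      proof
        assume "fst (f k') = ?i"
        then have "y \<in> A ?i" using precedes_set[OF k'(3)] sub[OF k'(1)] by auto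
        then show False using sep[OF _ xi] step.IH by blast
      qed
      then have "(y, z) \<in> ?T" using prec[OF k'(1,3)] fk(1)[OF k'(1)] by blast
      with step.IH show ?case by (rule trancl_into_trancl)
    qed
    moreover have "y \<in> A ?i" using y sub[OF k] by blast
    ultimately show False using sep[OF _ xi] by blast
  qed
  have "length (col k) = l \<and> distinct (col k) \<and> set (col k) \<subseteq> V" if k: "k < p" for k
  proof -
    have "Suc (snd (f k)) * l \<le> card (A (fst (f k)))"
      using fk(2)[OF k] by (metis Suc_leI div_times_less_eq_dividend dual_order.trans mult_le_mono1)
    then have "length (col k) = l" using qd(3)[OF fk(1)[OF k]] by (simp add: col_def)
    moreover have "distinct (col k)" using qd(1)[OF fk(1)[OF k]] by (simp add: col_def)
    moreover have "A (fst (f k)) \<subseteq> V" using A[OF fk(1)[OF k]] ps fk(1)[OF k] by (force simp: path_system_def)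
    ultimately show ?thesis using sub[OF k] by blast
  qed
  then show ?thesis using main by blast
qed

text \<open>A list is sent to a copy of its node according to its rank among the lists through that node.\<close>

lemma split_columns:
  fixes col :: "nat \<Rightarrow> 'v list"
  assumes len: "\<And>k. k < p \<Longrightarrow> length (col k) = l" and dist: "\<And>k. k < p \<Longrightarrow> distinct (col k)"
    and V: "finite V" "\<And>k. k < p \<Longrightarrow> set (col k) \<subseteq> V" and D: "D > 0"
    and sep: "\<And>k x y. k < p \<Longrightarrow> x \<in> set (col k) \<Longrightarrow> y \<in> set (col k) \<Longrightarrow>
      (x, y) \<notin> (\<Union>k'\<in>{..<p} - {k}. {(u, w). precedes (col k') u w})\<^sup>+"
  shows "\<exists>(col' :: nat \<Rightarrow> ('v \<times> nat) list) X. finite X \<and> D * card X \<le> D * card V + p * l \<and>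
    (\<forall>x\<in>X. card {c \<in> {..<p}. x \<in> set (col' c)} \<le> D) \<and>
    (\<forall>k<p. length (col' k) = l \<and> distinct (col' k) \<and> set (col' k) \<subseteq> X \<and>
      (\<forall>x\<in>set (col' k). \<forall>y\<in>set (col' k). (x, y) \<notin> (\<Union>k'\<in>{..<p} - {k}. {(u, w). precedes (col' k') u w})\<^sup>+))"
proof -
  define rank where "rank k v = card {k' \<in> {..<k}. v \<in> set (col k')}" for k v
  define cp where "cp k v = (v, rank k v div D)" for k v
  define col' where "col' k = map (cp k) (col k)" for k
  define X where "X = (\<Union>k<p. set (col' k))"
  define deg where "deg v = card {k \<in> {..<p}. v \<in> set (col k)}" for v
  have fX: "finite X" by (simp add: X_def)
  have rank_less: "rank k v < rank k' v" if "k < k'" "v \<in> set (col k)" for k k' v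
    unfolding rank_def using that by (intro psubset_card_mono) auto
  have rank_deg: "rank k v < deg v" if "k < p" "v \<in> set (col k)" for k v
    unfolding rank_def deg_def using that by (intro psubset_card_mono) auto
  have mem: "(v, c) \<in> set (col' k) \<longleftrightarrow> v \<in> set (col k) \<and> rank k v div D = c" for v c k
    by (auto simp: col'_def cp_def)
  have degX: "card {k \<in> {..<p}. x \<in> set (col' k)} \<le> D" for x
  proof -
    obtain v c where x: "x = (v, c)" by force
    let ?S = "{k \<in> {..<p}. x \<in> set (col' k)}"
    have inj: "inj_on (\<lambda>k. rank k v) ?S"
    proof (rule inj_onI)
      fix k k' assume "k \<in> ?S" "k' \<in> ?S" "rank k v = rank k' v"
      then show "k = k'" using rank_less[of k k' v] rank_less[of k' k v] unfolding x mem by (cases k k' rule: linorder_cases) auto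
    qed
    have "(\<lambda>k. rank k v) ` ?S \<subseteq> {c * D..<c * D + D}"
    proof
      fix t assume "t \<in> (\<lambda>k. rank k v) ` ?S"
      then have "t div D = c" unfolding x mem by auto
      then show "t \<in> {c * D..<c * D + D}" using D
        by (metis atLeastLessThan_iff div_mult_mod_eq le_add1 mod_less_divisor nat_add_left_cancel_less)
    qed
    then have "card ((\<lambda>k. rank k v) ` ?S) \<le> card {c * D..<c * D + D}" by (intro card_mono) auto
    then show ?thesis using inj by (simp add: card_image)
  qed
  have "D * card X \<le> D * card V + p * l"
  proof -
    have "X \<subseteq> (SIGMA v:V. {..deg v div D})"
    proof
      fix x assume "x \<in> X"
      then obtain k v c where h: "k < p" "x = (v, c)" "v \<in> set (col k)" "rank k v div D = c"
        unfolding X_def by (cases x) (auto simp: mem)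
      then have "c \<le> deg v div D" using rank_deg[OF h(1,3)] by (metis div_le_mono less_imp_le)
      then show "x \<in> (SIGMA v:V. {..deg v div D})" using h V(2)[OF h(1)] by auto
    qed
    then have "card X \<le> card (SIGMA v:V. {..deg v div D})" using V by (intro card_mono) auto
    also have "\<dots> = (\<Sum>v\<in>V. deg v div D + 1)" using V by simp
    finally have "D * card X \<le> D * (\<Sum>v\<in>V. deg v div D + 1)" by (rule mult_le_mono2)
    also have "\<dots> = (\<Sum>v\<in>V. D * (deg v div D + 1))" by (rule sum_distrib_left)
    also have "\<dots> \<le> (\<Sum>v\<in>V. deg v + D)" by (intro sum_mono) (simp add: algebra_simps)
    also have "\<dots> = (\<Sum>v\<in>V. deg v) + D * card V" by (simp add: sum.distrib)
    also have "(\<Sum>v\<in>V. deg v) = (\<Sum>k<p. card {v \<in> V. v \<in> set (col k)})"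
      unfolding deg_def using V by (intro sum_multicount_gen) auto
    also have "\<dots> = (\<Sum>k<p. l)"
    proof (rule sum.cong)
      fix k assume "k \<in> {..<p}"
      then have "{v \<in> V. v \<in> set (col k)} = set (col k)" "k < p" using V(2) by auto
      then show "card {v \<in> V. v \<in> set (col k)} = l" using distinct_card[OF dist] len by simp
    qed simp
    finally show ?thesis by simp
  qed
  moreover have "length (col' k) = l \<and> distinct (col' k) \<and> set (col' k) \<subseteq> X \<and>
      (\<forall>x\<in>set (col' k). \<forall>y\<in>set (col' k). (x, y) \<notin> (\<Union>k'\<in>{..<p} - {k}. {(u, w). precedes (col' k') u w})\<^sup>+)"
    if k: "k < p" for k
  proof (intro conjI ballI)
    show "length (col' k) = l" using len[OF k] by (simp add: col'_def)
    show "distinct (col' k)" using dist[OF k] by (auto simp: col'_def distinct_map inj_on_def cp_def)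
    show "set (col' k) \<subseteq> X" using k by (auto simp: X_def)
    have pr: "precedes (col k') (fst u) (fst w)" if "precedes (col' k') u w" for k' u w
      using that unfolding precedes_def col'_def by (force simp: cp_def)
    fix x y assume xy: "x \<in> set (col' k)" "y \<in> set (col' k)"
    show "(x, y) \<notin> (\<Union>k'\<in>{..<p} - {k}. {(u, w). precedes (col' k') u w})\<^sup>+"
    proof
      assume "(x, y) \<in> (\<Union>k'\<in>{..<p} - {k}. {(u, w). precedes (col' k') u w})\<^sup>+"
      then have "(fst x, fst y) \<in> (\<Union>k'\<in>{..<p} - {k}. {(u, w). precedes (col k') u w})\<^sup>+"
      proof (induction rule: trancl_induct)
        case (base y)
        then show ?case using pr by (intro r_into_trancl) fastforce
      next
        case (step y z)
        have "(fst y, fst z) \<in> (\<Union>k'\<in>{..<p} - {k}. {(u, w). precedes (col k') u w})"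
          using step.hyps(2) pr by fastforce
        with step.IH show ?case by (rule trancl_into_trancl)
      qed
      moreover have "fst x \<in> set (col k)" "fst y \<in> set (col k)" using xy mem by (metis prod.collapse)+
      ultimately show False using sep[OF k] by blast
    qed
  qed
  ultimately show ?thesis using fX degX by blast
qed

subsection \<open>The theorem\<close>

lemma exists_acyclic_half:
  fixes n :: nat
  assumes L: "ln (real n) \<ge> 1" and nL: "32 * ln (real n) \<le> real n"
    and ps: "path_system {..<n} Ps" and len: "length Ps = n" and g: "girth_gt {..<n} Ps \<infinity>"
    and B: "8 * ln (real n) * (real n * (1 + 512 * ln (real n) ^ 2 + 2 * ln (4 * real n))) \<le> real (ps_size Ps)"
  shows "\<exists>A. (\<forall>i<n. A i \<subseteq> set (Ps ! i)) \<and> acyclic (restr (path_rel Ps) {..<n} A) \<and>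
    ps_size Ps \<le> 2 * (\<Sum>i<n. card (A i))"
proof -
  let ?L = "ln (real n)" and ?B = "real (ps_size Ps)"
  define A where "A i = set (Ps ! i)" for i
  have n0: "n > 0" using nL L by (cases n) auto
  have sub: "A i \<subseteq> {..<n}" "distinct (Ps ! i)" if "i < n" for i
    using ps that len by (auto simp: path_system_def A_def)
  have size: "ps_size Ps = (\<Sum>i<n. card (A i))"
  proof -
    have "ps_size Ps = (\<Sum>i<n. length (Ps ! i))"
      unfolding ps_size_def by (simp add: sum_list_sum_nth len atLeast0LessThan)
    also have "\<dots> = (\<Sum>i<n. card (A i))"
      using sub(2) by (intro sum.cong refl) (simp add: A_def distinct_card)
    finally show ?thesis .
  qed
  \<comment> \<open>With this length the degree terms of the prices sum to at most B / (8 ln n),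
    hence to B / 4 after the factor log2 n, which is at most 2 ln n. The remaining terms cost
    another B / 4 by the assumption on the size.\<close>
  define m where "m = nat \<lfloor>real n / (32 * ?L)\<rfloor>"
  have x1: "real n / (32 * ?L) \<ge> 1" using nL L by (simp add: field_simps)
  then have f1: "\<lfloor>real n / (32 * ?L)\<rfloor> \<ge> 1" by simp
  then have m_eq: "real m = real_of_int \<lfloor>real n / (32 * ?L)\<rfloor>" by (simp add: m_def)
  have m0: "m > 0" using f1 by (simp add: m_def)
  have m_le: "real m \<le> real n / (32 * ?L)" unfolding m_eq by linarith
  have m_ge: "real n / (64 * ?L) \<le> real m"
  proof -
    have "real_of_int \<lfloor>real n / (32 * ?L)\<rfloor> \<ge> 1" using f1 by linarith
    moreover have "real_of_int \<lfloor>real n / (32 * ?L)\<rfloor> > real n / (32 * ?L) - 1" by linarith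
    ultimately have "2 * real m \<ge> real n / (32 * ?L)" unfolding m_eq by linarith
    then show ?thesis by simp
  qed
  obtain A' where A': "\<forall>i\<in>{..<n}. A' i \<subseteq> A i \<inter> {..<n}" "acyclic (restr (path_rel Ps) {..<n} A')"
    "real (\<Sum>i\<in>{..<n}. card (A i \<inter> {..<n})) \<le> real (\<Sum>i\<in>{..<n}. card (A' i))
      + log 2 (real (card {..<n})) * (\<Sum>v\<in>{..<n}. cut_price A {..<n} n m v)"
  proof -
    have "\<not> rainbow (path_rel Ps) x Q y" if "i \<in> {..<n}" "(x, y) \<in> path_rel Ps i" "Q \<subseteq> {..<n} - {i}" for i x y Q
      using no_rainbow_of_girth[OF ps g, of i x y Q] that len by simp
    moreover have "card {..<n} \<le> n" by simp
    ultimately have "\<exists>A'. (\<forall>i\<in>{..<n}. A' i \<subseteq> A i \<inter> {..<n}) \<and> acyclic (restr (path_rel Ps) {..<n} A') \<and>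
        real (\<Sum>i\<in>{..<n}. card (A i \<inter> {..<n})) \<le> real (\<Sum>i\<in>{..<n}. card (A' i))
        + log 2 (real (card {..<n})) * (\<Sum>v\<in>{..<n}. cut_price A {..<n} n m v)"
      using m0 by (intro acyclic_subsystem) auto
    then obtain A' where "\<forall>i\<in>{..<n}. A' i \<subseteq> A i \<inter> {..<n}" "acyclic (restr (path_rel Ps) {..<n} A')"
      "real (\<Sum>i\<in>{..<n}. card (A i \<inter> {..<n})) \<le> real (\<Sum>i\<in>{..<n}. card (A' i))
        + log 2 (real (card {..<n})) * (\<Sum>v\<in>{..<n}. cut_price A {..<n} n m v)"
      by blast
    then show thesis by (rule that)
  qed
  have 1: "(\<Sum>i\<in>{..<n}. card (A i \<inter> {..<n})) = ps_size Ps"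
    unfolding size using sub(1) by (intro sum.cong refl arg_cong[where f = card]) auto
  have deg: "(\<Sum>v<n. real (card {i \<in> {..<n}. v \<in> A i})) = ?B"
  proof -
    have "(\<Sum>v<n. card {i \<in> {..<n}. v \<in> A i}) = (\<Sum>i<n. card {v \<in> {..<n}. v \<in> A i})"
      by (intro sum_multicount_gen) auto
    also have "\<dots> = (\<Sum>i<n. card (A i))"
      using sub(1) by (intro sum.cong refl arg_cong[where f = card]) auto
    finally show ?thesis using size by (metis of_nat_sum)
  qed
  have "(\<Sum>v<n. cut_price A {..<n} n m v)
      = real n * (1 + 8 * (real n / real m * ?L) + 2 * ln (4 * real n)) + 4 * (real m / real n) * ?B"
  proof -
    have "(\<Sum>v<n. cut_price A {..<n} n m v) = (\<Sum>v<n. (1 + 8 * (real n / real m * ?L) + 2 * ln (4 * real n))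
        + 4 * (real m / real n) * real (card {i \<in> {..<n}. v \<in> A i}))"
      by (intro sum.cong refl) (simp add: cut_price_def algebra_simps)
    also have "\<dots> = real n * (1 + 8 * (real n / real m * ?L) + 2 * ln (4 * real n))
        + 4 * (real m / real n) * (\<Sum>v<n. real (card {i \<in> {..<n}. v \<in> A i}))"
      by (simp add: sum.distrib sum_distrib_left)
    finally show ?thesis unfolding deg .
  qed
  also have "\<dots> \<le> real n * (1 + 512 * ?L ^ 2 + 2 * ln (4 * real n)) + ?B / (8 * ?L)"
  proof -
    have "real n / real m \<le> 64 * ?L" using m_ge m0 L by (simp add: field_simps)
    then have "real n / real m * ?L \<le> 64 * ?L * ?L" using L by (intro mult_right_mono) auto
    then have a: "8 * (real n / real m * ?L) \<le> 512 * ?L ^ 2" by (simp add: power2_eq_square)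
    have "real m / real n \<le> 1 / (32 * ?L)" using m_le n0 L by (simp add: field_simps)
    then have "4 * (real m / real n) * ?B \<le> 4 * (1 / (32 * ?L)) * ?B" by (intro mult_right_mono) auto
    moreover have "real n * (1 + 8 * (real n / real m * ?L) + 2 * ln (4 * real n))
       \<le> real n * (1 + 512 * ?L ^ 2 + 2 * ln (4 * real n))" using a by (intro mult_left_mono) auto
    ultimately show ?thesis by simp
  qed
  finally have cp: "(\<Sum>v<n. cut_price A {..<n} n m v) \<le> real n * (1 + 512 * ?L ^ 2 + 2 * ln (4 * real n)) + ?B / (8 * ?L)" .
  have cp0: "0 \<le> (\<Sum>v<n. cut_price A {..<n} n m v)"
    unfolding cut_price_def using L n0
    by (intro sum_nonneg add_nonneg_nonneg mult_nonneg_nonneg divide_nonneg_nonneg) auto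
  have "log 2 (real n) \<le> 2 * ?L"
  proof -
    have "?L / ln 2 \<le> ?L / (1 / 2)" using ln2_ge_half L by (intro divide_left_mono) auto
    then show ?thesis by (simp add: log_def)
  qed
  then have "log 2 (real n) * (\<Sum>v<n. cut_price A {..<n} n m v)
      \<le> 2 * ?L * (real n * (1 + 512 * ?L ^ 2 + 2 * ln (4 * real n)) + ?B / (8 * ?L))"
    using cp cp0 L by (intro mult_mono) auto
  also have "\<dots> = (8 * ?L * (real n * (1 + 512 * ?L ^ 2 + 2 * ln (4 * real n)))) / 4 + ?B / 4"
  proof -
    have "2 * ?L * (Q + ?B / (8 * ?L)) = 8 * ?L * Q / 4 + ?B / 4" for Q :: real using L by (simp add: field_simps)
    then show ?thesis .
  qed
  also have "\<dots> \<le> ?B / 2" using B by linarith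
  finally have "?B \<le> real (\<Sum>i<n. card (A' i)) + ?B / 2" using A'(3) 1 by simp
  then have "?B \<le> 2 * real (\<Sum>i<n. card (A' i))" by linarith
  then have "ps_size Ps \<le> 2 * (\<Sum>i<n. card (A' i))" by (metis of_nat_le_iff of_nat_mult of_nat_numeral)
  then show ?thesis using A'(1,2) by (intro exI[of _ A']) (auto simp: A_def)
qed

text \<open>The parameters meet here: \<open>l\<close> of order B / n, \<open>h\<close> a fixed
  fraction of \<open>l\<close>, \<open>p\<close> and |X| of order n, and degree \<open>D\<close> of
  order \<open>l\<close>. Then \<open>\<kappa>\<close> is O(ln n / l), and the graph has at most B
  nodes.\<close>

lemma beta_le_SCG_beta:
  fixes n :: nat
  defines "B \<equiv> beta n n \<infinity>"
  assumes L: "ln (real n) \<ge> 1" and nL: "32 * ln (real n) \<le> real n"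
    and B1: "8 * ln (real n) * (real n * (1 + 512 * ln (real n) ^ 2 + 2 * ln (4 * real n))) \<le> real B"
    and B2: "4096 * real n \<le> real B" and B3: "2048 * real n * ln (128 * real n) \<le> real B"
  shows "real B \<le> 4204544 * real n * ln (real n) * real (SCG B)"
proof -
  let ?L = "ln (real n)"
  obtain Ps where ps: "path_system {..<n} Ps" "length Ps = n" "girth_gt {..<n} Ps \<infinity>" "ps_size Ps = B"
    unfolding B_def by (rule beta_attained)
  have n0: "n > 0" using nL L by (cases n) auto
  obtain A where A: "\<And>i. i < n \<Longrightarrow> A i \<subseteq> set (Ps ! i)" "acyclic (restr (path_rel Ps) {..<n} A)"
    "B \<le> 2 * (\<Sum>i<n. card (A i))"
    using exists_acyclic_half[OF L nL ps(1,2,3)] B1 ps(4) by auto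
  define S where "S = (\<Sum>i<n. card (A i))"
  have SB: "S \<le> B"
  proof -
    have "S \<le> (\<Sum>i<n. length (Ps ! i))" unfolding S_def
      by (intro sum_mono) (metis A(1) List.finite_set card_length card_mono lessThan_iff order_trans)
    then show ?thesis using ps(4) unfolding ps_size_def by (simp add: sum_list_sum_nth ps(2) atLeast0LessThan)
  qed
  \<comment> \<open>Discarding less than \<open>l\<close> nodes per path costs at most n l, that is
    B / 64, small against the B / 2 that survive; this leaves at least 31 n pieces.\<close>
  define l where "l = B div (64 * n)"
  have l1: "64 * n * l \<le> B" unfolding l_def by simp
  have l2: "B < 64 * n * (l + 1)" unfolding l_def using n0
    by (metis Suc_eq_plus1 dividend_less_times_div mult_Suc_right add.commute mult_pos_pos zero_less_numeral)
  have B2n: "4096 * n \<le> B" using B2 by (metis of_nat_le_iff of_nat_mult of_nat_numeral)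
  have l32: "l \<ge> 32"
  proof -
    have "64 * n * 64 \<le> B" using B2n by simp
    then have "64 \<le> l" unfolding l_def using n0 by (simp add: less_eq_div_iff_mult_less_eq)
    then show ?thesis by simp
  qed
  have l3: "B \<le> 128 * n * l"
  proof -
    have "B \<le> 64 * n * (l + 1)" using l2 by simp
    also have "\<dots> \<le> 64 * n * (2 * l)" using l32 by (intro mult_le_mono2) simp
    finally show ?thesis by simp
  qed
  have ln_n: "l \<le> n"
  proof -
    have "B \<le> n * n" using ps_size_le[OF ps(1)] ps by simp
    then have "64 * n * l \<le> n * n" using l1 by linarith
    then have "n * (64 * l) \<le> n * n" by (simp add: mult_ac)
    then show ?thesis using n0 by simp
  qed
  define p where "p = (\<Sum>i<n. card (A i) div l)"
  have pl: "p * l \<le> B"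
  proof -
    have "p * l = (\<Sum>i<n. card (A i) div l * l)" unfolding p_def by (rule sum_distrib_right)
    also have "\<dots> \<le> S" unfolding S_def by (intro sum_mono) simp
    finally show ?thesis using SB by simp
  qed
  have p128: "p \<le> 128 * n"
  proof -
    have "p * l \<le> 128 * n * l" using pl l3 by (rule order_trans)
    then show ?thesis using l32 by simp
  qed
  have p31: "31 * n \<le> p"
  proof -
    have "S \<le> (\<Sum>i<n. card (A i) div l * l + l)" unfolding S_def
      using l32 dividend_less_div_times[of l] by (intro sum_mono) (simp add: add.commute less_imp_le)
    also have "\<dots> = p * l + n * l" unfolding p_def by (simp add: sum.distrib sum_distrib_right)
    finally have "2 * S \<le> 2 * (p * l + n * l)" by (rule mult_le_mono2)
    with A(3) have "B \<le> 2 * (p * l + n * l)" unfolding S_def by (rule order_trans)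
    with l1 have "64 * n * l \<le> 2 * (p * l + n * l)" by (rule order_trans)
    then have "31 * n * l \<le> p * l" by simp
    then show ?thesis using l32 by simp
  qed
  have p0: "p > 0" using p31 n0 by linarith
  obtain col where col: "\<And>k. k < p \<Longrightarrow> length (col k) = l" "\<And>k. k < p \<Longrightarrow> distinct (col k)"
    "\<And>k. k < p \<Longrightarrow> set (col k) \<subseteq> {..<n}"
    "\<And>k x y. k < p \<Longrightarrow> x \<in> set (col k) \<Longrightarrow> y \<in> set (col k) \<Longrightarrow>
      (x, y) \<notin> (\<Union>k'\<in>{..<p} - {k}. {(u, w). precedes (col k') u w})\<^sup>+"
  proof -
    have "\<exists>col. \<forall>k<p. length (col k) = l \<and> distinct (col k) \<and> set (col k) \<subseteq> {..<n} \<and>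
      (\<forall>x\<in>set (col k). \<forall>y\<in>set (col k). (x, y) \<notin> (\<Union>k'\<in>{..<p} - {k}. {(u, w). precedes (col k') u w})\<^sup>+)"
      using exists_chunks[OF ps(1,3), of A l, unfolded ps(2), OF A(1,2)] l32 unfolding p_def by simp
    then obtain col where *: "\<forall>k<p. length (col k) = l \<and> distinct (col k) \<and> set (col k) \<subseteq> {..<n} \<and>
      (\<forall>x\<in>set (col k). \<forall>y\<in>set (col k). (x, y) \<notin> (\<Union>k'\<in>{..<p} - {k}. {(u, w). precedes (col k') u w})\<^sup>+)" ..
    show thesis by (rule that[of col]) (use * in blast)+
  qed
  \<comment> \<open>Chosen so that D n exceeds B: splitting then at most doubles the number of
    nodes.\<close>
  define D where "D = 64 * (l + 1)"
  have D0: "D > 0" by (simp add: D_def)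
  obtain col' :: "nat \<Rightarrow> (nat \<times> nat) list" and X where X: "finite X" "D * card X \<le> D * card {..<n} + p * l"
    "\<And>x. x \<in> X \<Longrightarrow> card {c \<in> {..<p}. x \<in> set (col' c)} \<le> D"
    and col': "\<And>k. k < p \<Longrightarrow> length (col' k) = l" "\<And>k. k < p \<Longrightarrow> distinct (col' k)" "\<And>k. k < p \<Longrightarrow> set (col' k) \<subseteq> X"
    "\<And>k x y. k < p \<Longrightarrow> x \<in> set (col' k) \<Longrightarrow> y \<in> set (col' k) \<Longrightarrow>
      (x, y) \<notin> (\<Union>k'\<in>{..<p} - {k}. {(u, w). precedes (col' k') u w})\<^sup>+"
  proof -
    have "\<exists>(col' :: nat \<Rightarrow> (nat \<times> nat) list) X. finite X \<and> D * card X \<le> D * card {..<n} + p * l \<and>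
      (\<forall>x\<in>X. card {c \<in> {..<p}. x \<in> set (col' c)} \<le> D) \<and>
      (\<forall>k<p. length (col' k) = l \<and> distinct (col' k) \<and> set (col' k) \<subseteq> X \<and>
      (\<forall>x\<in>set (col' k). \<forall>y\<in>set (col' k). (x, y) \<notin> (\<Union>k'\<in>{..<p} - {k}. {(u, w). precedes (col' k') u w})\<^sup>+))"
      by (rule split_columns[OF col(1,2) finite_lessThan col(3) D0 col(4)])
    then obtain col' :: "nat \<Rightarrow> (nat \<times> nat) list" and X where *: "finite X" "D * card X \<le> D * card {..<n} + p * l"
      "\<forall>x\<in>X. card {c \<in> {..<p}. x \<in> set (col' c)} \<le> D"
      "\<forall>k<p. length (col' k) = l \<and> distinct (col' k) \<and> set (col' k) \<subseteq> X \<and>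
      (\<forall>x\<in>set (col' k). \<forall>y\<in>set (col' k). (x, y) \<notin> (\<Union>k'\<in>{..<p} - {k}. {(u, w). precedes (col' k') u w})\<^sup>+)"
      by (elim exE conjE) (rule that)
    show thesis by (rule that[of X col']) (use * in blast)+
  qed
  have X2: "card X \<le> 2 * n"
  proof -
    have "D * card X \<le> D * n + B" using X(2) pl by simp
    also have "\<dots> \<le> D * n + D * n" using l2 unfolding D_def by (simp add: algebra_simps)
    also have "\<dots> = D * (2 * n)" by simp
    finally show ?thesis using D0 mult_le_cancel1[of D "card X" "2 * n"] by blast
  qed
  define h where "h = l div 32"
  have h32: "32 * h \<le> l" and h0: "h > 0" using l32 unfolding h_def by auto
  have h64: "l \<le> 64 * h" using l32 unfolding h_def by presburger
  have N: "2 * card X * h + 2 * p \<le> B"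
  proof -
    have "2 * card X * h \<le> 2 * (2 * n) * h" using X2 by (intro mult_le_mono1) simp
    also have "\<dots> = n * (4 * h)" by simp
    also have "\<dots> \<le> n * l" using h32 by (intro mult_le_mono2) simp
    finally have "64 * (2 * card X * h) \<le> B" using l1 by simp
    then show ?thesis using p128 B2n by linarith
  qed
  have lp: "ln (real p) \<le> real l / 16"
  proof -
    have "ln (real p) \<le> ln (128 * real n)" using p128 p0 n0 by (subst ln_le_cancel_iff) (auto simp: of_nat_le_iff[symmetric, where 'a = real] simp del: of_nat_le_iff)
    moreover have "2048 * real n * ln (128 * real n) \<le> 128 * real n * real l"
    proof -
      have "real B \<le> 128 * real n * real l" using l3 by (metis of_nat_le_iff of_nat_mult of_nat_numeral)
      then show ?thesis using B3 by linarith
    qed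
    then have "(128 * real n) * (16 * ln (128 * real n)) \<le> (128 * real n) * real l" by simp
    then have "16 * ln (128 * real n) \<le> real l" using n0 by (subst (asm) mult_le_cancel_left_pos) auto
    ultimately show ?thesis by linarith
  qed
  have lpos: "real l > 0" using l32 by simp
  let ?lam = "real l / 8 - ln (real p)"
  have lam: "?lam \<ge> real l / 16" using lp by linarith
  have lam0: "?lam > 0" using lam lpos by linarith
  let ?\<kappa> = "4 * real D / (real h * real l) + (2 + ln (real (card X * h))) / ?lam"
  have main: "real p \<le> real (SCG B) * ?\<kappa> * real (card X)"
    by (rule SCG_ge_of_columns[OF col'(1,2,3) X(1) p0 h0 h32 X(3) col'(4) lam0 N])
  have k1: "4 * real D / (real h * real l) \<le> 32768 / real l"
  proof -
    have "D \<le> 128 * l" using l32 by (simp add: D_def)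
    also have "\<dots> \<le> 128 * (64 * h)" using h64 by simp
    finally have "real D \<le> 8192 * real h" by linarith
    then show ?thesis using lpos h0 by (simp add: field_simps)
  qed
  have X0: "card X > 0"
  proof -
    have "X \<noteq> {}" using col'(1,3)[OF p0] l32 by (metis list.size(3) not_numeral_le_zero set_empty subset_empty)
    then show ?thesis using X(1) by (simp add: card_gt_0_iff)
  qed
  have k2: "(2 + ln (real (card X * h))) / ?lam \<le> 80 * ?L / real l"
  proof -
    have "card X * h \<le> 2 * n * n" using X2 h32 ln_n by (intro mult_le_mono) auto
    then have "real (card X * h) \<le> 2 * real n * real n" by (metis of_nat_le_iff of_nat_mult of_nat_numeral)
    moreover have "real (card X * h) > 0" using X0 h0 by simp
    ultimately have "ln (real (card X * h)) \<le> ln (2 * real n * real n)" using n0 by (subst ln_le_cancel_iff) auto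
    also have "\<dots> = ln 2 + 2 * ?L" using n0 by (simp add: ln_mult)
    also have "\<dots> \<le> 1 + 2 * ?L" using ln_le_minus_one[of "2 :: real"] by simp
    finally have a: "2 + ln (real (card X * h)) \<le> 5 * ?L" using L by linarith
    have "(2 + ln (real (card X * h))) / ?lam \<le> 5 * ?L / ?lam" using a lam0 by (intro divide_right_mono) auto
    also have "\<dots> \<le> 5 * ?L / (real l / 16)" using lam lpos L by (intro divide_left_mono) auto
    finally show ?thesis by simp
  qed
  have k: "?\<kappa> \<le> 32848 * ?L / real l"
  proof -
    have "32768 / real l \<le> 32768 * ?L / real l" using L lpos by (intro divide_right_mono) auto
    then have "?\<kappa> \<le> 32768 * ?L / real l + 80 * ?L / real l" using k1 k2 by linarith
    then show ?thesis by (simp add: add_divide_distrib[symmetric])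
  qed
  have "31 * real n \<le> real p" using p31 by linarith
  also have "\<dots> \<le> real (SCG B) * (32848 * ?L / real l) * (2 * real n)"
  proof -
    have "real (SCG B) * ?\<kappa> * real (card X) \<le> real (SCG B) * (32848 * ?L / real l) * real (card X)"
      using k by (intro mult_right_mono mult_left_mono) auto
    also have "\<dots> \<le> real (SCG B) * (32848 * ?L / real l) * (2 * real n)"
      using X2 L lpos by (intro mult_left_mono) auto
    finally show ?thesis using main by linarith
  qed
  finally have "31 * real l \<le> 65696 * ?L * real (SCG B)" using n0 lpos by (simp add: field_simps)
  \<comment> \<open>Only 2 of the 31 is used; with B at most 128 n l the final constant is 128 *
    32848 = 4204544.\<close>
  then have "real l \<le> 32848 * ?L * real (SCG B)" using lpos by linarith
  then have "128 * real n * real l \<le> 128 * real n * (32848 * ?L * real (SCG B))" by (intro mult_left_mono) auto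
  moreover have "real B \<le> 128 * real n * real l" using l3 by (metis of_nat_le_iff of_nat_mult of_nat_numeral)
  ultimately have "real B \<le> 128 * real n * (32848 * ?L * real (SCG B))" by linarith
  then show ?thesis by (simp add: mult_ac)
qed

lemma beta_ge_root:
  assumes "n \<ge> 4" shows "real n * (real n / 256) powr (1 / 6) / 256 \<le> real (beta n n \<infinity>)"
proof -
  define T where "T = (GREATEST T. 4 * T ^ 6 \<le> n)"
  have bnd: "T' \<le> n" if "4 * T' ^ 6 \<le> n" for T' :: nat
  proof -
    have "T' \<le> T' ^ 6" by (cases T') (auto intro: self_le_power)
    then show ?thesis using that by linarith
  qed
  have one: "4 * 1 ^ 6 \<le> n" using assms by simp
  have T1: "4 * T ^ 6 \<le> n" unfolding T_def by (rule GreatestI_nat[where P = "\<lambda>T. 4 * T ^ 6 \<le> n", OF one bnd])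
  have T0: "T \<ge> 1" unfolding T_def by (rule Greatest_le_nat[where P = "\<lambda>T. 4 * T ^ 6 \<le> n", OF one bnd])
  \<comment> \<open>\<open>T\<close> is maximal and at least 1, so passing to 2 T costs a factor
    2^6, whence the 256 = 4 * 64.\<close>
  have "n < 4 * Suc T ^ 6"
  proof (rule ccontr)
    assume "\<not> ?thesis"
    then have "4 * Suc T ^ 6 \<le> n" by simp
    then have "Suc T \<le> T" unfolding T_def by (rule Greatest_le_nat[where P = "\<lambda>T. 4 * T ^ 6 \<le> n", OF _ bnd])
    then show False by simp
  qed
  also have "\<dots> \<le> 4 * (2 * T) ^ 6" using T0 by (intro mult_le_mono2 power_mono) auto
  finally have "n < 256 * T ^ 6" by (simp add: power_mult_distrib)
  then have "real n \<le> real (256 * T ^ 6)" by (intro of_nat_mono) simp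
  then have nT: "real n / 256 \<le> real T ^ 6" by simp
  have "(real n / 256) powr (1 / 6) \<le> (real T ^ 6) powr (1 / 6)" using nT by (intro powr_mono2) auto
  also have "\<dots> = real T"
  proof -
    have pow: "real T ^ 6 = real T powr 6" using T0 by (simp add: powr_numeral)
    show ?thesis unfolding pow powr_powr using T0 by simp
  qed
  finally have r: "(real n / 256) powr (1 / 6) \<le> real T" .
  have "(real n / 256) * (real n / 256) powr (1 / 6) \<le> real T ^ 6 * real T"
    using r nT by (intro mult_mono) auto
  also have "\<dots> = real (T ^ 7)" by (simp add: eval_nat_numeral)
  also have "\<dots> \<le> real (beta n n \<infinity>)" using beta_ge_power[OF T1] by simp
  finally show ?thesis by simp
qed

theorem theorem5p15:
  shows "(\<lambda>n. real (SCG (beta n n \<infinity>))) \<in>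
           \<Omega>(\<lambda>n. real (beta n n \<infinity>) / (real n * ln (real n)))"
proof (rule landau_omega.bigI[of "1 / 4204544"])
  have "eventually (\<lambda>x::real. 1 \<le> ln x) at_top" by real_asymp
  then have e1: "eventually (\<lambda>n. 1 \<le> ln (real n)) sequentially"
    by (rule eventually_compose_filterlim[OF _ filterlim_real_sequentially])
  have "eventually (\<lambda>x::real. 32 * ln x \<le> x) at_top" by real_asymp
  then have e2: "eventually (\<lambda>n. 32 * ln (real n) \<le> real n) sequentially"
    by (rule eventually_compose_filterlim[OF _ filterlim_real_sequentially])
  \<comment> \<open>This and the next two comparisons put the size thresholds of
    \<open>beta_le_SCG_beta\<close> below the bound of \<open>beta_ge_root\<close>: n^(1/6) beats
    every power of log n.\<close>
  have "eventually (\<lambda>x::real. 8 * ln x * (x * (1 + 512 * ln x ^ 2 + 2 * ln (4 * x))) \<le> x * (x / 256) powr (1 / 6) / 256) at_top"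
    by real_asymp
  then have e3: "eventually (\<lambda>n. 8 * ln (real n) * (real n * (1 + 512 * ln (real n) ^ 2 + 2 * ln (4 * real n)))
      \<le> real n * (real n / 256) powr (1 / 6) / 256) sequentially"
    by (rule eventually_compose_filterlim[OF _ filterlim_real_sequentially])
  have "eventually (\<lambda>x::real. 4096 * x \<le> x * (x / 256) powr (1 / 6) / 256) at_top" by real_asymp
  then have e4: "eventually (\<lambda>n. 4096 * real n \<le> real n * (real n / 256) powr (1 / 6) / 256) sequentially"
    by (rule eventually_compose_filterlim[OF _ filterlim_real_sequentially])
  have "eventually (\<lambda>x::real. 2048 * x * ln (128 * x) \<le> x * (x / 256) powr (1 / 6) / 256) at_top" by real_asymp
  then have e5: "eventually (\<lambda>n. 2048 * real n * ln (128 * real n) \<le> real n * (real n / 256) powr (1 / 6) / 256) sequentially"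
    by (rule eventually_compose_filterlim[OF _ filterlim_real_sequentially])
  show "\<forall>\<^sub>F n in sequentially. norm (real (SCG (beta n n \<infinity>))) \<ge>
      1 / 4204544 * norm (real (beta n n \<infinity>) / (real n * ln (real n)))"
    using e1 e2 e3 e4 e5 eventually_ge_at_top[of 4]
  proof eventually_elim
    case (elim n)
    have "real (beta n n \<infinity>) \<le> 4204544 * real n * ln (real n) * real (SCG (beta n n \<infinity>))"
      using elim beta_ge_root[of n] by (intro beta_le_SCG_beta) linarith+
    moreover have "real n * ln (real n) > 0" using elim by auto
    ultimately show ?case by (simp add: field_simps)
  qed
qed simp

end
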